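(* Let $\ell\ge3$. The tuple $(Y_\ell,\mathcal G_\ell,B_\ell,\mathcal Q_\ell,\rightharpoondown)$ is a generic biquandle factorization of the quandle $Q_\ell$, which is a sub-quandle of the quandle $\mathrm{Conj}(\mathrm{SL}_2(\mathbb C))\times_{\mathrm{Cb}_r}\mathbb C$.
   Context: **Colored diagrams.** A quandle is a set $Q$ with an operation $\rhd$ such that $a\rhd(b\rhd c)=(a\rhd b)\rhd(a\rhd c)$; for all $a,b$ there is a unique $c$ with $a=b\rhd c$; $a\rhd a=a$. $W_X$ is the free monoid on pairs $(x,\epsilon)$, $x\in X$, $\epsilon=\pm$. Oriented framed tangle diagrams in $(0,\infty)\times[0,1]$ are read bottom to top; edges are arcs cut at all crossings. Drawn upward, a crossing is positive if the strand from bottom-left to top-right is over, negative if the strand from bottom-right to top-left is over. $Q$-coloring: positive crossing with bottom colors $(a,b)$ has top colors $(a\rhd b,a)$; negative crossing with bottom $(a\rhd b,a)$ has top $(a,b)$. $\mathcal D_Q$: tensor category with objects $W_Q$, morphisms planar isotopy classes of $Q$-colored diagrams (sign $+$ upward, $-$ downward boundary edges). Quandle automorphisms act on $\mathcal D_Q$ via colors. **Generic biquandle factorization.** Let $Y$ be a set and $\mathcal G$ a set of subsets of $Y$ with $Y\in\mathcal G$, $\emptyset\notin\mathcal G$, closed under pairwise intersection. A partial map $A\to B$ is a map from a subset of $A$ to $B$. A generic bijection of $Y$ is a bijection $f:Z_1\to Z_2$, $Z_i\in\mathcal G$, such that $f(Z\cap Z_1),f^{-1}(Z\cap Z_2)\in\mathcal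 G$ for all $Z\in\mathcal G$. A statement holds for generic $x$ if it holds on some $Z\in\mathcal G$. A generic biquandle factorization of $(Q,\rhd)$ is a tuple $(Y,\mathcal G,B,\mathcal Q,\rightharpoondown)$ with partial maps $B,S,B^{-1},S^{-1}:Y\times Y\to Y\times Y$ such that: (1) $(x_4,x_3)=B(x_1,x_2)\iff(x_1,x_2)=B^{-1}(x_4,x_3)\iff(x_3,x_2)=S(x_4,x_1)\iff(x_4,x_1)=S^{-1}(x_3,x_2)$; (2) for all $x\in Y$ the maps $B_1^{\pm1}(x,\cdot),B_2^{\pm1}(\cdot,x),S_1^{\pm1}(x,\cdot),S_2^{\pm1}(\cdot,x)$ (components of $B^{\pm1},S^{\pm1}$) are generic bijections; (3) there is a map $Y\to\mathrm{Aut}(Q,\rhd)$, $x\mapsto(x\rightharpoondown\cdot)$; (4) $\mathcal D_Y$ being the category of $Y$-colored diagrams (positive crossing: bottom $(x_1,x_2)$, top $(x_4,x_3)=B(x_1,x_2)$; negative: bottom $(x_4,x_3)$, top $(x_1,x_2)$ with $B(x_1,x_2)=(x_4,x_3)$; $B$ required to be defined there), there is a functor $\mathcal Q:\mathcal D_Y\to\mathcal D_Q$ inducing the identity on underlying diagrams, injective on $Y$-colored diagrams, with $\mathcal Q((x,\pm)\otimes w)=\mathcal Q((x,\pm))\otimes(x\rightharpoondown\cdot)^{\pm1}(\mathcal Q(w))$ for $x\in Y$, $w\in W_Y$; (5) for any $D\in\mathcal D_Q$, $\mathcal Q^{-1}(x\rightharpoondown D)$ exists for generic $x$. **The data.** $r=\ell/2$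 if $\ell$ is even, $r=\ell$ if $\ell$ is odd; $\mathrm{Cb}_r$ is the polynomial determined by $\mathrm{Cb}_r(2\cos\theta)=2\cos(r\theta)$. The quandle $\mathrm{Conj}(\mathrm{SL}_2(\mathbb C))\times_{\mathrm{Cb}_r}\mathbb C$ is the set of pairs $(m,z)$ with $m\in\mathrm{SL}_2(\mathbb C)$, $z\in\mathbb C$ and $\mathrm{trace}(m)=\mathrm{Cb}_r(z)$, with $(m,z)\rhd(m',z')=(m^{-1}m'm,z')$. Then $$Q_\ell=\{(m,z):\mathrm{trace}(m)=\mathrm{Cb}_r(z)\neq\pm2\}\cup\{((-1)^{r-1}\mathrm{Id}_{2\times2},\,2(-1)^{\ell-1})\}$$ with the same operation. $G^*$ is the group of pairs $\left(\begin{pmatrix}\kappa&0\\\varphi&1\end{pmatrix},\begin{pmatrix}1&\varepsilon\\0&\kappa\end{pmatrix}\right)$, $\kappa\in\mathbb C^*,\varepsilon,\varphi\in\mathbb C$, with projections $\varphi_+,\varphi_-$ to the first, second matrix, and $\psi(y)=\varphi_+(y)\varphi_-(y)^{-1}$, a bijection from $G^*$ onto $G'=\{m\in\mathrm{SL}_2(\mathbb C):m_{11}\ne0\}$. The partial map $B$ on $G^*\times G^*$ is $B(y_1,y_2)=(y_4,y_3)$ with $y_4=\psi^{-1}(\varphi_-(y_1)\psi(y_2)\varphi_-(y_1)^{-1})$, $y_3=\psi^{-1}(\varphi_+(y_4)^{-1}\psi(y_1)\varphi_+(y_4))$ (defined when the arguments of $\psi^{-1}$ lie in $G'$). $$Y_\ell=\{(y,z)\in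 G^*\times\mathbb C:\mathrm{trace}(\psi(y))=\mathrm{Cb}_r(z)\neq\pm2\}\cup\{(\psi^{-1}((-1)^{r-1}\mathrm{Id}_{2\times2}),\,2(-1)^{\ell-1})\}.$$ $B_\ell((y_1,z),(y_2,z'))=((y_4,z'),(y_3,z))$ whenever $B(y_1,y_2)=(y_4,y_3)$ is defined; $B_\ell^{-1}$ and $S_\ell^{\pm1}$ are determined from $B_\ell$ by the equivalences in (1). $\mathcal G_\ell=\{(Z\times\mathbb C)\cap Y_\ell:Z\subset G^*\text{ nonempty Zariski open}\}$. $(y,z)\rightharpoondown(m,t)=(\varphi_+(y)m\varphi_+(y)^{-1},t)$. The functor $\mathcal Q_\ell:\mathcal D_{Y_\ell}\to\mathcal D_{Q_\ell}$ keeps underlying diagrams and replaces the color $(y,z)$ of an edge $e$ by $(h\psi(y)h^{-1},z)$, $h=\varphi_+(y_1)^{\epsilon_1}\cdots\varphi_+(y_n)^{\epsilon_n}$, where a generic planar path from the leftmost region to the region on the left of $e$ (w.r.t. its orientation) crosses successively edges colored $(y_1,z_1),\dots,(y_n,z_n)$, $\epsilon_j=+1$ if the $j$-th edge is crossed from its left to its right and $-1$ otherwise.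
   Formalization: For even ℓ the exceptional point violates trace(m)=Cb_r(z), so the sub-quandle clause as printed is proved only for odd ℓ (and refuted for even ℓ); the factorization is proved as printed for all ℓ≥3, and both claims are also proved with trace(m)=(-1)^{ℓ-1}Cb_r(z). *)

theory Defs
  imports "HOL-Analysis.Analysis" "HOL-Computational_Algebra.Polynomial"
begin

section \<open>Quandles\<close>

definition quandle :: "'q set \<Rightarrow> ('q \<Rightarrow> 'q \<Rightarrow> 'q) \<Rightarrow> bool" where
  "quandle Q f \<longleftrightarrow>
     (\<forall>a\<in>Q. \<forall>b\<in>Q. f a b \<in> Q) \<and>
     (\<forall>a\<in>Q. \<forall>b\<in>Q. \<forall>c\<in>Q. f a (f b c) = f (f a b) (f a c)) \<and>
     (\<forall>a\<in>Q. \<forall>b\<in>Q. \<exists>!c. c \<in> Q \<and> a = f b c) \<and>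
     (\<forall>a\<in>Q. f a a = a)"

definition subquandle :: "'q set \<Rightarrow> 'q set \<Rightarrow> ('q \<Rightarrow> 'q \<Rightarrow> 'q) \<Rightarrow> bool" where
  "subquandle Q' Q f \<longleftrightarrow> quandle Q f \<and> quandle Q' f \<and> Q' \<subseteq> Q"

definition quandle_aut :: "'q set \<Rightarrow> ('q \<Rightarrow> 'q \<Rightarrow> 'q) \<Rightarrow> ('q \<Rightarrow> 'q) \<Rightarrow> bool" where
  "quandle_aut Q f h \<longleftrightarrow> bij_betw h Q Q \<and> (\<forall>a\<in>Q. \<forall>b\<in>Q. h (f a b) = f (h a) (h b))"

section \<open>Colored tangle diagrams\<close>

text \<open>
  Diagrams are put in generic position with respect to the height, so that each is a finite stack
  of slices, read bottom to top; a slice contains one crossing, one local minimum (a cup) or one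
  local maximum (a cap), and otherwise vertical strands.  Between consecutive slices, a horizontal
  line meets the diagram in a word of colored, signed points; the sign \<open>True\<close> stands for \<open>+\<close>
  (upward), \<open>False\<close> for \<open>-\<close> (downward).  Framings are blackboard framings.
\<close>

type_synonym 'c point = "'c \<times> bool"
type_synonym 'c word = "'c point list"

text \<open>
  \<open>Crossing e k\<close> is obtained from the crossing of sign \<open>e\<close> with both strands drawn upward by \<open>k\<close>
  clockwise quarter turns (\<open>k < 4\<close>).  For \<open>Cup s\<close> and \<open>Cap s\<close>, \<open>s\<close> is the sign of the left end.
\<close>

datatype piece = Crossing bool nat | Cup bool | Cap bool

text \<open>
  A slice \<open>(n, p)\<close> is the piece \<open>p\<close> with \<open>n\<close> vertical strands to its left.  A diagram with \<open>k\<close> slices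
  has \<open>k + 1\<close> levels, from the bottom boundary to the top boundary.  Its underlying uncolored
  diagram is its image under \<open>map_diagram (\<lambda>_. ())\<close>, which keeps signs and slices.
\<close>

datatype 'c diagram =
  Diagram (levels: "('c \<times> bool) list list") (slices: "(nat \<times> piece) list")

definition flip :: "'c point \<Rightarrow> 'c point" where
  "flip x = (fst x, \<not> snd x)"

text \<open>
  \<open>piece_colored B p b t\<close>: the piece \<open>p\<close> may carry the word \<open>b\<close> at its bottom and \<open>t\<close> at its top.
  Under a clockwise quarter turn the bottom left end becomes the top left end and the top right
  end becomes the bottom right end.
\<close>

inductive piece_colored :: "('c \<times> 'c \<rightharpoonup> 'c \<times> 'c) \<Rightarrow> piece \<Rightarrow> 'c word \<Rightarrow> 'c word \<Rightarrow> bool"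
  for B where
  cup: "piece_colored B (Cup s) [] [(c, s), (c, \<not> s)]"
| cap: "piece_colored B (Cap s) [(c, s), (c, \<not> s)] []"
| positive: "B (x1, x2) = Some (x4, x3) \<Longrightarrow>
    piece_colored B (Crossing True 0) [(x1, True), (x2, True)] [(x4, True), (x3, True)]"
| negative: "B (x1, x2) = Some (x4, x3) \<Longrightarrow>
    piece_colored B (Crossing False 0) [(x4, True), (x3, True)] [(x1, True), (x2, True)]"
| quarter_turn: "piece_colored B (Crossing e k) [x, x'] [y, y'] \<Longrightarrow> k < 3 \<Longrightarrow>
    piece_colored B (Crossing e (Suc k)) [x', flip y'] [flip x, y]"

definition slice_colored ::
  "('c \<times> 'c \<rightharpoonup> 'c \<times> 'c) \<Rightarrow> nat \<times> piece \<Rightarrow> 'c word \<Rightarrow> 'c word \<Rightarrow> bool" where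
  "slice_colored B s w w' \<longleftrightarrow>
     (\<exists>u b t v. length u = fst s \<and> w = u @ b @ v \<and> w' = u @ t @ v \<and> piece_colored B (snd s) b t)"

definition words :: "'c set \<Rightarrow> 'c word set" where
  "words X = lists (X \<times> UNIV)"

definition colored_diagrams :: "'c set \<Rightarrow> ('c \<times> 'c \<rightharpoonup> 'c \<times> 'c) \<Rightarrow> 'c diagram set" where
  "colored_diagrams X B =
     {D. length (levels D) = Suc (length (slices D)) \<and> set (levels D) \<subseteq> words X \<and>
         (\<forall>i<length (slices D). slice_colored B (slices D ! i) (levels D ! i) (levels D ! Suc i))}"

definition source :: "'c diagram \<Rightarrow> 'c word" where
  "source D = hd (levels D)"

definition target :: "'c diagram \<Rightarrow> 'c word" where
  "target D = last (levels D)"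

text \<open>\<open>stack D E\<close> puts \<open>E\<close> on top of \<open>D\<close>; it is meant for \<open>target D = source E\<close>.\<close>

definition stack :: "'c diagram \<Rightarrow> 'c diagram \<Rightarrow> 'c diagram" where
  "stack D E = Diagram (levels D @ tl (levels E)) (slices D @ slices E)"

text \<open>
  Planar isotopy of diagrams in generic position is generated by interchanging the heights of two
  pieces lying side by side, by straightening a strand, and by turning a crossing.  These are the
  relations of the free strict pivotal category on the two upward crossings; sliding a crossing past
  a cup or a cap, and the counterclockwise turns, follow.
\<close>

inductive elementary_isotopy ::
  "('c \<times> 'c \<rightharpoonup> 'c \<times> 'c) \<Rightarrow> 'c diagram \<Rightarrow> 'c diagram \<Rightarrow> bool" for B where
  interchange: "piece_colored B p b t \<Longrightarrow> piece_colored B p' b' t' \<Longrightarrow>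
    elementary_isotopy B
      (Diagram [u @ b @ w @ b' @ v, u @ t @ w @ b' @ v, u @ t @ w @ t' @ v]
               [(length u, p), (length (u @ t @ w), p')])
      (Diagram [u @ b @ w @ b' @ v, u @ b @ w @ t' @ v, u @ t @ w @ t' @ v]
               [(length (u @ b @ w), p'), (length u, p)])"
| zigzag_right: "elementary_isotopy B
      (Diagram [u @ [(c, s)] @ v, u @ [(c, s), (c, \<not> s), (c, s)] @ v, u @ [(c, s)] @ v]
               [(Suc (length u), Cup (\<not> s)), (length u, Cap s)])
      (Diagram [u @ [(c, s)] @ v] [])"
| zigzag_left: "elementary_isotopy B
      (Diagram [u @ [(c, s)] @ v, u @ [(c, s), (c, \<not> s), (c, s)] @ v, u @ [(c, s)] @ v]
               [(length u, Cup s), (Suc (length u), Cap (\<not> s))])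
      (Diagram [u @ [(c, s)] @ v] [])"
| turn: "piece_colored B (Crossing e k) [x, x'] [y, y'] \<Longrightarrow>
    elementary_isotopy B
      (Diagram [u @ [x', flip y'] @ v, u @ [flip x, y] @ v]
               [(length u, Crossing e (Suc k mod 4))])
      (Diagram [u @ [x', flip y'] @ v, u @ [flip x, x, x', flip y'] @ v,
                u @ [flip x, y, y', flip y'] @ v, u @ [flip x, y] @ v]
               [(length u, Cup (\<not> snd x)), (Suc (length u), Crossing e k),
                (Suc (Suc (length u)), Cap (snd y'))])"

inductive isotopy_step ::
  "'c set \<Rightarrow> ('c \<times> 'c \<rightharpoonup> 'c \<times> 'c) \<Rightarrow> 'c diagram \<Rightarrow> 'c diagram \<Rightarrow> bool" for X B where
  "elementary_isotopy B L R \<Longrightarrow> {P, L, R, U} \<subseteq> colored_diagrams X B \<Longrightarrow>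
   target P = source L \<Longrightarrow> target L = source U \<Longrightarrow>
   isotopy_step X B (stack (stack P L) U) (stack (stack P R) U)"

definition isotopy :: "'c set \<Rightarrow> ('c \<times> 'c \<rightharpoonup> 'c \<times> 'c) \<Rightarrow> 'c diagram rel" where
  "isotopy X B = {(D, E). D \<in> colored_diagrams X B \<and> E \<in> colored_diagrams X B \<and>
                          equivclp (isotopy_step X B) D E}"

section \<open>The categories of colored diagrams\<close>

record ('o, 'm) category =
  Obj :: "'o set"
  Mor :: "'m set"
  Src :: "'m \<Rightarrow> 'o"
  Tgt :: "'m \<Rightarrow> 'o"
  Idt :: "'o \<Rightarrow> 'm"
  Cmp :: "'m \<Rightarrow> 'm \<Rightarrow> 'm"

definition is_category :: "('o, 'm) category \<Rightarrow> bool" where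
  "is_category C \<longleftrightarrow>
     (\<forall>f\<in>Mor C. Src C f \<in> Obj C \<and> Tgt C f \<in> Obj C) \<and>
     (\<forall>a\<in>Obj C. Idt C a \<in> Mor C \<and> Src C (Idt C a) = a \<and> Tgt C (Idt C a) = a) \<and>
     (\<forall>f\<in>Mor C. \<forall>g\<in>Mor C. Tgt C f = Src C g \<longrightarrow>
        Cmp C g f \<in> Mor C \<and> Src C (Cmp C g f) = Src C f \<and> Tgt C (Cmp C g f) = Tgt C g) \<and>
     (\<forall>f\<in>Mor C. Cmp C f (Idt C (Src C f)) = f \<and> Cmp C (Idt C (Tgt C f)) f = f) \<and>
     (\<forall>f\<in>Mor C. \<forall>g\<in>Mor C. \<forall>h\<in>Mor C. Tgt C f = Src C g \<and> Tgt C g = Src C h \<longrightarrow>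
        Cmp C h (Cmp C g f) = Cmp C (Cmp C h g) f)"

definition is_functor ::
  "('o, 'm) category \<Rightarrow> ('p, 'n) category \<Rightarrow> ('o \<Rightarrow> 'p) \<Rightarrow> ('m \<Rightarrow> 'n) \<Rightarrow> bool" where
  "is_functor C D Fo Fm \<longleftrightarrow> is_category C \<and> is_category D \<and>
     (\<forall>a\<in>Obj C. Fo a \<in> Obj D \<and> Fm (Idt C a) = Idt D (Fo a)) \<and>
     (\<forall>f\<in>Mor C. Fm f \<in> Mor D \<and> Src D (Fm f) = Fo (Src C f) \<and> Tgt D (Fm f) = Fo (Tgt C f)) \<and>
     (\<forall>f\<in>Mor C. \<forall>g\<in>Mor C. Tgt C f = Src C g \<longrightarrow> Fm (Cmp C g f) = Cmp D (Fm g) (Fm f))"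

definition diagram_category ::
  "'c set \<Rightarrow> ('c \<times> 'c \<rightharpoonup> 'c \<times> 'c) \<Rightarrow> ('c word, 'c diagram set) category" where
  "diagram_category X B =
     \<lparr> Obj = words X,
       Mor = colored_diagrams X B // isotopy X B,
       Src = (\<lambda>f. the_elem (source ` f)),
       Tgt = (\<lambda>f. the_elem (target ` f)),
       Idt = (\<lambda>w. isotopy X B `` {Diagram [w] []}),
       Cmp = (\<lambda>g f. \<Union>D\<in>f. \<Union>E\<in>g. isotopy X B `` {stack D E}) \<rparr>"

definition quandle_braiding :: "'q set \<Rightarrow> ('q \<Rightarrow> 'q \<Rightarrow> 'q) \<Rightarrow> ('q \<times> 'q \<rightharpoonup> 'q \<times> 'q)" where
  "quandle_braiding Q f = (\<lambda>(a, b). if a \<in> Q \<and> b \<in> Q then Some (f a b, a) else None)"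

text \<open>
  The map induced on isotopy classes by a map \<open>F\<close> on diagrams.  If \<open>F\<close> does not respect isotopy,
  the union below is not an isotopy class.
\<close>

definition on_classes ::
  "'d set \<Rightarrow> ('d \<times> 'd \<rightharpoonup> 'd \<times> 'd) \<Rightarrow> ('c diagram \<Rightarrow> 'd diagram) \<Rightarrow> 'c diagram set \<Rightarrow> 'd diagram set" where
  "on_classes X B F f = (\<Union>D\<in>f. isotopy X B `` {F D})"

section \<open>Generic biquandle factorizations\<close>

definition genericity_system :: "'y set \<Rightarrow> 'y set set \<Rightarrow> bool" where
  "genericity_system Y G \<longleftrightarrow>
     G \<subseteq> Pow Y \<and> Y \<in> G \<and> {} \<notin> G \<and> (\<forall>Z\<in>G. \<forall>Z'\<in>G. Z \<inter> Z' \<in> G)"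

definition generic_bijection :: "'y set set \<Rightarrow> ('y \<rightharpoonup> 'y) \<Rightarrow> bool" where
  "generic_bijection G f \<longleftrightarrow>
     dom f \<in> G \<and> ran f \<in> G \<and> inj_on f (dom f) \<and>
     (\<forall>Z\<in>G. {y. \<exists>x\<in>Z. f x = Some y} \<in> G \<and> {x. \<exists>y\<in>Z. f x = Some y} \<in> G)"

definition partial_map_on :: "'y set \<Rightarrow> ('y \<times> 'y \<rightharpoonup> 'y \<times> 'y) \<Rightarrow> bool" where
  "partial_map_on Y F \<longleftrightarrow> dom F \<subseteq> Y \<times> Y \<and> ran F \<subseteq> Y \<times> Y"

text \<open>\<open>F\<^sub>1(x,\<cdot>)\<close> and \<open>F\<^sub>2(\<cdot>,x)\<close>.\<close>

definition left_component :: "('y \<times> 'y \<rightharpoonup> 'y \<times> 'y) \<Rightarrow> 'y \<Rightarrow> ('y \<rightharpoonup> 'y)" where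
  "left_component F x = (\<lambda>y. map_option fst (F (x, y)))"

definition right_component :: "('y \<times> 'y \<rightharpoonup> 'y \<times> 'y) \<Rightarrow> 'y \<Rightarrow> ('y \<rightharpoonup> 'y)" where
  "right_component F x = (\<lambda>y. map_option snd (F (y, x)))"

definition generic_biquandle :: "'y set \<Rightarrow> 'y set set \<Rightarrow> ('y \<times> 'y \<rightharpoonup> 'y \<times> 'y) \<Rightarrow> bool" where
  "generic_biquandle Y G B \<longleftrightarrow> genericity_system Y G \<and>
     (\<exists>B' S S'.
        (\<forall>F\<in>{B, B', S, S'}. partial_map_on Y F) \<and>
        (\<forall>x1\<in>Y. \<forall>x2\<in>Y. \<forall>x3\<in>Y. \<forall>x4\<in>Y.
           (B (x1, x2) = Some (x4, x3) \<longleftrightarrow> B' (x4, x3) = Some (x1, x2)) \<and>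
           (B (x1, x2) = Some (x4, x3) \<longleftrightarrow> S (x4, x1) = Some (x3, x2)) \<and>
           (B (x1, x2) = Some (x4, x3) \<longleftrightarrow> S' (x3, x2) = Some (x4, x1))) \<and>
        (\<forall>F\<in>{B, B', S, S'}. \<forall>x\<in>Y.
           generic_bijection G (left_component F x) \<and> generic_bijection G (right_component F x)))"

definition signed_action :: "'q set \<Rightarrow> ('y \<Rightarrow> 'q \<Rightarrow> 'q) \<Rightarrow> 'y point \<Rightarrow> 'q \<Rightarrow> 'q" where
  "signed_action Q act x = (if snd x then act (fst x) else the_inv_into Q (act (fst x)))"

text \<open>
  The functor is given by its values \<open>Fo\<close> on objects and \<open>Fd\<close> on diagrams: since it keeps the
  underlying diagrams and only changes their colors, it comes from a map on diagrams.  Injectivity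
  is required both for diagrams and for isotopy classes of diagrams.
\<close>

definition generic_biquandle_factorization ::
  "'y set \<Rightarrow> 'y set set \<Rightarrow> ('y \<times> 'y \<rightharpoonup> 'y \<times> 'y) \<Rightarrow>
   ('y word \<Rightarrow> 'q word) \<Rightarrow> ('y diagram \<Rightarrow> 'q diagram) \<Rightarrow> ('y \<Rightarrow> 'q \<Rightarrow> 'q) \<Rightarrow>
   'q set \<Rightarrow> ('q \<Rightarrow> 'q \<Rightarrow> 'q) \<Rightarrow> bool" where
  "generic_biquandle_factorization Y G B Fo Fd act Q f \<longleftrightarrow>
     quandle Q f \<and>
     generic_biquandle Y G B \<and>
     (\<forall>x\<in>Y. quandle_aut Q f (act x)) \<and>
     (let BQ = quandle_braiding Q f; DY = diagram_category Y B; DQ = diagram_category Q BQ;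
          Fm = on_classes Q BQ Fd
      in is_functor DY DQ Fo Fm \<and>
         (\<forall>D\<in>colored_diagrams Y B. Fd D \<in> colored_diagrams Q BQ \<and>
            map_diagram (\<lambda>_. ()) (Fd D) = map_diagram (\<lambda>_. ()) D) \<and>
         inj_on Fd (colored_diagrams Y B) \<and> inj_on Fm (Mor DY) \<and>
         (\<forall>x\<in>Y. \<forall>s. \<forall>w\<in>words Y.
            Fo ((x, s) # w) = Fo [(x, s)] @ map (map_prod (signed_action Q act (x, s)) id) (Fo w)) \<and>
         (\<forall>D\<in>colored_diagrams Q BQ. \<exists>Z\<in>G. \<forall>x\<in>Z.
            map_diagram (act x) D \<in> Fd ` colored_diagrams Y B))"

section \<open>The data\<close>

type_synonym mat2 = "complex^2^2"

definition rr :: "nat \<Rightarrow> nat" where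
  "rr l = (if even l then l div 2 else l)"

definition Cb :: "nat \<Rightarrow> complex poly" where
  "Cb r = (THE p. \<forall>\<theta>::complex. poly p (2 * cos \<theta>) = 2 * cos (of_nat r * \<theta>))"

text \<open>
  With \<open>\<sigma> = 1\<close> the following definitions use the relation \<open>trace m = Cb\<^sub>r(z)\<close>.  For even \<open>l\<close> the
  exceptional point of \<open>Q_ell 1 l\<close> does not satisfy it: its first entry has trace \<open>2(-1)\<^sup>r\<^sup>-\<^sup>1\<close>, but
  \<open>Cb\<^sub>r(-2) = 2(-1)\<^sup>r\<close>.  It satisfies the relation \<open>trace m = (-1)\<^sup>l\<^sup>-\<^sup>1 Cb\<^sub>r(z)\<close>, which is the one with
  \<open>\<sigma> = (-1)\<^sup>l\<^sup>-\<^sup>1\<close>.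
\<close>

definition conj_Cb :: "complex \<Rightarrow> nat \<Rightarrow> (mat2 \<times> complex) set" where
  "conj_Cb \<sigma> r = {(m, z). det m = 1 \<and> trace m = \<sigma> * poly (Cb r) z}"

definition conj_op :: "mat2 \<times> complex \<Rightarrow> mat2 \<times> complex \<Rightarrow> mat2 \<times> complex" where
  "conj_op = (\<lambda>(m, z) (m', z'). (matrix_inv m ** m' ** m, z'))"

definition exceptional_matrix :: "nat \<Rightarrow> mat2" where
  "exceptional_matrix l = mat ((-1) ^ (rr l - 1))"

definition exceptional_value :: "nat \<Rightarrow> complex" where
  "exceptional_value l = 2 * (-1) ^ (l - 1)"

definition Q_ell :: "complex \<Rightarrow> nat \<Rightarrow> (mat2 \<times> complex) set" where
  "Q_ell \<sigma> l = {(m, z). (m, z) \<in> conj_Cb \<sigma> (rr l) \<and> trace m \<notin> {2, -2}} \<union>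
               {(exceptional_matrix l, exceptional_value l)}"

type_synonym gstar = "mat2 \<times> mat2"

definition Gstar :: "gstar set" where
  "Gstar = {(vector [vector [\<kappa>, 0], vector [\<phi>, 1]], vector [vector [1, \<epsilon>], vector [0, \<kappa>]])
            | \<kappa> \<epsilon> \<phi>. \<kappa> \<noteq> 0}"

abbreviation phi_plus :: "gstar \<Rightarrow> mat2" where "phi_plus \<equiv> fst"
abbreviation phi_minus :: "gstar \<Rightarrow> mat2" where "phi_minus \<equiv> snd"

definition psi :: "gstar \<Rightarrow> mat2" where
  "psi y = phi_plus y ** matrix_inv (phi_minus y)"

definition Gprime :: "mat2 set" where
  "Gprime = {m. det m = 1 \<and> m $ 1 $ 1 \<noteq> 0}"

abbreviation psi_inv :: "mat2 \<Rightarrow> gstar" where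
  "psi_inv \<equiv> the_inv_into Gstar psi"

definition B_star :: "gstar \<times> gstar \<rightharpoonup> gstar \<times> gstar" where
  "B_star = (\<lambda>(y1, y2).
     let m4 = phi_minus y1 ** psi y2 ** matrix_inv (phi_minus y1);
         y4 = psi_inv m4;
         m3 = matrix_inv (phi_plus y4) ** psi y1 ** phi_plus y4
     in if y1 \<in> Gstar \<and> y2 \<in> Gstar \<and> m4 \<in> Gprime \<and> m3 \<in> Gprime
        then Some (y4, psi_inv m3) else None)"

type_synonym ycolor = "gstar \<times> complex"

definition Y_ell :: "complex \<Rightarrow> nat \<Rightarrow> ycolor set" where
  "Y_ell \<sigma> l = {(y, z). y \<in> Gstar \<and> trace (psi y) = \<sigma> * poly (Cb (rr l)) z \<and>
                        trace (psi y) \<notin> {2, -2}} \<union>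
               {(psi_inv (exceptional_matrix l), exceptional_value l)}"

definition B_ell :: "complex \<Rightarrow> nat \<Rightarrow> ycolor \<times> ycolor \<rightharpoonup> ycolor \<times> ycolor" where
  "B_ell \<sigma> l = (\<lambda>((y1, z), (y2, z')).
     if (y1, z) \<in> Y_ell \<sigma> l \<and> (y2, z') \<in> Y_ell \<sigma> l
     then map_option (\<lambda>(y4, y3). ((y4, z'), (y3, z))) (B_star (y1, y2)) else None)"

text \<open>
  \<open>Gstar\<close> has the coordinates \<open>\<kappa> \<noteq> 0\<close>, \<open>\<epsilon>\<close>, \<open>\<phi>\<close>.  An element of \<open>complex poly poly poly\<close> is a
  polynomial in three variables; negative powers of the unit \<open>\<kappa>\<close> would define no further open sets.
\<close>

definition zariski_open :: "gstar set \<Rightarrow> bool" where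
  "zariski_open Z \<longleftrightarrow> (\<exists>P :: complex poly poly poly set.
     Z = {y \<in> Gstar. \<exists>p\<in>P. poly (poly (poly p [:[:phi_plus y $ 1 $ 1:]:])
                                     [:phi_minus y $ 1 $ 2:]) (phi_plus y $ 2 $ 1) \<noteq> 0})"

definition G_ell :: "complex \<Rightarrow> nat \<Rightarrow> ycolor set set" where
  "G_ell \<sigma> l = {(Z \<times> UNIV) \<inter> Y_ell \<sigma> l | Z. zariski_open Z \<and> Z \<noteq> {}}"

definition act_ell :: "ycolor \<Rightarrow> mat2 \<times> complex \<Rightarrow> mat2 \<times> complex" where
  "act_ell = (\<lambda>(y, z) (m, t). (phi_plus y ** m ** matrix_inv (phi_plus y), t))"

section \<open>The functor\<close>

text \<open>
  Position \<open>(i, k)\<close> is the gap at level \<open>i\<close> with exactly \<open>k\<close> points to its left.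
  \<open>gap_connected s k k'\<close>: inside slice \<open>s\<close>, the gap \<open>k\<close> below and the gap \<open>k'\<close> above belong to the
  same region, since both lie to the left, or both to the right, of the piece.
\<close>

fun bottom_ends :: "piece \<Rightarrow> nat" where
  "bottom_ends (Crossing _ _) = 2" | "bottom_ends (Cup _) = 0" | "bottom_ends (Cap _) = 2"

fun top_ends :: "piece \<Rightarrow> nat" where
  "top_ends (Crossing _ _) = 2" | "top_ends (Cup _) = 2" | "top_ends (Cap _) = 0"

definition gap_connected :: "nat \<times> piece \<Rightarrow> nat \<Rightarrow> nat \<Rightarrow> bool" where
  "gap_connected = (\<lambda>(n, p) k k'. (k \<le> n \<and> k' = k) \<or>
     (\<exists>j. k = n + bottom_ends p + j \<and> k' = n + top_ends p + j))"

text \<open>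
  \<open>edge_holonomy x rightward\<close> is \<open>\<phi>\<^sub>+(y)\<^sup>\<epsilon>\<close> for crossing the point \<open>x\<close> horizontally: rightward, an
  upward edge is crossed from its left to its right and a downward edge from its right to its left.
\<close>

definition edge_holonomy :: "ycolor point \<Rightarrow> bool \<Rightarrow> mat2" where
  "edge_holonomy x rightward =
     (if snd x = rightward then phi_plus (fst (fst x)) else matrix_inv (phi_plus (fst (fst x))))"

text \<open>
  \<open>planar_path D (i, k) h\<close>: some generic planar path from the leftmost region to the gap \<open>(i, k)\<close>
  has the product \<open>h\<close>.
\<close>

inductive planar_path :: "ycolor diagram \<Rightarrow> nat \<times> nat \<Rightarrow> mat2 \<Rightarrow> bool" for D where
  leftmost: "i < length (levels D) \<Longrightarrow> planar_path D (i, 0) (mat 1)"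
| right: "planar_path D (i, k) h \<Longrightarrow> k < length (levels D ! i) \<Longrightarrow>
    planar_path D (i, Suc k) (h ** edge_holonomy (levels D ! i ! k) True)"
| left: "planar_path D (i, Suc k) h \<Longrightarrow> k < length (levels D ! i) \<Longrightarrow>
    planar_path D (i, k) (h ** edge_holonomy (levels D ! i ! k) False)"
| up: "planar_path D (i, k) h \<Longrightarrow> i < length (slices D) \<Longrightarrow> gap_connected (slices D ! i) k k' \<Longrightarrow>
    planar_path D (Suc i, k') h"
| down: "planar_path D (Suc i, k') h \<Longrightarrow> i < length (slices D) \<Longrightarrow>
    gap_connected (slices D ! i) k k' \<Longrightarrow> planar_path D (i, k) h"

definition region_holonomy :: "ycolor diagram \<Rightarrow> nat \<times> nat \<Rightarrow> mat2" where
  "region_holonomy D g = (THE h. planar_path D g h)"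

text \<open>The region on the left of a downward edge is the gap to the right of its point.\<close>

definition recolor_point :: "ycolor diagram \<Rightarrow> nat \<Rightarrow> nat \<Rightarrow> (mat2 \<times> complex) point" where
  "recolor_point D i j =
     (let ((y, z), s) = levels D ! i ! j;
          h = region_holonomy D (i, if s then j else Suc j)
      in ((h ** psi y ** matrix_inv h, z), s))"

definition Q_diagram :: "ycolor diagram \<Rightarrow> (mat2 \<times> complex) diagram" where
  "Q_diagram D = Diagram
     (map (\<lambda>i. map (recolor_point D i) [0..<length (levels D ! i)]) [0..<length (levels D)])
     (slices D)"

definition Q_object :: "ycolor word \<Rightarrow> (mat2 \<times> complex) word" where
  "Q_object w = source (Q_diagram (Diagram [w] []))"

end

theory Submission
  imports Defs
begin

text \<open>
  Color the regions of a \<open>Y\<close>-colored diagram by elements of \<open>G\<^sup>*\<close>, starting with \<open>1\<close> on the left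
  and multiplying by the color of each strand crossed.  The relation \<open>B(y\<^sub>1, y\<^sub>2) = (y\<^sub>4, y\<^sub>3)\<close> says that
  \<open>y\<^sub>1 y\<^sub>2 = y\<^sub>4 y\<^sub>3\<close> in \<open>G\<^sup>*\<close> and that the functor maps it to the conjugation relation, so the labels are
  well defined.  If \<open>g\<close>, \<open>g'\<close> are the labels to the left and to the right of an upward edge, its new
  color is \<open>\<psi>(g') \<psi>(g)\<inverse>\<close>.  Conversely, a \<open>Q\<close>-coloring labels the regions by matrices of determinant
  \<open>1\<close>, and it comes from a \<open>Y\<close>-coloring iff all these matrices lie in \<open>G'\<close>.  Planar isotopies do
  not change the set of labels; therefore this inverse operation respects isotopy, and the functor
  is injective on isotopy classes.  Conjugating by a generic \<open>\<phi>\<^sub>+(y)\<close> moves finitely many matrices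
  into \<open>G'\<close>.

  In coordinates, \<open>B\<close> is given by
  \<open>\<kappa>\<^sub>4 = \<kappa>\<^sub>2 + \<epsilon>\<^sub>1 \<phi>\<^sub>2\<close>, \<open>\<kappa>\<^sub>1 \<kappa>\<^sub>2 = \<kappa>\<^sub>4 \<kappa>\<^sub>3\<close>, \<open>\<phi>\<^sub>4 = \<kappa>\<^sub>1 \<phi>\<^sub>2\<close>, \<open>\<epsilon>\<^sub>1 = \<epsilon>\<^sub>3 \<kappa>\<^sub>4\<close>,
  \<open>\<phi>\<^sub>1 \<kappa>\<^sub>2 + \<phi>\<^sub>2 = \<phi>\<^sub>4 \<kappa>\<^sub>3 + \<phi>\<^sub>3\<close>, \<open>\<epsilon>\<^sub>2 + \<epsilon>\<^sub>1 \<kappa>\<^sub>2 = \<epsilon>\<^sub>3 + \<epsilon>\<^sub>4 \<kappa>\<^sub>3\<close>,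
  which is birational between any two opposite colors when one of the other two colors is fixed.
\<close>

section \<open>Categories of diagrams\<close>

text \<open>Two facts shape the proof: \<open>psi\<close> is not a homomorphism, and its image
  misses the matrices with zero corner entry. Both passages between colorings are therefore
  instances of one automaton, the locale \<open>recoloring\<close>, whose states are region labels
  and whose partiality is confined to a set \<open>Good\<close> of labels: all of
  \<open>Gstar\<close> in one direction, \<open>Gprime\<close> in the other. For genericity, B, S
  and their inverses have eight components, but a crossing is a single relation among four colors.
  Fixing one color leaves a relation between the two ends of the other strand; these four relations
  and their converses give all eight components. The entry \<open>z\<close> travels unchanged along
  strands, so every openness question is settled on \<open>Gstar\<close>. The sign \<sigma> is
  carried through because the exceptional point fits the trace relation only for one value of it,
  depending on the parity of \<open>l\<close>. The factorization meets \<sigma> only through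
  surjectivity of \<sigma> times the Chebyshev polynomial; the inclusion of quandles depends on its
  exact value.\<close>

lemma flip_simps [simp]:
  "flip (flip x) = x" "flip (c, e) = (c, \<not> e)" "fst (flip x) = fst x" "snd (flip x) = (\<not> snd x)"
  by (auto simp: flip_def)

text \<open>\<open>inv\<close> is an equivalence so that steps run backwards along a zigzag also
  stay inside \<open>P\<close>. Hence a map that respects steps only on \<open>P\<close> still
  respects the generated equivalence, which serves recolorings that are defined for some diagrams
  only.\<close>

lemma equivclp_transfer:
  assumes "equivclp r a b" and "P a"
    and inv: "\<And>x y. r x y \<Longrightarrow> P x \<longleftrightarrow> P y"
    and hom: "\<And>x y. r x y \<Longrightarrow> P x \<Longrightarrow> r' (f x) (f y)"
  shows "P b \<and> equivclp r' (f a) (f b)"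
  using assms(1)
proof (induction rule: equivclp_induct)
  case base
  show ?case using \<open>P a\<close> by simp
next
  case (step y z)
  then have "P y" "P z" using inv by auto
  with step hom have "equivclp r' (f y) (f z)"
    by (meson equivclp_sym r_into_equivclp)
  with step \<open>P z\<close> show ?case by (meson equivclp_trans)
qed

lemma colored_diagrams_iff:
  "D \<in> colored_diagrams X B \<longleftrightarrow>
     length (levels D) = Suc (length (slices D)) \<and> (\<forall>w\<in>set (levels D). w \<in> words X) \<and>
     (\<forall>i<length (slices D). slice_colored B (slices D ! i) (levels D ! i) (levels D ! Suc i))"
  by (auto simp: colored_diagrams_def)

lemma colored_levels_nonempty: "D \<in> colored_diagrams X B \<Longrightarrow> levels D \<noteq> []"
  by (auto simp: colored_diagrams_iff)

lemma stack_assoc: "levels E \<noteq> [] \<Longrightarrow> stack (stack D E) F = stack D (stack E F)"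
  by (simp add: stack_def)

lemma levels_stack_nonempty: "levels D \<noteq> [] \<Longrightarrow> levels (stack D E) \<noteq> []"
  by (simp add: stack_def)

lemma source_stack: "levels D \<noteq> [] \<Longrightarrow> source (stack D E) = source D"
  by (simp add: stack_def source_def)

lemma target_stack:
  "levels E \<noteq> [] \<Longrightarrow> target D = source E \<Longrightarrow> target (stack D E) = target E"
  by (cases "levels E") (auto simp: stack_def target_def source_def)

lemma source_in_words: "D \<in> colored_diagrams X B \<Longrightarrow> source D \<in> words X"
  and target_in_words: "D \<in> colored_diagrams X B \<Longrightarrow> target D \<in> words X"
  using colored_levels_nonempty[of D X B]
  by (auto simp: colored_diagrams_iff source_def target_def)

lemma identity_colored: "w \<in> words X \<Longrightarrow> Diagram [w] [] \<in> colored_diagrams X B"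
  by (simp add: colored_diagrams_iff)

text \<open>The common boundary word is stored once, as the top level of \<open>D\<close>. The index
  facts \<open>low\<close> and \<open>high\<close> overlap at \<open>?n\<close>, and this overlap is
  where \<open>target D = source E\<close> enters.\<close>

lemma stack_colored:
  assumes D: "D \<in> colored_diagrams X B" and E: "E \<in> colored_diagrams X B"
    and eq: "target D = source E"
  shows "stack D E \<in> colored_diagrams X B"
proof -
  let ?n = "length (slices D)"
  have lD: "length (levels D) = Suc ?n" and lE: "length (levels E) = Suc (length (slices E))"
    using D E by (auto simp: colored_diagrams_iff)
  have low: "levels (stack D E) ! i = levels D ! i" if "i \<le> ?n" for i
    using that lD by (simp add: stack_def nth_append)
  have high: "levels (stack D E) ! (?n + j) = levels E ! j" if "j \<le> length (slices E)" for j
  proof (cases j)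
    case 0
    then show ?thesis using eq low[of ?n] lD lE
      by (simp add: target_def source_def last_conv_nth hd_conv_nth flip: length_greater_0_conv)
  next
    case (Suc k)
    then show ?thesis using that lD lE by (simp add: stack_def nth_append nth_tl)
  qed
  have "slice_colored B (slices (stack D E) ! i) (levels (stack D E) ! i) (levels (stack D E) ! Suc i)"
    if i: "i < length (slices (stack D E))" for i
  proof (cases "i < ?n")
    case True
    then have "slices (stack D E) ! i = slices D ! i" by (simp add: stack_def nth_append)
    then show ?thesis using True D low[of i] low[of "Suc i"] by (simp add: colored_diagrams_iff)
  next
    case False
    then obtain j where j: "i = ?n + j" using le_Suc_ex not_less by blast
    then have jl: "j < length (slices E)" using i by (simp add: stack_def)
    have "slices (stack D E) ! i = slices E ! j" using j by (simp add: stack_def nth_append)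
    then show ?thesis using jl E high[of j] high[of "Suc j"] j by (simp add: colored_diagrams_iff)
  qed
  moreover have "set (tl (levels E)) \<subseteq> set (levels E)" using lE by (cases "levels E") auto
  ultimately show ?thesis
    using D E lD lE by (auto simp: colored_diagrams_iff) (auto simp: stack_def)
qed

section \<open>Isotopy as a congruence for stacking\<close>

lemma elementary_isotopy_ends:
  "elementary_isotopy B L R \<Longrightarrow> source L = source R \<and> target L = target R"
  by (induction rule: elementary_isotopy.induct) (auto simp: source_def target_def)

lemma isotopy_step_colored:
  assumes "isotopy_step X B D E"
  shows "D \<in> colored_diagrams X B" "E \<in> colored_diagrams X B"
    "source D = source E" "target D = target E"
proof -
  from assms obtain P L R U where *: "D = stack (stack P L) U" "E = stack (stack P R) U"
    "elementary_isotopy B L R" "{P, L, R, U} \<subseteq> colored_diagrams X B"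
    "target P = source L" "target L = source U"
    by (auto elim: isotopy_step.cases)
  have LR: "source L = source R" "target L = target R"
    using elementary_isotopy_ends[OF *(3)] by auto
  have ne: "levels P \<noteq> []" "levels L \<noteq> []" "levels R \<noteq> []" "levels U \<noteq> []"
    using *(4) colored_levels_nonempty by auto
  have c: "stack P L \<in> colored_diagrams X B" "stack P R \<in> colored_diagrams X B"
    using * LR by (auto intro: stack_colored)
  have t: "target (stack P L) = target L" "target (stack P R) = target L"
    using * LR ne by (auto simp: target_stack)
  show "D \<in> colored_diagrams X B" "E \<in> colored_diagrams X B"
    using * c t by (auto intro!: stack_colored)
  have "levels (stack P L) \<noteq> []" "levels (stack P R) \<noteq> []"
    using ne by (auto simp: stack_def)
  then show "source D = source E" "target D = target E"
    using * t ne by (auto simp: source_stack target_stack)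
qed

text \<open>The extra diagram is absorbed into the upper context \<open>U\<close> of the step, by
  associativity of stacking.\<close>

lemma isotopy_step_stack_right:
  assumes "isotopy_step X B D D'" "E \<in> colored_diagrams X B" "target D = source E"
  shows "isotopy_step X B (stack D E) (stack D' E)"
proof -
  from assms(1) obtain P L R U where *: "D = stack (stack P L) U" "D' = stack (stack P R) U"
    "elementary_isotopy B L R" "{P, L, R, U} \<subseteq> colored_diagrams X B"
    "target P = source L" "target L = source U"
    by (auto elim: isotopy_step.cases)
  have ne: "levels P \<noteq> []" "levels L \<noteq> []" "levels U \<noteq> []"
    using *(4) colored_levels_nonempty by auto
  have "target D = target U"
    using * ne by (simp add: target_stack)
  then have "{P, L, R, stack U E} \<subseteq> colored_diagrams X B" "target L = source (stack U E)"
    using * assms ne by (auto intro: stack_colored simp: source_stack)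
  with *(3,5) show ?thesis
    unfolding *(1,2) using isotopy_step.intros[of B L R P "stack U E" X] ne
    by (simp add: stack_assoc levels_stack_nonempty)
qed

lemma isotopy_step_stack_left:
  assumes "isotopy_step X B E E'" "D \<in> colored_diagrams X B" "target D = source E"
  shows "isotopy_step X B (stack D E) (stack D E')"
proof -
  from assms(1) obtain P L R U where *: "E = stack (stack P L) U" "E' = stack (stack P R) U"
    "elementary_isotopy B L R" "{P, L, R, U} \<subseteq> colored_diagrams X B"
    "target P = source L" "target L = source U"
    by (auto elim: isotopy_step.cases)
  have ne: "levels P \<noteq> []" "levels L \<noteq> []" "levels R \<noteq> []" "levels U \<noteq> []"
    "levels (stack P L) \<noteq> []" "levels (stack P R) \<noteq> []"
    using *(4) colored_levels_nonempty by (auto simp: stack_def)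
  have "source E = source P"
    using * ne by (simp add: source_stack)
  then have "{stack D P, L, R, U} \<subseteq> colored_diagrams X B" "target (stack D P) = source L"
    using * assms ne by (auto intro: stack_colored simp: target_stack)
  with *(3,6) show ?thesis
    unfolding *(1,2) using isotopy_step.intros[of B L R "stack D P" U X] ne
    by (simp add: stack_assoc levels_stack_nonempty)
qed

lemma isotopy_equiv: "equiv (colored_diagrams X B) (isotopy X B)"
proof (rule equivI)
  show "refl_on (colored_diagrams X B) (isotopy X B)"
    by (simp add: refl_on_def isotopy_def)
  show "sym (isotopy X B)"
    by (simp add: sym_def isotopy_def equivclp_sym)
  show "trans (isotopy X B)"
    unfolding trans_def isotopy_def by (blast intro: equivclp_trans)
  show "isotopy X B \<subseteq> colored_diagrams X B \<times> colored_diagrams X B"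
    by (auto simp: isotopy_def)
qed

lemma isotopy_ends:
  assumes "(D, E) \<in> isotopy X B"
  shows "D \<in> colored_diagrams X B" "E \<in> colored_diagrams X B"
    "source D = source E" "target D = target E"
proof -
  show "D \<in> colored_diagrams X B" "E \<in> colored_diagrams X B"
    using assms by (auto simp: isotopy_def)
  have "equivclp (isotopy_step X B) D E" using assms by (auto simp: isotopy_def)
  from equivclp_transfer[OF this, of "\<lambda>F. source D = source F \<and> target D = target F" "\<lambda>_ _. True" id]
  show "source D = source E" "target D = target E"
    using isotopy_step_colored by metis+
qed

text \<open>The two factors are changed one after the other. In each half the invariant given to
  \<open>equivclp_transfer\<close> is that the boundary words still match, which holds because steps
  fix the boundary.\<close>

lemma isotopy_stack:
  assumes D: "(D, D') \<in> isotopy X B" and E: "(E, E') \<in> isotopy X B" and eq: "target D = source E"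
  shows "(stack D E, stack D' E') \<in> isotopy X B"
proof -
  note c = isotopy_ends[OF D] isotopy_ends[OF E]
  have 1: "equivclp (isotopy_step X B) (stack D E) (stack D' E)"
    using equivclp_transfer[of "isotopy_step X B" D D' "\<lambda>F. target F = source E"
        "isotopy_step X B" "\<lambda>F. stack F E"] D eq c isotopy_step_colored isotopy_step_stack_right
    by (metis (mono_tags, lifting) case_prodD isotopy_def mem_Collect_eq)
  have 2: "equivclp (isotopy_step X B) (stack D' E) (stack D' E')"
    using equivclp_transfer[of "isotopy_step X B" E E' "\<lambda>F. target D' = source F"
        "isotopy_step X B" "\<lambda>F. stack D' F"] E eq c isotopy_step_colored isotopy_step_stack_left
    by (metis (mono_tags, lifting) case_prodD isotopy_def mem_Collect_eq)
  from 1 2 have "equivclp (isotopy_step X B) (stack D E) (stack D' E')" by (rule equivclp_trans)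
  moreover have "stack D E \<in> colored_diagrams X B" "stack D' E' \<in> colored_diagrams X B"
    using c eq by (auto intro!: stack_colored)
  ultimately show ?thesis by (simp add: isotopy_def)
qed

section \<open>Isotopy classes as morphisms\<close>

abbreviation isotopy_class where "isotopy_class X B D \<equiv> isotopy X B `` {D}"

lemma isotopy_class_self: "D \<in> colored_diagrams X B \<Longrightarrow> D \<in> isotopy_class X B D"
  using isotopy_equiv by (rule equiv_class_self)

lemma isotopy_class_eq: "(D, E) \<in> isotopy X B \<Longrightarrow> isotopy_class X B D = isotopy_class X B E"
  using isotopy_equiv by (rule equiv_class_eq)

lemma Mor_diagram_category_cases:
  assumes "f \<in> Mor (diagram_category X B)"
  obtains D where "D \<in> colored_diagrams X B" "f = isotopy_class X B D"
  using assms by (auto simp: diagram_category_def elim: quotientE)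

lemma class_in_Mor:
  "D \<in> colored_diagrams X B \<Longrightarrow> isotopy_class X B D \<in> Mor (diagram_category X B)"
  by (auto simp: diagram_category_def intro: quotientI)

lemma UN2_constant:
  assumes "a \<in> A" "b \<in> B" "\<And>x y. x \<in> A \<Longrightarrow> y \<in> B \<Longrightarrow> h x y = c"
  shows "(\<Union>x\<in>A. \<Union>y\<in>B. h x y) = c"
  using assms by blast

text \<open>\<open>the_elem\<close> returns the source because isotopy keeps it, so the image of a
  class is a singleton.\<close>

lemma Src_class: "D \<in> colored_diagrams X B \<Longrightarrow> Src (diagram_category X B) (isotopy_class X B D) = source D"
proof -
  assume D: "D \<in> colored_diagrams X B"
  have "source E = source D" if "E \<in> isotopy_class X B D" for E
    using that isotopy_ends(3)[of D E X B] by simp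
  then have "source ` isotopy_class X B D = {source D}"
    using isotopy_class_self[OF D] by blast
  then show ?thesis by (simp add: diagram_category_def)
qed

lemma Tgt_class: "D \<in> colored_diagrams X B \<Longrightarrow> Tgt (diagram_category X B) (isotopy_class X B D) = target D"
proof -
  assume D: "D \<in> colored_diagrams X B"
  have "target E = target D" if "E \<in> isotopy_class X B D" for E
    using that isotopy_ends(4)[of D E X B] by simp
  then have "target ` isotopy_class X B D = {target D}"
    using isotopy_class_self[OF D] by blast
  then show ?thesis by (simp add: diagram_category_def)
qed

text \<open>Composition is a union over all pairs of representatives. By
  \<open>isotopy_stack\<close> every member of the union is the same class, so the union collapses
  to it.\<close>

lemma Cmp_class:
  assumes D: "D \<in> colored_diagrams X B" and E: "E \<in> colored_diagrams X B"
    and eq: "target D = source E"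
  shows "Cmp (diagram_category X B) (isotopy_class X B E) (isotopy_class X B D) =
         isotopy_class X B (stack D E)"
proof -
  have "isotopy_class X B (stack D' E') = isotopy_class X B (stack D E)"
    if "(D, D') \<in> isotopy X B" "(E, E') \<in> isotopy X B" for D' E'
    using isotopy_class_eq[OF isotopy_stack[OF that eq]] by simp
  then have "(\<Union>D'\<in>isotopy_class X B D. \<Union>E'\<in>isotopy_class X B E. isotopy_class X B (stack D' E')) =
      isotopy_class X B (stack D E)"
    by (intro UN2_constant[OF isotopy_class_self[OF D] isotopy_class_self[OF E]]) simp
  then show ?thesis by (simp add: diagram_category_def)
qed

lemma stack_identity:
  "levels D \<noteq> [] \<Longrightarrow> stack (Diagram [source D] []) D = D"
  "stack D (Diagram [w] []) = D"
  by (cases D; auto simp: stack_def source_def)+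

lemma source_target_identity [simp]: "source (Diagram [w] []) = w" "target (Diagram [w] []) = w"
  by (simp_all add: source_def target_def)

lemma diagram_category_is_category: "is_category (diagram_category X B)"
proof -
  let ?C = "diagram_category X B"
  have Obj: "Obj ?C = words X" and Idt: "Idt ?C w = isotopy_class X B (Diagram [w] [])" for w
    by (simp_all add: diagram_category_def)
  show ?thesis
    unfolding is_category_def
  proof (intro conjI ballI impI)
    fix f assume "f \<in> Mor ?C"
    then obtain D where D: "D \<in> colored_diagrams X B" "f = isotopy_class X B D"
      by (rule Mor_diagram_category_cases)
    show "Src ?C f \<in> Obj ?C" "Tgt ?C f \<in> Obj ?C"
      using D source_in_words target_in_words by (auto simp: Src_class Tgt_class Obj)
    have "Diagram [source D] [] \<in> colored_diagrams X B" "Diagram [target D] [] \<in> colored_diagrams X B"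
      using D source_in_words target_in_words identity_colored by blast+
    then show "Cmp ?C f (Idt ?C (Src ?C f)) = f" "Cmp ?C (Idt ?C (Tgt ?C f)) f = f"
      using D colored_levels_nonempty[OF D(1)]
      by (auto simp: Src_class Tgt_class Idt Cmp_class stack_identity)
    fix g assume "g \<in> Mor ?C"
    then obtain E where E: "E \<in> colored_diagrams X B" "g = isotopy_class X B E"
      by (rule Mor_diagram_category_cases)
    {
      assume "Tgt ?C f = Src ?C g"
      then have eq: "target D = source E" using D E by (simp add: Src_class Tgt_class)
      have DE: "stack D E \<in> colored_diagrams X B"
        using D E eq by (simp add: stack_colored)
      show "Cmp ?C g f \<in> Mor ?C" "Src ?C (Cmp ?C g f) = Src ?C f" "Tgt ?C (Cmp ?C g f) = Tgt ?C g"
        using D E eq DE colored_levels_nonempty[OF D(1)] colored_levels_nonempty[OF E(1)]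
        by (auto simp: Cmp_class Src_class Tgt_class source_stack target_stack intro: class_in_Mor)
    }
    fix h assume "h \<in> Mor ?C"
    then obtain F where F: "F \<in> colored_diagrams X B" "h = isotopy_class X B F"
      by (rule Mor_diagram_category_cases)
    assume "Tgt ?C f = Src ?C g \<and> Tgt ?C g = Src ?C h"
    then have eq: "target D = source E" "target E = source F"
      using D E F by (auto simp: Src_class Tgt_class)
    have "stack D E \<in> colored_diagrams X B" "stack E F \<in> colored_diagrams X B"
      using D E F eq by (auto simp: stack_colored)
    then show "Cmp ?C h (Cmp ?C g f) = Cmp ?C (Cmp ?C h g) f"
      using D E F eq colored_levels_nonempty[OF D(1)] colored_levels_nonempty[OF E(1)]
      by (auto simp: Cmp_class source_stack target_stack stack_assoc)
  next
    fix w assume "w \<in> Obj ?C"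
    then have "Diagram [w] [] \<in> colored_diagrams X B" by (simp add: Obj identity_colored)
    then show "Idt ?C w \<in> Mor ?C" "Src ?C (Idt ?C w) = w" "Tgt ?C (Idt ?C w) = w"
      by (auto simp: Idt Src_class Tgt_class intro: class_in_Mor)
  qed
qed

lemma words_simps [simp]:
  "[] \<in> words X" "x # w \<in> words X \<longleftrightarrow> fst x \<in> X \<and> w \<in> words X"
  "u @ v \<in> words X \<longleftrightarrow> u \<in> words X \<and> v \<in> words X"
  by (cases x; auto simp: words_def)+

lemma piece_colored_lengths:
  "piece_colored B p b t \<Longrightarrow> length b = bottom_ends p \<and> length t = top_ends p"
  by (induction rule: piece_colored.induct) auto

text \<open>
  A recoloring reads each level word from left to right as an automaton whose states label the
  regions: \<open>step\<close> gives the label on the other side of a point, and \<open>col\<close> the new color of the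
  point.  It makes sense where all labels lie in \<open>Good\<close>.
\<close>

locale recoloring =
  fixes X :: "'c set" and B :: "'c \<times> 'c \<rightharpoonup> 'c \<times> 'c"
    and X' :: "'d set" and B' :: "'d \<times> 'd \<rightharpoonup> 'd \<times> 'd"
    and S :: "'s set" and Good :: "'s set"
    and step :: "'s \<Rightarrow> 'c point \<Rightarrow> 's" and col :: "'s \<Rightarrow> 'c point \<Rightarrow> 'd"
  assumes partial_map: "partial_map_on X B"
    and step_closed: "s \<in> S \<Longrightarrow> fst x \<in> X \<Longrightarrow> step s x \<in> S"
    and step_flip: "s \<in> S \<Longrightarrow> fst x \<in> X \<Longrightarrow> step (step s x) (flip x) = s"
    and col_flip: "s \<in> S \<Longrightarrow> fst x \<in> X \<Longrightarrow> col (step s x) (flip x) = col s x"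
    and col_in: "s \<in> S \<Longrightarrow> fst x \<in> X \<Longrightarrow> s \<in> Good \<Longrightarrow> step s x \<in> Good \<Longrightarrow> col s x \<in> X'"
    and crossing_step: "s \<in> S \<Longrightarrow> B (x1, x2) = Some (x4, x3) \<Longrightarrow>
      step (step s (x1, True)) (x2, True) = step (step s (x4, True)) (x3, True)"
    and crossing_col: "s \<in> S \<Longrightarrow> B (x1, x2) = Some (x4, x3) \<Longrightarrow>
      {s, step s (x1, True), step (step s (x1, True)) (x2, True), step s (x4, True)} \<subseteq> Good \<Longrightarrow>
      B' (col s (x1, True), col (step s (x1, True)) (x2, True)) =
        Some (col s (x4, True), col (step s (x4, True)) (x3, True))"
begin

primrec recolor :: "'s \<Rightarrow> 'c word \<Rightarrow> 'd word" where
  "recolor s [] = []"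
| "recolor s (x # w) = (col s x, snd x) # recolor (step s x) w"

primrec regions :: "'s \<Rightarrow> 'c word \<Rightarrow> 's set" where
  "regions s [] = {s}"
| "regions s (x # w) = insert s (regions (step s x) w)"

abbreviation final :: "'s \<Rightarrow> 'c word \<Rightarrow> 's" where
  "final \<equiv> foldl step"

definition recolor_diagram :: "'s \<Rightarrow> 'c diagram \<Rightarrow> 'd diagram" where
  "recolor_diagram s D = Diagram (map (recolor s) (levels D)) (slices D)"

definition diagram_regions :: "'s \<Rightarrow> 'c diagram \<Rightarrow> 's set" where
  "diagram_regions s D = (\<Union>w\<in>set (levels D). regions s w)"

lemma recolor_append [simp]: "recolor s (u @ v) = recolor s u @ recolor (final s u) v"
  by (induction u arbitrary: s) auto

lemma start_in_regions [simp]: "s \<in> regions s w"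
  by (cases w) auto

lemma regions_append [simp]: "regions s (u @ v) = regions s u \<union> regions (final s u) v"
  by (induction u arbitrary: s) auto

lemma length_recolor [simp]: "length (recolor s w) = length w"
  by (induction w arbitrary: s) auto

lemma final_closed: "s \<in> S \<Longrightarrow> w \<in> words X \<Longrightarrow> final s w \<in> S"
  by (induction w arbitrary: s) (auto simp: step_closed)

lemma nth_recolor:
  "j < length w \<Longrightarrow> recolor s w ! j = (col (final s (take j w)) (w ! j), snd (w ! j))"
  by (induction w arbitrary: s j) (auto simp: nth_Cons' gr0_conv_Suc)

lemma finite_regions: "finite (regions s w)"
  by (induction w arbitrary: s) auto

lemma regions_closed: "s \<in> S \<Longrightarrow> w \<in> words X \<Longrightarrow> regions s w \<subseteq> S"
  by (induction w arbitrary: s) (auto simp: step_closed)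

lemma recolor_in_words:
  "s \<in> S \<Longrightarrow> w \<in> words X \<Longrightarrow> regions s w \<subseteq> Good \<Longrightarrow> recolor s w \<in> words X'"
proof (induction w arbitrary: s)
  case (Cons x w)
  then have "step s x \<in> Good" using start_in_regions by (auto simp del: start_in_regions)
  with Cons show ?case by (simp add: col_in step_closed)
qed simp

lemma step_flip': "s \<in> S \<Longrightarrow> c \<in> X \<Longrightarrow> step (step s (c, e)) (c, \<not> e) = s"
  and col_flip': "s \<in> S \<Longrightarrow> c \<in> X \<Longrightarrow> col (step s (c, e)) (c, \<not> e) = col s (c, e)"
  using step_flip[of s "(c, e)"] col_flip[of s "(c, e)"] by (simp_all add: flip_def)

text \<open>That a region label does not depend on the height at which it is read rests on the first
  claim: a piece leads the automaton to the same state along its bottom and along its top. The start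
  \<open>s\<close> is arbitrary in the induction because a turn changes which region lies on the
  left.\<close>

lemma piece:
  assumes "piece_colored B p b t" "s \<in> S" "b \<in> words X" "t \<in> words X"
  shows "final s b = final s t"
    and "regions s b \<union> regions s t \<subseteq> Good \<Longrightarrow> piece_colored B' p (recolor s b) (recolor s t)"
proof -
  have "final s b = final s t \<and>
     (regions s b \<union> regions s t \<subseteq> Good \<longrightarrow> piece_colored B' p (recolor s b) (recolor s t))"
    using assms
  proof (induction arbitrary: s rule: piece_colored.induct)
    case (cup e c)
    then show ?case by (simp add: step_flip' col_flip' piece_colored.cup)
  next
    case (cap e c)
    then show ?case by (simp add: step_flip' col_flip' piece_colored.cap)
  next
    case (positive x1 x2 x4 x3)
    then show ?case
      using crossing_step[of s x1 x2 x4 x3] crossing_col[of s x1 x2 x4 x3]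
      by (auto intro: piece_colored.positive)
  next
    case (negative x1 x2 x4 x3)
    then show ?case
      using crossing_step[of s x1 x2 x4 x3] crossing_col[of s x1 x2 x4 x3]
      by (auto intro: piece_colored.negative)
  next
    case (quarter_turn e k x x' y y')
    \<comment> \<open>A clockwise turn moves the region below the crossing to its left. So
      \<open>s\<close> labels the region below the unturned crossing, and \<open>s0\<close> the
      region to the left of it, which the turned crossing has at its top.\<close>
    define s0 where "s0 = step s (flip x)"
    have X: "fst x \<in> X" "fst x' \<in> X" "fst y \<in> X" "fst y' \<in> X" and s: "s \<in> S"
      using quarter_turn.prems by auto
    have s0: "s0 \<in> S" "step s0 x = s" "col s0 x = col s (flip x)"
      using step_closed[of s "flip x"] step_flip[of s "flip x"] col_flip[of s "flip x"] X s
      by (auto simp: s0_def)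
    have s1: "step s0 y \<in> S" using s0 X by (simp add: step_closed)
    from quarter_turn.IH[OF s0(1)] X s0
    have f: "step s x' = step (step s0 y) y'"
      and p: "{s0, s, step s x', step s0 y} \<subseteq> Good \<Longrightarrow>
        piece_colored B' (Crossing e k) [(col s0 x, snd x), (col s x', snd x')]
          [(col s0 y, snd y), (col (step s0 y) y', snd y')]"
      by auto
    have g: "step (step s x') (flip y') = step s0 y"
        "col (step s x') (flip y') = col (step s0 y) y'"
      using step_flip[OF s1 X(4)] col_flip[OF s1 X(4)] f by auto
    have "piece_colored B' (Crossing e (Suc k)) (recolor s [x', flip y']) (recolor s [flip x, y])"
      if "{s0, s, step s x', step s0 y} \<subseteq> Good"
      using piece_colored.quarter_turn[OF p[OF that] \<open>k < 3\<close>] g s0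
      by (simp add: s0_def[symmetric])
    then show ?case using g by (auto simp: s0_def)
  qed
  then show "final s b = final s t"
    and "regions s b \<union> regions s t \<subseteq> Good \<Longrightarrow> piece_colored B' p (recolor s b) (recolor s t)"
    by auto
qed

text \<open>The piece of a slice is recolored from the state reached after the strands
  \<open>u\<close> on its left. The strands \<open>v\<close> on its right get the same colors below
  and above, since the piece does not affect the final state.\<close>

lemma recolor_diagram_colored:
  assumes D: "D \<in> colored_diagrams X B" and s: "s \<in> S" and good: "diagram_regions s D \<subseteq> Good"
  shows "recolor_diagram s D \<in> colored_diagrams X' B'"
proof -
  have "slice_colored B' (slices D ! i) (recolor s (levels D ! i)) (recolor s (levels D ! Suc i))"
    if i: "i < length (slices D)" for i
  proof -
    have mem: "levels D ! i \<in> set (levels D)" "levels D ! Suc i \<in> set (levels D)"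
      using D i by (auto simp: colored_diagrams_iff)
    obtain u b t v where *: "length u = fst (slices D ! i)" "levels D ! i = u @ b @ v"
      "levels D ! Suc i = u @ t @ v" "piece_colored B (snd (slices D ! i)) b t"
      using D i unfolding colored_diagrams_iff slice_colored_def by blast
    have w: "u \<in> words X" "b \<in> words X" "t \<in> words X"
      using mem * D by (auto simp: colored_diagrams_iff)
    have "regions (final s u) b \<union> regions (final s u) t \<subseteq> Good"
      using good mem * by (fastforce simp: diagram_regions_def)
    with piece[OF *(4) final_closed[OF s w(1)] w(2,3)] *
    show ?thesis unfolding slice_colored_def
      by (intro exI[of _ "recolor s u"] exI[of _ "recolor (final s u) b"]
          exI[of _ "recolor (final s u) t"] exI[of _ "recolor (final s (u @ b)) v"]) auto
  qed
  moreover have "recolor s w \<in> words X'" if "w \<in> set (levels D)" for w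
    using that D s good by (intro recolor_in_words) (auto simp: colored_diagrams_iff diagram_regions_def)
  ultimately show ?thesis
    using D by (auto simp: colored_diagrams_iff recolor_diagram_def)
qed

text \<open>No relation creates or removes a label. In an interchange each piece is read from the
  same state whichever comes first; a zigzag only crosses a strand to and fro; a turned crossing has
  the same four regions as the crossing bent with a cup and a cap.\<close>

lemma elementary_isotopy_recolor:
  assumes "elementary_isotopy B L R" "s \<in> S"
    and "\<forall>w\<in>set (levels L). w \<in> words X" "\<forall>w\<in>set (levels R). w \<in> words X"
  shows "diagram_regions s L = diagram_regions s R"
    and "diagram_regions s L \<subseteq> Good \<Longrightarrow>
      elementary_isotopy B' (recolor_diagram s L) (recolor_diagram s R)"
proof -
  have "diagram_regions s L = diagram_regions s R \<and>
    (diagram_regions s L \<subseteq> Good \<longrightarrow>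
      elementary_isotopy B' (recolor_diagram s L) (recolor_diagram s R))"
    using assms
  proof (induction rule: elementary_isotopy.induct)
    case (interchange p b t p' b' t' u w v)
    let ?s1 = "final s u"
    let ?s2 = "final ?s1 b"
    let ?s3 = "final ?s2 w"
    have s: "?s1 \<in> S" "?s2 \<in> S" "?s3 \<in> S"
      using interchange by (auto simp: final_closed)
    note p1 = piece[OF interchange(1) s(1)] and p2 = piece[OF interchange(2) s(3)]
    have f: "final ?s1 t = ?s2" "final ?s3 t' = final ?s3 b'"
      using p1(1) p2(1) interchange by auto
    have "elementary_isotopy B'
        (recolor_diagram s (Diagram [u @ b @ w @ b' @ v, u @ t @ w @ b' @ v, u @ t @ w @ t' @ v]
          [(length u, p), (length (u @ t @ w), p')]))
        (recolor_diagram s (Diagram [u @ b @ w @ b' @ v, u @ b @ w @ t' @ v, u @ t @ w @ t' @ v]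
          [(length (u @ b @ w), p'), (length u, p)]))"
      if "regions ?s1 b \<union> regions ?s1 t \<subseteq> Good" "regions ?s3 b' \<union> regions ?s3 t' \<subseteq> Good"
      using elementary_isotopy.interchange[OF p1(2)[OF _ _ that(1)] p2(2)[OF _ _ that(2)],
          of "recolor s u" "recolor ?s2 w" "recolor (final ?s3 b') v"] f interchange
      by (simp add: recolor_diagram_def)
    then show ?case using f by (auto simp: diagram_regions_def)
  next
    case (zigzag_right u c e v)
    have s: "final s u \<in> S" "c \<in> X" using zigzag_right by (auto simp: final_closed)
    show ?case
      using elementary_isotopy.zigzag_right[of B' "recolor s u" "col (final s u) (c, e)" e
          "recolor (step (final s u) (c, e)) v"] s
      by (auto simp: recolor_diagram_def diagram_regions_def step_flip' col_flip')
  next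
    case (zigzag_left u c e v)
    have s: "final s u \<in> S" "c \<in> X" using zigzag_left by (auto simp: final_closed)
    show ?case
      using elementary_isotopy.zigzag_left[of B' "recolor s u" "col (final s u) (c, e)" e
          "recolor (step (final s u) (c, e)) v"] s
      by (auto simp: recolor_diagram_def diagram_regions_def step_flip' col_flip')
  next
    case (turn e k x x' y y' u v)
    let ?s = "final s u"
    define s0 where "s0 = step ?s (flip x)"
    have X: "fst x \<in> X" "fst x' \<in> X" "fst y \<in> X" "fst y' \<in> X" "u \<in> words X"
      using turn.prems by auto
    have s: "?s \<in> S" using X turn by (simp add: final_closed)
    have s0: "s0 \<in> S" "step s0 x = ?s" "col s0 x = col ?s (flip x)"
      using step_closed[of ?s "flip x"] step_flip[of ?s "flip x"] col_flip[of ?s "flip x"] X s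
      by (auto simp: s0_def)
    have s1: "step s0 y \<in> S" using s0 X by (simp add: step_closed)
    note p = piece[OF turn(1) s0(1)]
    have f: "step ?s x' = step (step s0 y) y'"
      using p(1) X s0 by simp
    have g: "step (step ?s x') (flip y') = step s0 y"
        "col (step ?s x') (flip y') = col (step s0 y) y'"
      using step_flip[OF s1 X(4)] col_flip[OF s1 X(4)] f by auto
    have pc: "piece_colored B' (Crossing e k) [(col s0 x, snd x), (col ?s x', snd x')]
          [(col s0 y, snd y), (col (step s0 y) y', snd y')]"
      if "{s0, ?s, step ?s x', step s0 y} \<subseteq> Good"
      using p(2) that X s0 f by simp
    note simps = s0(2,3) f g[unfolded f] s0_def[symmetric]
    have "elementary_isotopy B'
        (recolor_diagram s (Diagram [u @ [x', flip y'] @ v, u @ [flip x, y] @ v]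
               [(length u, Crossing e (Suc k mod 4))]))
        (recolor_diagram s (Diagram [u @ [x', flip y'] @ v, u @ [flip x, x, x', flip y'] @ v,
                u @ [flip x, y, y', flip y'] @ v, u @ [flip x, y] @ v]
               [(length u, Cup (\<not> snd x)), (Suc (length u), Crossing e k),
                (Suc (Suc (length u)), Cap (snd y'))]))"
      if "{s0, ?s, step ?s x', step s0 y} \<subseteq> Good"
      using elementary_isotopy.turn[OF pc[OF that], of "recolor s u" "recolor (step s0 y) v"]
      by (simp add: recolor_diagram_def simps)
    then show ?case
      using start_in_regions[of "step s0 y" v]
      by (auto simp: diagram_regions_def simps simp del: start_in_regions)
  qed
  then show "diagram_regions s L = diagram_regions s R"
    and "diagram_regions s L \<subseteq> Good \<Longrightarrow>
      elementary_isotopy B' (recolor_diagram s L) (recolor_diagram s R)"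
    by auto
qed

lemma recolor_stack:
  "recolor_diagram s (stack D E) = stack (recolor_diagram s D) (recolor_diagram s E)"
  by (simp add: recolor_diagram_def stack_def map_tl)

lemma regions_stack:
  assumes "target D = source E" "levels D \<noteq> []" "levels E \<noteq> []"
  shows "diagram_regions s (stack D E) = diagram_regions s D \<union> diagram_regions s E"
proof -
  have "source E \<in> set (levels D)" using assms by (metis target_def last_in_set)
  moreover have "set (levels E) = insert (source E) (set (tl (levels E)))"
    using assms(3) by (cases "levels E") (auto simp: source_def)
  ultimately show ?thesis by (auto simp: diagram_regions_def stack_def)
qed

lemma source_target_recolor:
  assumes "levels D \<noteq> []"
  shows "source (recolor_diagram s D) = recolor s (source D)"
    "target (recolor_diagram s D) = recolor s (target D)"
  using assms by (auto simp: recolor_diagram_def source_def target_def hd_map last_map)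

lemma isotopy_step_recolor:
  assumes "isotopy_step X B D E" "s \<in> S"
  shows "diagram_regions s D = diagram_regions s E"
    and "diagram_regions s D \<subseteq> Good \<Longrightarrow>
      isotopy_step X' B' (recolor_diagram s D) (recolor_diagram s E)"
proof -
  from assms(1) obtain P L R U where *: "D = stack (stack P L) U" "E = stack (stack P R) U"
    "elementary_isotopy B L R" "{P, L, R, U} \<subseteq> colored_diagrams X B"
    "target P = source L" "target L = source U"
    by (auto elim: isotopy_step.cases)
  have LR: "source L = source R" "target L = target R"
    using elementary_isotopy_ends[OF *(3)] by auto
  have ne: "levels P \<noteq> []" "levels L \<noteq> []" "levels R \<noteq> []" "levels U \<noteq> []"
    using *(4) colored_levels_nonempty by auto
  have D: "diagram_regions s D = diagram_regions s P \<union> diagram_regions s L \<union> diagram_regions s U"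
    and E: "diagram_regions s E = diagram_regions s P \<union> diagram_regions s R \<union> diagram_regions s U"
    using * LR ne by (auto simp: regions_stack target_stack levels_stack_nonempty)
  have w: "\<forall>w\<in>set (levels L). w \<in> words X" "\<forall>w\<in>set (levels R). w \<in> words X"
    using *(4) by (auto simp: colored_diagrams_iff)
  note el = elementary_isotopy_recolor[OF *(3) assms(2) w]
  show eq: "diagram_regions s D = diagram_regions s E"
    using D E el(1) by simp
  assume good: "diagram_regions s D \<subseteq> Good"
  then have "{recolor_diagram s P, recolor_diagram s L, recolor_diagram s R, recolor_diagram s U}
      \<subseteq> colored_diagrams X' B'"
    using D E eq *(4) assms(2) by (auto intro!: recolor_diagram_colored)
  then show "isotopy_step X' B' (recolor_diagram s D) (recolor_diagram s E)"
    unfolding *(1,2) recolor_stack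
    using el(2) good D * ne by (intro isotopy_step.intros) (auto simp: source_target_recolor)
qed

text \<open>It is enough that \<open>D\<close> has good labels: goodness is the invariant handed to
  \<open>equivclp_transfer\<close>, so all intermediate diagrams can be recolored too.\<close>

lemma isotopy_recolor:
  assumes DE: "(D, E) \<in> isotopy X B" and s: "s \<in> S" and good: "diagram_regions s D \<subseteq> Good"
  shows "(recolor_diagram s D, recolor_diagram s E) \<in> isotopy X' B'"
proof -
  note c = isotopy_ends(1,2)[OF DE]
  have "equivclp (isotopy_step X B) D E" using DE by (simp add: isotopy_def)
  then have "diagram_regions s E \<subseteq> Good \<and>
      equivclp (isotopy_step X' B') (recolor_diagram s D) (recolor_diagram s E)"
    by (rule equivclp_transfer) (use good s isotopy_step_recolor in auto)
  then show ?thesis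
    using c s good by (simp add: isotopy_def recolor_diagram_colored)
qed

end

section \<open>Matrices\<close>

lemma matrix_inv_cancel:
  assumes "invertible (A :: 'a::semiring_1^'n^'n)"
  shows "A ** matrix_inv A = mat 1" "matrix_inv A ** A = mat 1"
    "A ** (matrix_inv A ** C) = C" "matrix_inv A ** (A ** C) = C"
proof -
  have *: "A ** matrix_inv A = mat 1 \<and> matrix_inv A ** A = mat 1"
    unfolding matrix_inv_def using assms unfolding invertible_def by (rule someI_ex)
  then show "A ** matrix_inv A = mat 1" "matrix_inv A ** A = mat 1" by auto
  from * show "A ** (matrix_inv A ** C) = C" "matrix_inv A ** (A ** C) = C"
    by (simp_all add: matrix_mul_assoc)
qed

lemma matrix_inv_unique:
  assumes "A ** B = mat 1" "B ** A = mat 1"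
  shows "matrix_inv (A :: 'a::semiring_1^'n^'n) = B"
proof -
  have "invertible A" using assms by (auto simp: invertible_def)
  then have "matrix_inv A ** A ** B = B" by (simp add: matrix_inv_cancel)
  then show ?thesis using assms by (simp add: matrix_mul_assoc[symmetric])
qed

lemma invertible_inv: "invertible (A :: 'a::semiring_1^'n^'n) \<Longrightarrow> invertible (matrix_inv A)"
  unfolding invertible_def[of "matrix_inv A"] using matrix_inv_cancel[of A] by blast

lemma matrix_inv_inv: "invertible (A :: 'a::semiring_1^'n^'n) \<Longrightarrow> matrix_inv (matrix_inv A) = A"
  by (rule matrix_inv_unique) (simp_all add: matrix_inv_cancel)

lemma matrix_inv_mult:
  assumes "invertible (A :: 'a::semiring_1^'n^'n)" "invertible (B :: 'a^'n^'n)"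
  shows "matrix_inv (A ** B) = matrix_inv B ** matrix_inv A"
  by (rule matrix_inv_unique) (use assms in \<open>simp_all add: matrix_inv_cancel matrix_mul_assoc[symmetric]\<close>)

lemma matrix_inv_one: "matrix_inv (mat 1 :: 'a::semiring_1^'n^'n) = mat 1"
  by (rule matrix_inv_unique) simp_all

lemma invertible_one: "invertible (mat 1 :: 'a::semiring_1^'n^'n)"
  unfolding invertible_def by (rule exI[of _ "mat 1"]) simp

lemmas matrix_group_simps =
  matrix_mul_assoc[symmetric] matrix_inv_mult matrix_inv_inv matrix_inv_cancel matrix_inv_one
  invertible_inv invertible_mult invertible_one

lemma det_inv: "invertible (A :: 'a::field^'n^'n) \<Longrightarrow> det (matrix_inv A) = 1 / det A"
proof -
  assume A: "invertible A"
  then have "det A * det (matrix_inv A) = 1"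
    by (simp flip: det_mul add: matrix_inv_cancel)
  then show ?thesis
    by (metis mult_zero_left nonzero_eq_divide_eq mult.commute zero_neq_one)
qed

lemma invertible_det_one: "det (A :: 'a::field^'n^'n) = 1 \<Longrightarrow> invertible A"
  by (simp add: invertible_det_nz)

lemma conjugate_det_trace:
  assumes "invertible (h :: 'a::field^'n^'n)"
  shows "det (h ** m ** matrix_inv h) = det m" "trace (h ** m ** matrix_inv h) = trace m"
    "det (matrix_inv h ** m ** h) = det m" "trace (matrix_inv h ** m ** h) = trace m"
proof -
  have *: "det (h ** m ** matrix_inv h) = det m \<and> trace (h ** m ** matrix_inv h) = trace m"
    if "invertible h" for h :: "'a^'n^'n"
  proof
    have "det h \<noteq> 0" using that by (simp add: invertible_det_nz)
    then show "det (h ** m ** matrix_inv h) = det m" by (simp add: det_mul det_inv that)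
    show "trace (h ** m ** matrix_inv h) = trace m"
      using that by (subst trace_mul_sym) (simp add: matrix_group_simps)
  qed
  from *[OF assms] *[OF invertible_inv[OF assms]] assms
  show "det (h ** m ** matrix_inv h) = det m" "trace (h ** m ** matrix_inv h) = trace m"
    "det (matrix_inv h ** m ** h) = det m" "trace (matrix_inv h ** m ** h) = trace m"
    by (auto simp: matrix_inv_inv)
qed

lemma mat_commute: "(m :: 'a::comm_ring_1^'n^'n) ** mat c = mat c ** m"
  by (simp add: vec_eq_iff matrix_matrix_mult_def mat_def if_distrib[of "(*) _"]
      if_distrib[of "\<lambda>x. x * _"] sum.delta' sum.delta mult.commute cong: if_cong)

lemma conjugate_scalar:
  assumes "invertible (h :: 'a::field^'n^'n)"
  shows "h ** mat c ** matrix_inv h = mat c" "matrix_inv h ** mat c ** h = mat c"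
proof -
  show "h ** mat c ** matrix_inv h = mat c"
    by (simp add: mat_commute[of h] assms matrix_group_simps)
  show "matrix_inv h ** mat c ** h = mat c"
    by (simp add: mat_commute[of "matrix_inv h"] assms matrix_group_simps)
qed

section \<open>Two-by-two complex matrices by their entries\<close>

definition m2 :: "complex \<Rightarrow> complex \<Rightarrow> complex \<Rightarrow> complex \<Rightarrow> mat2" where
  "m2 a b c d = vector [vector [a, b], vector [c, d]]"

lemma m2_nth [simp]:
  "m2 a b c d $ 1 $ 1 = a" "m2 a b c d $ 1 $ 2 = b" "m2 a b c d $ 2 $ 1 = c" "m2 a b c d $ 2 $ 2 = d"
  by (simp_all add: m2_def)

lemma mat2_eq_iff:
  "(m :: mat2) = m' \<longleftrightarrow> m$1$1 = m'$1$1 \<and> m$1$2 = m'$1$2 \<and> m$2$1 = m'$2$1 \<and> m$2$2 = m'$2$2"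
  by (auto simp: vec_eq_iff forall_2)

lemma m2_mult [simp]:
  "m2 a b c d ** m2 a' b' c' d' = m2 (a * a' + b * c') (a * b' + b * d') (c * a' + d * c') (c * b' + d * d')"
  by (simp add: mat2_eq_iff matrix_matrix_mult_def sum_2)

lemma m2_eq [simp]: "m2 a b c d = m2 a' b' c' d' \<longleftrightarrow> a = a' \<and> b = b' \<and> c = c' \<and> d = d'"
  by (simp add: mat2_eq_iff)

lemma m2_cases: obtains a b c d where "m = m2 a b c d"
  by (rule that[of "m$1$1" "m$1$2" "m$2$1" "m$2$2"]) (simp add: mat2_eq_iff)

lemma det_m2 [simp]: "det (m2 a b c d) = a * d - b * c"
  by (simp add: det_2)

lemma trace_m2 [simp]: "trace (m2 a b c d) = a + d"
  by (simp add: trace_def sum_2)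

lemma mat_eq_m2: "mat k = m2 k 0 0 k"
  by (simp add: mat2_eq_iff mat_def)

lemma inv_m2:
  assumes "a * d - b * c \<noteq> 0"
  shows "matrix_inv (m2 a b c d) = m2 (d / (a * d - b * c)) (- b / (a * d - b * c))
    (- c / (a * d - b * c)) (a / (a * d - b * c))"
  by (rule matrix_inv_unique) (use assms in \<open>auto simp: mat_eq_m2 divide_simps\<close>)

section \<open>The group \<open>G\<^sup>*\<close>\<close>

definition gs :: "complex \<Rightarrow> complex \<Rightarrow> complex \<Rightarrow> gstar" where
  "gs k e p = (m2 k 0 p 1, m2 1 e 0 k)"

definition gmul :: "gstar \<Rightarrow> gstar \<Rightarrow> gstar" where
  "gmul g h = (phi_plus g ** phi_plus h, phi_minus g ** phi_minus h)"

definition ginv :: "gstar \<Rightarrow> gstar" where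
  "ginv g = (matrix_inv (phi_plus g), matrix_inv (phi_minus g))"

definition gone :: gstar where
  "gone = (mat 1, mat 1)"

lemma Gstar_iff: "y \<in> Gstar \<longleftrightarrow> (\<exists>k e p. k \<noteq> 0 \<and> y = gs k e p)"
  by (auto simp: Gstar_def gs_def m2_def)

lemma gs_in_Gstar [simp]: "gs k e p \<in> Gstar \<longleftrightarrow> k \<noteq> 0"
  by (auto simp: Gstar_iff gs_def)

lemma Gstar_cases:
  assumes "y \<in> Gstar"
  obtains k e p where "k \<noteq> 0" "y = gs k e p"
  using assms by (auto simp: Gstar_iff)

lemma gs_eq [simp]: "gs k e p = gs k' e' p' \<longleftrightarrow> k = k' \<and> e = e' \<and> p = p'"
  by (auto simp: gs_def)

lemma gone_gs: "gone = gs 1 0 0"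
  by (simp add: gone_def gs_def mat_eq_m2)

lemma gone_Gstar [simp]: "gone \<in> Gstar"
  by (simp add: gone_gs)

lemma gmul_gs: "gmul (gs k e p) (gs k' e' p') = gs (k * k') (e' + e * k') (p * k' + p')"
  by (simp add: gmul_def gs_def)

lemma ginv_gs: "k \<noteq> 0 \<Longrightarrow> ginv (gs k e p) = gs (1 / k) (- e / k) (- p / k)"
  by (simp add: ginv_def gs_def inv_m2)

lemma gmul_closed [simp]: "g \<in> Gstar \<Longrightarrow> h \<in> Gstar \<Longrightarrow> gmul g h \<in> Gstar"
  by (auto elim!: Gstar_cases simp: gmul_gs)

lemma ginv_closed [simp]: "g \<in> Gstar \<Longrightarrow> ginv g \<in> Gstar"
  by (auto elim!: Gstar_cases simp: ginv_gs)

lemma Gstar_invertible: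
  assumes "g \<in> Gstar"
  shows "invertible (phi_plus g)" "invertible (phi_minus g)"
  using assms by (auto elim!: Gstar_cases simp: gs_def invertible_det_nz)

lemma phi_gmul [simp]:
  "phi_plus (gmul g h) = phi_plus g ** phi_plus h" "phi_minus (gmul g h) = phi_minus g ** phi_minus h"
  by (simp_all add: gmul_def)

lemma phi_ginv [simp]:
  "phi_plus (ginv g) = matrix_inv (phi_plus g)" "phi_minus (ginv g) = matrix_inv (phi_minus g)"
  by (simp_all add: ginv_def)

lemma phi_gone [simp]: "phi_plus gone = mat 1" "phi_minus gone = mat 1"
  by (simp_all add: gone_def)

section \<open>The bijection \<psi> from \<open>Gstar\<close> onto \<open>Gprime\<close>\<close>

lemma psi_gs: "k \<noteq> 0 \<Longrightarrow> psi (gs k e p) = m2 k (- e) p ((1 - p * e) / k)"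
  by (simp add: psi_def gs_def inv_m2 field_simps)

lemma psi_in_Gprime: "y \<in> Gstar \<Longrightarrow> psi y \<in> Gprime"
  by (auto elim!: Gstar_cases simp: psi_gs Gprime_def)

lemma psi_eq_iff:
  assumes "k \<noteq> 0" "det m = 1"
  shows "psi (gs k e p) = m \<longleftrightarrow> k = m$1$1 \<and> e = - m$1$2 \<and> p = m$2$1"
proof (cases m rule: m2_cases)
  case (1 a b c d)
  then show ?thesis using assms by (auto simp: psi_gs field_simps)
qed

lemma inj_on_psi: "inj_on psi Gstar"
  by (rule inj_onI, elim Gstar_cases) (simp add: psi_gs)

lemma psi_image: "psi ` Gstar = Gprime"
proof (intro equalityI subsetI)
  fix m assume m: "m \<in> Gprime"
  then have "psi (gs (m$1$1) (- m$1$2) (m$2$1)) = m"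
    by (subst psi_eq_iff) (auto simp: Gprime_def)
  with m show "m \<in> psi ` Gstar"
    by (metis (mono_tags, lifting) Gprime_def gs_in_Gstar image_eqI mem_Collect_eq)
qed (auto simp: psi_in_Gprime)

lemma psi_inv_in [simp]: "m \<in> Gprime \<Longrightarrow> psi_inv m \<in> Gstar"
  using the_inv_into_into[OF inj_on_psi, of m Gstar] psi_image by auto

lemma psi_psi_inv [simp]: "m \<in> Gprime \<Longrightarrow> psi (psi_inv m) = m"
  using f_the_inv_into_f[OF inj_on_psi, of m] psi_image by auto

lemma psi_inv_psi [simp]: "y \<in> Gstar \<Longrightarrow> psi_inv (psi y) = y"
  by (rule the_inv_into_f_f[OF inj_on_psi])

lemma psi_det: "y \<in> Gstar \<Longrightarrow> det (psi y) = 1"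
  using psi_in_Gprime[of y] by (simp add: Gprime_def)

lemma psi_invertible: "y \<in> Gstar \<Longrightarrow> invertible (psi y)"
  by (simp add: psi_det invertible_det_one)

lemma psi_gone: "psi gone = mat 1"
  by (simp add: psi_def matrix_inv_one)

text \<open>The factor \<open>phi_minus g\<close> cancels in
  \<open>psi (gmul g y) ** matrix_inv (psi g)\<close>. Hence conjugating by the holonomy
  \<open>phi_plus g\<close>, as the functor does, gives a color that depends only on the labels of
  the two regions beside the edge.\<close>

lemma psi_conj:
  assumes "g \<in> Gstar" "y \<in> Gstar"
  shows "phi_plus g ** psi y ** matrix_inv (phi_plus g) = psi (gmul g y) ** matrix_inv (psi g)"
  using assms by (simp add: psi_def matrix_group_simps Gstar_invertible)

section \<open>The braiding in coordinates\<close>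

lemma B_star_iff:
  "B_star (y1, y2) = Some (y4, y3) \<longleftrightarrow> {y1, y2, y3, y4} \<subseteq> Gstar \<and>
     psi y4 = phi_minus y1 ** psi y2 ** matrix_inv (phi_minus y1) \<and>
     psi y3 = matrix_inv (phi_plus y4) ** psi y1 ** phi_plus y4"
  (is "?L \<longleftrightarrow> ?R")
proof
  assume ?L
  then show ?R by (auto simp: B_star_def Let_def split: if_splits)
next
  assume R: ?R
  then have e: "phi_minus y1 ** psi y2 ** matrix_inv (phi_minus y1) = psi y4"
    "matrix_inv (phi_plus y4) ** psi y1 ** phi_plus y4 = psi y3" by auto
  show ?L using R by (simp add: B_star_def e psi_in_Gprime)
qed

text \<open>A matrix of determinant 1 with nonzero corner is determined by its first row and its
  lower left entry, so each of the two defining equations amounts to three scalar ones. The system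
  is their division-free form; its last two equations together with \<open>k1 * k2 = k4 * k3\<close>
  say that the products agree in \<open>Gstar\<close>.\<close>

lemma B_star_gs:
  assumes k: "k1 \<noteq> 0" "k2 \<noteq> 0" "k3 \<noteq> 0" "k4 \<noteq> 0"
  shows "B_star (gs k1 e1 p1, gs k2 e2 p2) = Some (gs k4 e4 p4, gs k3 e3 p3) \<longleftrightarrow>
    k4 = k2 + e1 * p2 \<and> k1 * k2 = k4 * k3 \<and> p4 = k1 * p2 \<and> e1 = e3 * k4 \<and>
    p1 * k2 + p2 = p4 * k3 + p3 \<and> e2 + e1 * k2 = e3 + e4 * k3"
proof -
  let ?m4 = "phi_minus (gs k1 e1 p1) ** psi (gs k2 e2 p2) ** matrix_inv (phi_minus (gs k1 e1 p1))"
  let ?m3 = "matrix_inv (phi_plus (gs k4 e4 p4)) ** psi (gs k1 e1 p1) ** phi_plus (gs k4 e4 p4)"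
  have d: "det ?m4 = 1" "det ?m3 = 1"
    using k by (simp_all only: conjugate_det_trace Gstar_invertible psi_det gs_in_Gstar not_False_eq_True)
  have m4: "?m4 $ 1 $ 1 = k2 + e1 * p2" "?m4 $ 2 $ 1 = k1 * p2"
    "?m4 $ 1 $ 2 = (- e2 + e1 * (1 - p2 * e2) / k2 - e1 * (k2 + e1 * p2)) / k1"
    using k by (simp_all add: psi_gs) (simp_all add: gs_def inv_m2 field_simps)
  have m3: "?m3 $ 1 $ 1 = k1 - e1 * p4 / k4" "?m3 $ 1 $ 2 = - e1 / k4"
    "?m3 $ 2 $ 1 = p1 * k4 + (1 - p1 * e1) / k1 * p4 - p4 * (k1 - e1 * p4 / k4)"
    using k by (simp_all add: psi_gs) (simp_all add: gs_def inv_m2 field_simps)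
  have "B_star (gs k1 e1 p1, gs k2 e2 p2) = Some (gs k4 e4 p4, gs k3 e3 p3) \<longleftrightarrow>
    psi (gs k4 e4 p4) = ?m4 \<and> psi (gs k3 e3 p3) = ?m3"
    using k by (simp add: B_star_iff)
  also have "\<dots> \<longleftrightarrow> k4 = k2 + e1 * p2 \<and>
      e4 = - ((- e2 + e1 * (1 - p2 * e2) / k2 - e1 * (k2 + e1 * p2)) / k1) \<and> p4 = k1 * p2 \<and>
      k3 = k1 - e1 * p4 / k4 \<and> e3 = e1 / k4 \<and>
      p3 = p1 * k4 + (1 - p1 * e1) / k1 * p4 - p4 * (k1 - e1 * p4 / k4)"
    unfolding psi_eq_iff[OF k(4) d(1)] psi_eq_iff[OF k(3) d(2)] m4 m3 by auto
  also have "\<dots> \<longleftrightarrow> k4 = k2 + e1 * p2 \<and> k1 * k2 = k4 * k3 \<and> p4 = k1 * p2 \<and> e1 = e3 * k4 \<and>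
    p1 * k2 + p2 = p4 * k3 + p3 \<and> e2 + e1 * k2 = e3 + e4 * k3" (is "?L \<longleftrightarrow> ?R")
  \<comment> \<open>These three equations occur on both sides, one of them up to division by
    \<open>k4\<close>. If one fails, both sides are false; if they hold, they can be substituted
    into the remaining three.\<close>
  proof (cases "k4 = k2 + e1 * p2 \<and> p4 = k1 * p2 \<and> e3 = e1 / k4")
    case True
    then have a: "k4 = k2 + e1 * p2" "p4 = k1 * p2" "e1 = e3 * k4" using k by auto
    have "k1 * (k2 + e1 * p2) - e1 * (k1 * p2) = k1 * k2" by (simp add: algebra_simps)
    then have "(k1 - e1 * p4 / k4) * k4 = k1 * k2" using a(1,2) k(4) by (simp add: left_diff_distrib)
    then have k3: "k3 = k1 - e1 * p4 / k4 \<longleftrightarrow> k1 * k2 = k4 * k3"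
      using k(4) by (metis mult.commute mult_cancel_right)
    have "(1 - p1 * e1) / k1 * p4 = (1 - p1 * e1) * p2" using a(2) k by simp
    then have p3: "p3 = p1 * k4 + (1 - p1 * e1) / k1 * p4 - p4 * k3 \<longleftrightarrow> p1 * k2 + p2 = p4 * k3 + p3"
      unfolding a(1) by (auto simp: algebra_simps)
    have "e4 = - ((- e2 + e1 * (1 - p2 * e2) / k2 - e1 * (k2 + e1 * p2)) / k1) \<longleftrightarrow>
        e4 * k1 * k2 = e2 * k2 - e1 * (1 - p2 * e2) + e1 * (k2 + e1 * p2) * k2"
      using k by (simp add: field_simps)
    also have "\<dots> \<longleftrightarrow> (e2 + e1 * k2) * k4 = e1 + e4 * (k1 * k2)"
      unfolding a(1) by (auto simp: algebra_simps)
    also have "\<dots> \<longleftrightarrow> e2 + e1 * k2 = e3 + e4 * k3" if "k1 * k2 = k4 * k3"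
    proof -
      have "e1 + e4 * (k1 * k2) = (e3 + e4 * k3) * k4"
        unfolding that by (subst a(3)) (simp add: algebra_simps)
      then show ?thesis using k by simp
    qed
    finally show ?thesis using k3 p3 a True by metis
  next
    case False
    moreover have "e1 = e3 * k4 \<longleftrightarrow> e3 = e1 / k4" using k by (auto simp: field_simps)
    ultimately show ?thesis by blast
  qed
  finally show ?thesis .
qed

lemma B_star_gmul:
  assumes "B_star (y1, y2) = Some (y4, y3)"
  shows "gmul y1 y2 = gmul y4 y3"
proof -
  have G: "y1 \<in> Gstar" "y2 \<in> Gstar" "y3 \<in> Gstar" "y4 \<in> Gstar"
    using assms by (simp_all add: B_star_iff)
  obtain k1 e1 p1 where 1: "k1 \<noteq> 0" "y1 = gs k1 e1 p1" using G(1) by (rule Gstar_cases)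
  obtain k2 e2 p2 where 2: "k2 \<noteq> 0" "y2 = gs k2 e2 p2" using G(2) by (rule Gstar_cases)
  obtain k3 e3 p3 where 3: "k3 \<noteq> 0" "y3 = gs k3 e3 p3" using G(3) by (rule Gstar_cases)
  obtain k4 e4 p4 where 4: "k4 \<noteq> 0" "y4 = gs k4 e4 p4" using G(4) by (rule Gstar_cases)
  show ?thesis
    using assms unfolding 1(2) 2(2) 3(2) 4(2) B_star_gs[OF 1(1) 2(1) 3(1) 4(1)] gmul_gs gs_eq
    by blast
qed

section \<open>Color sets stable under conjugation\<close>

lemma exceptional_in_Gprime: "exceptional_matrix l \<in> Gprime"
  by (simp add: Gprime_def exceptional_matrix_def mat_eq_m2 flip: power_add)

lemma Q_ell_iff:
  "(m, z) \<in> Q_ell \<sigma> l \<longleftrightarrow> det m = 1 \<and> trace m = \<sigma> * poly (Cb (rr l)) z \<and> trace m \<notin> {2, -2} \<or>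
     m = exceptional_matrix l \<and> z = exceptional_value l"
  by (auto simp: Q_ell_def conj_Cb_def)

text \<open>The exceptional matrix is scalar with corner entry 1 or -1, so it lies in
  \<open>Gprime\<close> and its point needs no separate treatment: \<open>Y_ell\<close> becomes the
  preimage of \<open>Q_ell\<close> under \<open>psi\<close>, with \<open>z\<close>
  unchanged.\<close>

lemma Y_ell_iff: "(y, z) \<in> Y_ell \<sigma> l \<longleftrightarrow> y \<in> Gstar \<and> (psi y, z) \<in> Q_ell \<sigma> l"
proof -
  have "y = psi_inv (exceptional_matrix l) \<longleftrightarrow> y \<in> Gstar \<and> psi y = exceptional_matrix l"
    using exceptional_in_Gprime[of l] psi_inv_psi by (metis psi_inv_in psi_psi_inv)
  then show ?thesis using psi_det[of y] by (auto simp: Y_ell_def Q_ell_iff)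
qed

lemma Q_ell_det: "(m, z) \<in> Q_ell \<sigma> l \<Longrightarrow> det m = 1"
  using exceptional_in_Gprime[of l] by (auto simp: Q_ell_iff Gprime_def)

lemma Q_ell_invertible: "(m, z) \<in> Q_ell \<sigma> l \<Longrightarrow> invertible m"
  by (simp add: Q_ell_det invertible_det_one)

text \<open>Away from the exceptional point membership depends on determinant, trace and
  \<open>z\<close>, which conjugation preserves; the exceptional matrix is central.\<close>

lemma Q_ell_conj:
  assumes "(m, z) \<in> Q_ell \<sigma> l" "invertible h"
  shows "(h ** m ** matrix_inv h, z) \<in> Q_ell \<sigma> l" "(matrix_inv h ** m ** h, z) \<in> Q_ell \<sigma> l"
proof -
  have "h ** exceptional_matrix l ** matrix_inv h = exceptional_matrix l"
    "matrix_inv h ** exceptional_matrix l ** h = exceptional_matrix l"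
    unfolding exceptional_matrix_def using assms(2) by (rule conjugate_scalar)+
  then show "(h ** m ** matrix_inv h, z) \<in> Q_ell \<sigma> l" "(matrix_inv h ** m ** h, z) \<in> Q_ell \<sigma> l"
    using assms(1) unfolding Q_ell_iff conjugate_det_trace[OF assms(2)] by blast+
qed

lemma Q_ell_conj_iff:
  assumes "invertible h"
  shows "(h ** m ** matrix_inv h, z) \<in> Q_ell \<sigma> l \<longleftrightarrow> (m, z) \<in> Q_ell \<sigma> l"
    and "(matrix_inv h ** m ** h, z) \<in> Q_ell \<sigma> l \<longleftrightarrow> (m, z) \<in> Q_ell \<sigma> l"
proof -
  have "matrix_inv h ** (h ** m ** matrix_inv h) ** h = m"
    "h ** (matrix_inv h ** m ** h) ** matrix_inv h = m"
    using assms by (simp_all add: matrix_group_simps)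
  then show "(h ** m ** matrix_inv h, z) \<in> Q_ell \<sigma> l \<longleftrightarrow> (m, z) \<in> Q_ell \<sigma> l"
    "(matrix_inv h ** m ** h, z) \<in> Q_ell \<sigma> l \<longleftrightarrow> (m, z) \<in> Q_ell \<sigma> l"
    using assms Q_ell_conj by metis+
qed

text \<open>Phrased for any set of invertible matrices with labels that is stable under conjugation,
  so as to cover \<open>Q_ell\<close> as well as the larger \<open>conj_Cb\<close>.\<close>

lemma quandle_conj_op:
  assumes inv: "\<And>m z. (m, z) \<in> Q \<Longrightarrow> invertible m"
    and conj: "\<And>m z h. (m, z) \<in> Q \<Longrightarrow> invertible h \<Longrightarrow> (h ** m ** matrix_inv h, z) \<in> Q"
  shows "quandle Q conj_op"
proof -
  have conj': "(matrix_inv h ** m ** h, z) \<in> Q" if "(m, z) \<in> Q" "invertible h" for m z h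
    using conj[OF that(1) invertible_inv[OF that(2)]] that(2) by (simp add: matrix_inv_inv)
  show ?thesis
    unfolding quandle_def
  proof (intro conjI ballI)
    fix a b assume "a \<in> Q" "b \<in> Q"
    moreover obtain ma za mb zb where ab: "a = (ma, za)" "b = (mb, zb)" by (metis surj_pair)
    ultimately have i: "(ma, za) \<in> Q" "(mb, zb) \<in> Q" "invertible ma" "invertible mb"
      using inv by auto
    show "conj_op a b \<in> Q" "conj_op a a = a"
      using i by (auto simp: ab conj_op_def conj' matrix_inv_cancel)
    show "\<exists>!c. c \<in> Q \<and> a = conj_op b c"
    proof (intro ex1I[of _ "(mb ** ma ** matrix_inv mb, za)"] conjI)
      show "(mb ** ma ** matrix_inv mb, za) \<in> Q" using i conj by auto
      show "a = conj_op b (mb ** ma ** matrix_inv mb, za)"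
        using i by (simp add: ab conj_op_def matrix_group_simps)
      fix c assume "c \<in> Q \<and> a = conj_op b c"
      then show "c = (mb ** ma ** matrix_inv mb, za)"
        using i by (cases c) (auto simp: ab conj_op_def matrix_group_simps)
    qed
    fix c assume "c \<in> Q"
    then show "conj_op a (conj_op b c) = conj_op (conj_op a b) (conj_op a c)"
      using i by (cases c) (simp add: ab conj_op_def matrix_group_simps)
  qed
qed

lemma quandle_Q_ell: "quandle (Q_ell \<sigma> l) conj_op"
  by (rule quandle_conj_op) (auto intro: Q_ell_invertible Q_ell_conj)

text \<open>\<open>signed_action\<close> uses \<open>the_inv_into\<close> for downward letters; its
  value is the inverse conjugation once the action is known to be a bijection of
  \<open>Q_ell\<close>.\<close>

lemma act_ell_inverse:
  assumes "y \<in> Gstar" "q \<in> Q_ell \<sigma> l"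
  shows "the_inv_into (Q_ell \<sigma> l) (act_ell (y, z)) q =
      (matrix_inv (phi_plus y) ** fst q ** phi_plus y, snd q)"
    and "act_ell (y, z) q \<in> Q_ell \<sigma> l"
    and "bij_betw (act_ell (y, z)) (Q_ell \<sigma> l) (Q_ell \<sigma> l)"
proof -
  have i: "invertible (phi_plus y)" using assms by (simp add: Gstar_invertible)
  let ?g = "\<lambda>q. (matrix_inv (phi_plus y) ** fst q ** phi_plus y, snd q)"
  have *: "act_ell (y, z) q \<in> Q_ell \<sigma> l" "?g q \<in> Q_ell \<sigma> l" if "q \<in> Q_ell \<sigma> l" for q
    using that i by (cases q; auto simp: act_ell_def intro: Q_ell_conj)+
  have gi: "?g (act_ell (y, z) q) = q" "act_ell (y, z) (?g q) = q" for q
    using i by (cases q; simp add: act_ell_def matrix_group_simps)+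
  show bij: "bij_betw (act_ell (y, z)) (Q_ell \<sigma> l) (Q_ell \<sigma> l)"
    by (rule bij_betwI[where g = ?g]) (use * gi in auto)
  show "act_ell (y, z) q \<in> Q_ell \<sigma> l" using * assms by auto
  show "the_inv_into (Q_ell \<sigma> l) (act_ell (y, z)) q = ?g q"
    by (rule the_inv_into_f_eq) (use bij * gi assms in \<open>auto simp: bij_betw_def\<close>)
qed

lemma quandle_aut_act_ell:
  assumes "x \<in> Y_ell \<sigma> l"
  shows "quandle_aut (Q_ell \<sigma> l) conj_op (act_ell x)"
proof -
  obtain y z where x: "x = (y, z)" "y \<in> Gstar" using assms by (cases x) (auto simp: Y_ell_iff)
  have "act_ell x (conj_op a b) = conj_op (act_ell x a) (act_ell x b)"
    if "a \<in> Q_ell \<sigma> l" "b \<in> Q_ell \<sigma> l" for a b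
    using that Q_ell_invertible[of "fst a" "snd a"] x
    by (cases a; cases b) (simp add: act_ell_def conj_op_def matrix_group_simps Gstar_invertible)
  moreover have "(exceptional_matrix l, exceptional_value l) \<in> Q_ell \<sigma> l" by (simp add: Q_ell_iff)
  ultimately show ?thesis
    using act_ell_inverse(3)[OF x(2)] by (auto simp: quandle_aut_def x(1))
qed

section \<open>Region labels\<close>

text \<open>Although \<open>psi\<close> is not multiplicative, it is equivariant when
  \<open>g\<close> acts on matrices by the twisted rule M -> phi_plus(g) M phi_minus(g)^-1.\<close>

lemma psi_gmul:
  "g \<in> Gstar \<Longrightarrow> h \<in> Gstar \<Longrightarrow>
    psi (gmul g h) = phi_plus g ** psi h ** matrix_inv (phi_minus g)"
  by (simp add: psi_def matrix_group_simps Gstar_invertible)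

lemma gmul_simps:
  "gmul (gmul f g) h = gmul f (gmul g h)"
  "g \<in> Gstar \<Longrightarrow> gmul (ginv g) (gmul g h) = h"
  "g \<in> Gstar \<Longrightarrow> gmul g (gmul (ginv g) h) = h"
  "g \<in> Gstar \<Longrightarrow> gmul (gmul h (ginv g)) g = h"
  "g \<in> Gstar \<Longrightarrow> gmul (gmul h g) (ginv g) = h"
  "g \<in> Gstar \<Longrightarrow> ginv (ginv g) = g"
  "g \<in> Gstar \<Longrightarrow> h \<in> Gstar \<Longrightarrow> ginv (gmul g h) = gmul (ginv h) (ginv g)"
  "gmul gone g = g" "gmul g gone = g"
  by (simp_all add: gmul_def ginv_def gone_def matrix_group_simps Gstar_invertible)

text \<open>Given \<open>y4\<close>, equality of the products determines \<open>y3\<close>, and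
  \<open>psi_gmul\<close> turns this value into the second conjugation of \<open>B_star\<close>. The
  form suits region labels, since edge colors are quotients of neighboring labels and quotients
  telescope.\<close>

lemma B_star_iff_gmul:
  assumes G: "y1 \<in> Gstar" "y2 \<in> Gstar" "y3 \<in> Gstar" "y4 \<in> Gstar"
  shows "B_star (y1, y2) = Some (y4, y3) \<longleftrightarrow>
    gmul y1 y2 = gmul y4 y3 \<and> psi y4 ** phi_minus y1 = phi_minus y1 ** psi y2"
proof
  assume B: "B_star (y1, y2) = Some (y4, y3)"
  then have "psi y4 = phi_minus y1 ** psi y2 ** matrix_inv (phi_minus y1)" by (simp add: B_star_iff)
  then have "psi y4 ** phi_minus y1 = phi_minus y1 ** psi y2"
    using G by (simp add: matrix_group_simps Gstar_invertible)
  with B_star_gmul[OF B] show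
    "gmul y1 y2 = gmul y4 y3 \<and> psi y4 ** phi_minus y1 = phi_minus y1 ** psi y2" by simp
next
  assume R: "gmul y1 y2 = gmul y4 y3 \<and> psi y4 ** phi_minus y1 = phi_minus y1 ** psi y2"
  note inv = Gstar_invertible[OF G(1)] Gstar_invertible[OF G(2)] Gstar_invertible[OF G(3)]
    Gstar_invertible[OF G(4)]
  have 4: "psi y4 = phi_minus y1 ** psi y2 ** matrix_inv (phi_minus y1)"
    using inv R[THEN conjunct2, symmetric] by (simp add: matrix_group_simps)
  have "y3 = gmul (ginv y4) (gmul y1 y2)" using R G by (simp add: gmul_simps)
  then have "psi y3 = matrix_inv (phi_plus y4) ** phi_plus y1 ** psi y2 ** matrix_inv (phi_minus y1)
      ** phi_minus y4"
    using G inv by (simp add: psi_gmul psi_gmul[of y1] matrix_group_simps)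
  also have "\<dots> = matrix_inv (phi_plus y4) ** phi_plus y1 ** matrix_inv (phi_minus y1) **
      (psi y4 ** phi_minus y4)"
    unfolding 4 using inv by (simp add: matrix_group_simps)
  also have "\<dots> = matrix_inv (phi_plus y4) ** psi y1 ** phi_plus y4"
    using inv by (simp add: psi_def matrix_group_simps)
  finally show "B_star (y1, y2) = Some (y4, y3)" using G 4 by (simp add: B_star_iff)
qed

lemma B_ell_iff:
  "B_ell \<sigma> l ((y1, z1), (y2, z2)) = Some ((y4, z4), (y3, z3)) \<longleftrightarrow>
    (y1, z1) \<in> Y_ell \<sigma> l \<and> (y2, z2) \<in> Y_ell \<sigma> l \<and> z4 = z2 \<and> z3 = z1 \<and>
    B_star (y1, y2) = Some (y4, y3)"
proof (cases "B_star (y1, y2)")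
  case (Some p)
  then show ?thesis by (cases p) (simp add: B_ell_def, blast)
qed (simp add: B_ell_def)

text \<open>\<open>psi y4\<close> is a conjugate of \<open>psi y2\<close>, and \<open>psi y3\<close>
  of \<open>psi y1\<close>; so a \<open>z\<close> that fits one end of a strand fits the
  other.\<close>

lemma B_star_in_Y_ell:
  assumes "B_star (y1, y2) = Some (y4, y3)"
  shows "(y4, z) \<in> Y_ell \<sigma> l \<longleftrightarrow> (y2, z) \<in> Y_ell \<sigma> l" "(y3, z) \<in> Y_ell \<sigma> l \<longleftrightarrow> (y1, z) \<in> Y_ell \<sigma> l"
proof -
  have G: "y1 \<in> Gstar" "y2 \<in> Gstar" "y3 \<in> Gstar" "y4 \<in> Gstar"
    and 4: "psi y4 = phi_minus y1 ** psi y2 ** matrix_inv (phi_minus y1)"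
    and 3: "psi y3 = matrix_inv (phi_plus y4) ** psi y1 ** phi_plus y4"
    using assms by (auto simp: B_star_iff)
  show "(y4, z) \<in> Y_ell \<sigma> l \<longleftrightarrow> (y2, z) \<in> Y_ell \<sigma> l" "(y3, z) \<in> Y_ell \<sigma> l \<longleftrightarrow> (y1, z) \<in> Y_ell \<sigma> l"
    using G by (simp_all add: Y_ell_iff 3 4 Q_ell_conj_iff Gstar_invertible)
qed

lemma partial_map_B_ell: "partial_map_on (Y_ell \<sigma> l) (B_ell \<sigma> l)"
proof -
  have "B_ell \<sigma> l p = Some q \<Longrightarrow> p \<in> Y_ell \<sigma> l \<times> Y_ell \<sigma> l \<and> q \<in> Y_ell \<sigma> l \<times> Y_ell \<sigma> l" for p q
    by (cases p; cases q; cases "fst p"; cases "snd p"; cases "fst q"; cases "snd q")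
      (auto simp: B_ell_iff B_star_in_Y_ell)
  then show ?thesis by (force simp: partial_map_on_def dom_def ran_def)
qed

lemma partial_map_quandle_braiding: "quandle Q f \<Longrightarrow> partial_map_on Q (quandle_braiding Q f)"
  by (auto simp: partial_map_on_def quandle_braiding_def quandle_def dom_def ran_def split: if_splits)

section \<open>The two automata on region labels\<close>

definition stepY :: "gstar \<Rightarrow> ycolor point \<Rightarrow> gstar" where
  "stepY g x = gmul g (if snd x then fst (fst x) else ginv (fst (fst x)))"

text \<open>After applying \<open>psi\<close>, the color is (right label)(left label)^-1, left and
  right being taken along the orientation of the edge. In this form reading an edge backwards
  visibly gives the same color; \<open>colY_conj\<close> recovers the conjugate used by the
  functor.\<close>

definition colY :: "gstar \<Rightarrow> ycolor point \<Rightarrow> mat2 \<times> complex" where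
  "colY g x =
     (if snd x then psi (stepY g x) ** matrix_inv (psi g) else psi g ** matrix_inv (psi (stepY g x)),
      snd (fst x))"

text \<open>As the color of an upward edge is the quotient of the right label by the left one,
  passing the edge multiplies the label on the left. The rule does not mention \<open>Gstar\<close>,
  and labels may leave \<open>Gprime\<close>.\<close>

definition stepQ :: "mat2 \<Rightarrow> (mat2 \<times> complex) point \<Rightarrow> mat2" where
  "stepQ M x = (if snd x then fst (fst x) else matrix_inv (fst (fst x))) ** M"

text \<open>Both labels are lifted to \<open>Gstar\<close> and the color is the quotient (left)^-1
  (right) there. Off \<open>Gprime\<close> the value of \<open>psi_inv\<close> is arbitrary, which
  is why good labels have to lie in \<open>Gprime\<close>.\<close>

definition colQ :: "mat2 \<Rightarrow> (mat2 \<times> complex) point \<Rightarrow> ycolor" where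
  "colQ M x =
     (if snd x then gmul (ginv (psi_inv M)) (psi_inv (stepQ M x))
      else gmul (ginv (psi_inv (stepQ M x))) (psi_inv M), snd (fst x))"

lemma fst_Y_ell: "x \<in> Y_ell \<sigma> l \<Longrightarrow> fst x \<in> Gstar"
  by (cases x) (simp add: Y_ell_iff)

lemma stepY_closed: "g \<in> Gstar \<Longrightarrow> fst (fst x) \<in> Gstar \<Longrightarrow> stepY g x \<in> Gstar"
  by (simp add: stepY_def)

lemma stepY_flip: "fst (fst x) \<in> Gstar \<Longrightarrow> stepY (stepY g x) (flip x) = g"
  by (simp add: stepY_def gmul_simps(4,5))

lemma colY_conj:
  assumes "g \<in> Gstar" "fst (fst x) \<in> Gstar"
  defines "h \<equiv> phi_plus (if snd x then g else stepY g x)"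
  shows "colY g x = (h ** psi (fst (fst x)) ** matrix_inv h, snd (fst x))"
  using assms psi_conj[of g "fst (fst x)"] psi_conj[of "stepY g x" "fst (fst x)"]
  by (auto simp: colY_def stepY_def gmul_simps(4))

lemma quandle_braiding_iff:
  "quandle_braiding Q f (a, b) = Some (c, d) \<longleftrightarrow> a \<in> Q \<and> b \<in> Q \<and> c = f a b \<and> d = a"
  by (auto simp: quandle_braiding_def)

text \<open>Labels never leave the group \<open>Gstar\<close>, so every region is good and this
  recoloring is total.\<close>

interpretation fwd: recoloring "Y_ell \<sigma> l" "B_ell \<sigma> l" "Q_ell \<sigma> l"
  "quandle_braiding (Q_ell \<sigma> l) conj_op" Gstar Gstar stepY colY for \<sigma> l
proof
  show "partial_map_on (Y_ell \<sigma> l) (B_ell \<sigma> l)" by (rule partial_map_B_ell)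
next
  fix g :: gstar and x :: "ycolor point"
  assume g: "g \<in> Gstar" and x: "fst x \<in> Y_ell \<sigma> l"
  show "stepY g x \<in> Gstar" "stepY (stepY g x) (flip x) = g"
    using g x by (simp_all add: stepY_closed stepY_flip fst_Y_ell)
  then show "colY (stepY g x) (flip x) = colY g x" by (simp add: colY_def)
next
  fix g :: gstar and x :: "ycolor point"
  assume g: "g \<in> Gstar" and x: "fst x \<in> Y_ell \<sigma> l"
  then have "(psi (fst (fst x)), snd (fst x)) \<in> Q_ell \<sigma> l"
    by (metis Y_ell_iff prod.collapse)
  then show "colY g x \<in> Q_ell \<sigma> l"
    using g x by (simp add: colY_conj fst_Y_ell stepY_closed Gstar_invertible Q_ell_conj)
next
  fix g :: gstar and x1 x2 x4 x3
  assume g: "g \<in> Gstar" and B: "B_ell \<sigma> l (x1, x2) = Some (x4, x3)"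
  obtain y1 z1 y2 z2 y4 z4 y3 z3 where
    x: "x1 = (y1, z1)" "x2 = (y2, z2)" "x4 = (y4, z4)" "x3 = (y3, z3)" by (metis surj_pair)
  have *: "(y1, z1) \<in> Y_ell \<sigma> l" "(y2, z2) \<in> Y_ell \<sigma> l" "z4 = z2" "z3 = z1"
    "B_star (y1, y2) = Some (y4, y3)"
    using B by (auto simp: x B_ell_iff)
  then have G: "y1 \<in> Gstar" "y2 \<in> Gstar" "y3 \<in> Gstar" "y4 \<in> Gstar" by (auto simp: B_star_iff)
  then have R: "gmul y1 y2 = gmul y4 y3" "psi y4 ** phi_minus y1 = phi_minus y1 ** psi y2"
    using * by (auto simp: B_star_iff_gmul)
  show st: "stepY (stepY g (x1, True)) (x2, True) = stepY (stepY g (x4, True)) (x3, True)"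
    using R by (simp add: x stepY_def gmul_simps(1))
  have a: "colY g (x1, True) \<in> Q_ell \<sigma> l" and b: "colY (stepY g (x1, True)) (x2, True) \<in> Q_ell \<sigma> l"
    using * g G by (simp_all add: x colY_conj stepY_closed Gstar_invertible Q_ell_conj Y_ell_iff)
  let ?A = "psi (gmul g y1)" and ?C = "psi (gmul g (gmul y1 y2))"
  have inv: "invertible (psi g)" "invertible ?A" "invertible ?C"
    "invertible (phi_plus g)" "invertible (phi_minus g)" "invertible (phi_plus y1)" "invertible (phi_minus y1)"
    using g G by (simp_all add: psi_invertible Gstar_invertible)
  have 4: "psi y4 = phi_minus y1 ** psi y2 ** matrix_inv (phi_minus y1)"
    using * by (simp add: B_star_iff)
  \<comment> \<open>Let L, B, R, T be the matrices of the regions left of, below, right of and above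
    the crossing. The conjugation rule for the colors B L^-1, R B^-1 and T L^-1 is equivalent to T =
    L B^-1 R, which is proved here.\<close>
  have "psi g ** matrix_inv ?A ** ?C = phi_plus g ** psi y4 ** matrix_inv (phi_minus g)"
    unfolding 4 using g G inv
    by (simp add: psi_gmul) (simp add: psi_def Gstar_invertible matrix_group_simps)
  also have "\<dots> = psi (gmul g y4)" using g G by (simp add: psi_gmul)
  finally have P: "psi (gmul g y4) = psi g ** matrix_inv ?A ** ?C" by simp
  show "quandle_braiding (Q_ell \<sigma> l) conj_op
      (colY g (x1, True), colY (stepY g (x1, True)) (x2, True)) =
      Some (colY g (x4, True), colY (stepY g (x4, True)) (x3, True))"
    unfolding quandle_braiding_iff
  proof (intro conjI a b)
    show "colY g (x4, True) = conj_op (colY g (x1, True)) (colY (stepY g (x1, True)) (x2, True))"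
      using inv * by (simp add: x colY_def stepY_def conj_op_def P gmul_simps(1) matrix_group_simps)
    show "colY (stepY g (x4, True)) (x3, True) = colY g (x1, True)"
      using inv * R by (simp add: x colY_def stepY_def P gmul_simps(1) matrix_group_simps)
  qed
qed

lemma stepQ_colY:
  assumes "g \<in> Gstar" "fst (fst x) \<in> Gstar"
  shows "stepQ (psi g) (colY g x, snd x) = psi (stepY g x)"
  using assms psi_invertible[OF assms(1)] psi_invertible[OF stepY_closed[OF assms]]
  by (simp add: stepQ_def colY_def matrix_group_simps)

lemma colQ_colY:
  assumes "g \<in> Gstar" "fst (fst x) \<in> Gstar"
  shows "colQ (psi g) (colY g x, snd x) = fst x"
proof -
  have "psi_inv (stepQ (psi g) (colY g x, snd x)) = stepY g x"
    using stepQ_colY[OF assms] stepY_closed[OF assms] by simp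
  then have "colQ (psi g) (colY g x, snd x) =
      (if snd x then gmul (ginv g) (stepY g x) else gmul (ginv (stepY g x)) g, snd (fst x))"
    using assms by (auto simp: colQ_def colY_def)
  then show ?thesis
    using assms by (auto simp: stepY_def gmul_simps(2,6,7) gmul_simps(1) prod_eq_iff[of _ x])
      (simp_all add: gmul_def ginv_def matrix_group_simps Gstar_invertible)
qed

text \<open>This undoes \<open>psi_conj\<close>: the lifted color is conjugate to the given one, by
  the inverse holonomy of the region on the left of the edge, and therefore falls into
  \<open>Y_ell\<close>.\<close>

lemma colQ_conj:
  assumes M: "M \<in> Gprime" "stepQ M x \<in> Gprime" and x: "invertible (fst (fst x))"
  defines "h \<equiv> matrix_inv (phi_plus (psi_inv (if snd x then M else stepQ M x)))"
  shows "psi (fst (colQ M x)) = h ** fst (fst x) ** matrix_inv h" "fst (colQ M x) \<in> Gstar"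
proof -
  let ?g = "psi_inv M" and ?g' = "psi_inv (stepQ M x)"
  have G: "?g \<in> Gstar" "?g' \<in> Gstar" using M by auto
  then show "fst (colQ M x) \<in> Gstar" by (simp add: colQ_def)
  have c: "psi (gmul (ginv a) b) = matrix_inv (phi_plus a) ** (psi b ** matrix_inv (psi a)) ** phi_plus a"
    if "a \<in> Gstar" "b \<in> Gstar" for a b
    using that by (simp add: psi_gmul Gstar_invertible psi_def[of a] matrix_group_simps)
  have i: "invertible M" using M by (auto simp: Gprime_def invertible_det_one)
  have i': "invertible (stepQ M x)" using M by (auto simp: Gprime_def invertible_det_one)
  show "psi (fst (colQ M x)) = h ** fst (fst x) ** matrix_inv h"
  proof (cases "snd x")
    case True
    have "psi ?g' ** matrix_inv (psi ?g) = fst (fst x)"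
      using M i x True by simp (simp add: stepQ_def matrix_group_simps)
    then show ?thesis using True c[OF G] G by (simp add: colQ_def h_def matrix_inv_inv Gstar_invertible)
  next
    case False
    have "psi ?g ** matrix_inv (psi ?g') = fst (fst x)"
      using M i x False by simp (simp add: stepQ_def matrix_group_simps)
    then show ?thesis using False c[OF G(2,1)] G by (simp add: colQ_def h_def matrix_inv_inv Gstar_invertible)
  qed
qed

lemma colQ_in_Y_ell:
  assumes M: "M \<in> Gprime" "stepQ M x \<in> Gprime" and x: "fst x \<in> Q_ell \<sigma> l"
  shows "colQ M x \<in> Y_ell \<sigma> l"
proof -
  have i: "invertible (fst (fst x))"
    using x Q_ell_invertible[of "fst (fst x)" "snd (fst x)" \<sigma> l] by auto
  have "(psi (fst (colQ M x)), snd (fst x)) \<in> Q_ell \<sigma> l"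
    unfolding colQ_conj(1)[OF M i]
    by (rule Q_ell_conj(1)) (use M x in \<open>auto simp: Gstar_invertible invertible_inv\<close>)
  moreover have "snd (colQ M x) = snd (fst x)" by (simp add: colQ_def)
  ultimately show ?thesis
    using colQ_conj(2)[OF M i] by (metis Y_ell_iff prod.collapse)
qed

text \<open>Labels of a \<open>Q_ell\<close>-coloring are only known to have determinant 1; a zero
  corner entry is what obstructs the lift.\<close>

interpretation bwd: recoloring "Q_ell \<sigma> l" "quandle_braiding (Q_ell \<sigma> l) conj_op" "Y_ell \<sigma> l"
  "B_ell \<sigma> l" "{M. det M = 1}" Gprime stepQ colQ for \<sigma> l
proof
  show "partial_map_on (Q_ell \<sigma> l) (quandle_braiding (Q_ell \<sigma> l) conj_op)"
    by (rule partial_map_quandle_braiding[OF quandle_Q_ell])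
next
  fix M :: mat2 and x :: "(mat2 \<times> complex) point"
  assume M: "M \<in> {M. det M = 1}" and x: "fst x \<in> Q_ell \<sigma> l"
  have i: "invertible (fst (fst x))" "det (fst (fst x)) = 1"
    using x Q_ell_invertible[of "fst (fst x)" "snd (fst x)" \<sigma> l] Q_ell_det[of "fst (fst x)" "snd (fst x)" \<sigma> l]
    by auto
  show "stepQ M x \<in> {M. det M = 1}" using M i by (simp add: stepQ_def det_mul det_inv)
  show fl: "stepQ (stepQ M x) (flip x) = M" using i by (simp add: stepQ_def matrix_inv_cancel)
  then show "colQ (stepQ M x) (flip x) = colQ M x" by (simp add: colQ_def)
  assume g: "M \<in> Gprime" "stepQ M x \<in> Gprime"
  then show "colQ M x \<in> Y_ell \<sigma> l" using x by (rule colQ_in_Y_ell)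
next
  fix M :: mat2 and x1 x2 x4 x3
  assume M: "M \<in> {M. det M = 1}" and B: "quandle_braiding (Q_ell \<sigma> l) conj_op (x1, x2) = Some (x4, x3)"
  obtain a z b z' where x: "x1 = (a, z)" "x2 = (b, z')" by (metis surj_pair)
  have *: "(a, z) \<in> Q_ell \<sigma> l" "(b, z') \<in> Q_ell \<sigma> l" and x': "x4 = (matrix_inv a ** b ** a, z')" "x3 = (a, z)"
    using B by (auto simp: x quandle_braiding_iff conj_op_def)
  have i: "invertible a" "invertible b" "invertible M"
    using * M by (auto intro: Q_ell_invertible invertible_det_one)
  show "stepQ (stepQ M (x1, True)) (x2, True) = stepQ (stepQ M (x4, True)) (x3, True)"
    using i by (simp add: x x' stepQ_def matrix_group_simps)
  assume "{M, stepQ M (x1, True), stepQ (stepQ M (x1, True)) (x2, True), stepQ M (x4, True)} \<subseteq> Gprime"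
  then have M': "M \<in> Gprime" "a ** M \<in> Gprime" "b ** (a ** M) \<in> Gprime"
      "matrix_inv a ** (b ** (a ** M)) \<in> Gprime"
    by (auto simp: x x' stepQ_def matrix_mul_assoc)
  \<comment> \<open>The lifted labels left of, below, right of and above the crossing; the four
    lifted colors are quotients of neighbors.\<close>
  define gL gB gR gT where g_def: "gL = psi_inv M" "gB = psi_inv (a ** M)"
    "gR = psi_inv (b ** (a ** M))" "gT = psi_inv (matrix_inv a ** (b ** (a ** M)))"
  have G: "gL \<in> Gstar" "gB \<in> Gstar" "gR \<in> Gstar" "gT \<in> Gstar" using M' by (auto simp: g_def)
  have p: "psi gL = M" "psi gB = a ** M" "psi gR = b ** (a ** M)"
    "psi gT = matrix_inv a ** (b ** (a ** M))"
    using M' by (auto simp: g_def)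
  have c: "colQ M (x1, True) = (gmul (ginv gL) gB, z)"
    "colQ (stepQ M (x1, True)) (x2, True) = (gmul (ginv gB) gR, z')"
    "colQ M (x4, True) = (gmul (ginv gL) gT, z')"
    "colQ (stepQ M (x4, True)) (x3, True) = (gmul (ginv gT) gR, z)"
    using i by (simp_all add: colQ_def stepQ_def x x' g_def matrix_group_simps)
  have Y: "colQ M (x1, True) \<in> Y_ell \<sigma> l" "colQ (stepQ M (x1, True)) (x2, True) \<in> Y_ell \<sigma> l"
    using M' * by (auto intro!: colQ_in_Y_ell simp: x stepQ_def)
  have inv: "invertible (phi_plus gL)" "invertible (phi_minus gL)" "invertible (phi_plus gB)"
    "invertible (phi_minus gB)"
    using G by (auto simp: Gstar_invertible)
  \<comment> \<open>Again the conjugation rule as T = L B^-1 R. Through the twisted action it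
    becomes the second condition of \<open>B_star_iff_gmul\<close>, while the equality of products
    is a telescoping of quotients.\<close>
  have T: "psi gT = psi gL ** matrix_inv (psi gB) ** psi gR"
    unfolding p using i by (simp add: matrix_group_simps)
  have "psi (gmul (ginv gL) gT) ** phi_minus (gmul (ginv gL) gB) =
      phi_minus (gmul (ginv gL) gB) ** psi (gmul (ginv gB) gR)"
    using G inv
    by (simp add: psi_gmul T) (simp add: psi_def[of gL] psi_def[of gB] matrix_group_simps)
  moreover have "gmul (gmul (ginv gL) gB) (gmul (ginv gB) gR) = gmul (gmul (ginv gL) gT) (gmul (ginv gT) gR)"
    using G by (simp add: gmul_simps(1,3))
  ultimately have "B_star (gmul (ginv gL) gB, gmul (ginv gB) gR) =
      Some (gmul (ginv gL) gT, gmul (ginv gT) gR)"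
    using G by (subst B_star_iff_gmul) auto
  then show "B_ell \<sigma> l (colQ M (x1, True), colQ (stepQ M (x1, True)) (x2, True)) =
    Some (colQ M (x4, True), colQ (stepQ M (x4, True)) (x3, True))"
    using Y unfolding c by (simp add: B_ell_iff)
qed

section \<open>The two recolorings are inverse to each other\<close>

lemma fwd_regions_in_Gstar:
  "g \<in> Gstar \<Longrightarrow> w \<in> words (Y_ell \<sigma> l) \<Longrightarrow> fwd.regions g w \<subseteq> Gstar"
  by (rule fwd.regions_closed)

text \<open>The map \<open>psi\<close> matches the states: it sends the \<open>Gstar\<close> label
  of a region to the matrix label of the same region.\<close>

lemma bwd_fwd:
  assumes "g \<in> Gstar" "w \<in> words (Y_ell \<sigma> l)"
  shows "bwd.recolor (psi g) (fwd.recolor g w) = w \<and>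
    bwd.regions (psi g) (fwd.recolor g w) = psi ` fwd.regions g w"
  using assms
proof (induction w arbitrary: g)
  case (Cons x w)
  then have x: "fst (fst x) \<in> Gstar" using fst_Y_ell[of "fst x" \<sigma> l] by simp
  with Cons show ?case
    using Cons.IH[OF stepY_closed[OF Cons.prems(1) x]]
    by (simp add: stepQ_colY colQ_colY)
qed simp

lemma stepY_colQ:
  assumes "M \<in> Gprime" "stepQ M x \<in> Gprime" "invertible (fst (fst x))"
  shows "stepY (psi_inv M) (colQ M x, snd x) = psi_inv (stepQ M x)"
    and "colY (psi_inv M) (colQ M x, snd x) = fst x"
proof -
  have G: "psi_inv M \<in> Gstar" "psi_inv (stepQ M x) \<in> Gstar" using assms by auto
  show st: "stepY (psi_inv M) (colQ M x, snd x) = psi_inv (stepQ M x)"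
    using G by (simp add: stepY_def colQ_def gmul_simps(3,6,7))
  have i: "invertible M" using assms by (simp add: Gprime_def invertible_det_one)
  show "colY (psi_inv M) (colQ M x, snd x) = fst x"
    unfolding colY_def st using assms i
    by (simp add: prod_eq_iff[of _ "fst x"]) (simp add: colQ_def stepQ_def matrix_group_simps)
qed

lemma fwd_bwd:
  assumes "M \<in> Gprime" "v \<in> words (Q_ell \<sigma> l)" "bwd.regions M v \<subseteq> Gprime"
  shows "fwd.recolor (psi_inv M) (bwd.recolor M v) = v"
  using assms
proof (induction v arbitrary: M)
  case (Cons x v)
  have x: "invertible (fst (fst x))"
    using Cons.prems(2) Q_ell_invertible[of "fst (fst x)" "snd (fst x)" \<sigma> l] by simp
  have s: "stepQ M x \<in> Gprime"
    using Cons.prems(3) bwd.start_in_regions[of "stepQ M x" v] by (auto simp del: bwd.start_in_regions)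
  show ?case
    using Cons.IH[OF s] Cons.prems by (simp add: stepY_colQ[OF Cons.prems(1) s x])
qed simp

text \<open>Colors are conjugates by \<open>phi_plus\<close> of a label and \<open>phi_plus\<close>
  is multiplicative, so a factor \<open>h\<close> in front of the starting label conjugates all
  colors. The case \<open>g = gone\<close> yields the tensor rule of the functor.\<close>

lemma fwd_recolor_gmul:
  assumes "h \<in> Gstar" "g \<in> Gstar" "w \<in> words (Y_ell \<sigma> l)"
  shows "fwd.recolor (gmul h g) w =
    map (map_prod (\<lambda>(m, t). (phi_plus h ** m ** matrix_inv (phi_plus h), t)) id) (fwd.recolor g w)"
  using assms
proof (induction w arbitrary: g)
  case (Cons x w)
  then have x: "fst (fst x) \<in> Gstar" using fst_Y_ell[of "fst x" \<sigma> l] by simp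
  have st: "stepY (gmul h g) x = gmul h (stepY g x)" by (simp add: stepY_def gmul_simps(1))
  have G: "stepY g x \<in> Gstar" using Cons x by (simp add: stepY_closed)
  have "invertible (phi_plus g)" "invertible (phi_plus h)" "invertible (phi_plus (stepY g x))"
    using G Cons.prems by (simp_all add: Gstar_invertible)
  then have "colY (gmul h g) x =
      (phi_plus h ** fst (colY g x) ** matrix_inv (phi_plus h), snd (colY g x))"
    using colY_conj[of "gmul h g" x] colY_conj[of g x] x Cons.prems
    by (simp add: st matrix_group_simps)
  then show ?case using Cons.IH[OF Cons.prems(1) G] Cons.prems(3) by (simp add: st split_beta)
qed simp

section \<open>The functor as a recoloring\<close>

lemma final_gone_closed:
  assumes "D \<in> colored_diagrams (Y_ell \<sigma> l) B" "i < length (levels D)"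
  shows "levels D ! i \<in> words (Y_ell \<sigma> l)" "fwd.final gone (take k (levels D ! i)) \<in> Gstar"
proof -
  show w: "levels D ! i \<in> words (Y_ell \<sigma> l)" using assms by (auto simp: colored_diagrams_iff)
  have "take k (levels D ! i) @ drop k (levels D ! i) \<in> words (Y_ell \<sigma> l)" using w by simp
  then have "take k (levels D ! i) \<in> words (Y_ell \<sigma> l)" unfolding words_simps by simp
  then show "fwd.final gone (take k (levels D ! i)) \<in> Gstar"
    by (rule fwd.final_closed[OF gone_Gstar])
qed

lemma nth_level_color:
  assumes "D \<in> colored_diagrams (Y_ell \<sigma> l) B" "i < length (levels D)" "k < length (levels D ! i)"
  shows "fst (fst (levels D ! i ! k)) \<in> Gstar"
proof -
  have "levels D ! i = take k (levels D ! i) @ levels D ! i ! k # drop (Suc k) (levels D ! i)"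
    using assms by (simp add: id_take_nth_drop)
  then have "fst (levels D ! i ! k) \<in> Y_ell \<sigma> l"
    using final_gone_closed(1)[OF assms(1,2)] words_simps(2,3) by metis
  then show ?thesis by (rule fst_Y_ell)
qed

lemma final_take_Suc:
  "k < length w \<Longrightarrow> fwd.final g (take (Suc k) w) = stepY (fwd.final g (take k w)) (w ! k)"
  by (simp add: take_Suc_conv_app_nth)

lemma phi_plus_stepY: "phi_plus (stepY g x) = phi_plus g ** edge_holonomy x True"
  by (simp add: stepY_def edge_holonomy_def)

lemma phi_plus_stepY_back:
  "fst (fst x) \<in> Gstar \<Longrightarrow> phi_plus (stepY g x) ** edge_holonomy x False = phi_plus g"
  by (simp add: stepY_def edge_holonomy_def matrix_group_simps Gstar_invertible)

text \<open>A gap left of the piece has the same prefix below and above. A gap right of it differs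
  by the bottom and top words of the piece, which lead to the same state.\<close>

lemma gap_connected_final:
  assumes D: "D \<in> colored_diagrams (Y_ell \<sigma> l) (B_ell \<sigma> l)" and i: "i < length (slices D)"
    and gap: "gap_connected (slices D ! i) k k'"
  shows "fwd.final gone (take k (levels D ! i)) = fwd.final gone (take k' (levels D ! Suc i))"
proof -
  obtain u b t v where *: "length u = fst (slices D ! i)" "levels D ! i = u @ b @ v"
    "levels D ! Suc i = u @ t @ v" "piece_colored (B_ell \<sigma> l) (snd (slices D ! i)) b t"
    using D i unfolding colored_diagrams_iff slice_colored_def by blast
  have len: "i < length (levels D)" "Suc i < length (levels D)"
    using D i by (auto simp: colored_diagrams_iff)
  have w: "u \<in> words (Y_ell \<sigma> l)" "b \<in> words (Y_ell \<sigma> l)" "t \<in> words (Y_ell \<sigma> l)"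
    using final_gone_closed(1)[OF D len(1)] final_gone_closed(1)[OF D len(2)] * by auto
  have eq: "fwd.final (fwd.final gone u) b = fwd.final (fwd.final gone u) t"
    using fwd.piece(1)[OF *(4)] w fwd.final_closed[OF gone_Gstar w(1)] by simp
  show ?thesis
    using gap piece_colored_lengths[OF *(4)] *(1)
    unfolding gap_connected_def *(2,3) by (cases "slices D ! i") (auto simp: eq)
qed

text \<open>Path independence: every rule of \<open>planar_path\<close> preserves the property that
  the accumulated product is \<open>phi_plus\<close> of the state of the automaton at the
  gap.\<close>

lemma planar_path_final:
  assumes "planar_path D p h" and D: "D \<in> colored_diagrams (Y_ell \<sigma> l) (B_ell \<sigma> l)"
  shows "fst p < length (levels D) \<and>
    h = phi_plus (fwd.final gone (take (snd p) (levels D ! fst p)))"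
  using assms(1)
proof induction
  case (right i k h)
  then show ?case by (simp add: final_take_Suc phi_plus_stepY)
next
  case (left i k h)
  then show ?case
    using nth_level_color[OF D, of i k] by (simp add: final_take_Suc phi_plus_stepY_back)
next
  case (up i k h k')
  then show ?case using gap_connected_final[OF D, of i k k'] D by (simp add: colored_diagrams_iff)
next
  case (down i k' h k)
  then show ?case using gap_connected_final[OF D, of i k k'] D by (simp add: colored_diagrams_iff)
qed simp

text \<open>The \<open>THE\<close> is justified by the horizontal path along level \<open>i\<close>
  for existence and by \<open>planar_path_final\<close> for uniqueness.\<close>

lemma region_holonomy_final:
  assumes D: "D \<in> colored_diagrams (Y_ell \<sigma> l) (B_ell \<sigma> l)"
    and i: "i < length (levels D)" and k: "k \<le> length (levels D ! i)"
  shows "region_holonomy D (i, k) = phi_plus (fwd.final gone (take k (levels D ! i)))"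
proof -
  have "planar_path D (i, k) (phi_plus (fwd.final gone (take k (levels D ! i))))"
    using k
  proof (induction k)
    case 0
    then show ?case using planar_path.leftmost[OF i] by simp
  next
    case (Suc k)
    then show ?case
      using planar_path.right[of D i k "phi_plus (fwd.final gone (take k (levels D ! i)))"]
      by (simp add: final_take_Suc phi_plus_stepY)
  qed
  then show ?thesis
    unfolding region_holonomy_def using planar_path_final[OF _ D] by (intro the_equality) fastforce+
qed

lemma Q_diagram_recolor:
  assumes D: "D \<in> colored_diagrams (Y_ell \<sigma> l) (B_ell \<sigma> l)"
  shows "Q_diagram D = fwd.recolor_diagram gone D"
proof -
  have "recolor_point D i j = fwd.recolor gone (levels D ! i) ! j"
    if i: "i < length (levels D)" and j: "j < length (levels D ! i)" for i j
  proof -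
    let ?x = "levels D ! i ! j" and ?g = "fwd.final gone (take j (levels D ! i))"
    \<comment> \<open>Left of a downward edge is the gap after its point, hence
      \<open>Suc j\<close>; this agrees with the case distinction in
      \<open>colY_conj\<close>.\<close>
    have "region_holonomy D (i, if snd ?x then j else Suc j) =
        phi_plus (if snd ?x then ?g else stepY ?g ?x)"
      using region_holonomy_final[OF D i, of j] region_holonomy_final[OF D i, of "Suc j"] j
      by (simp add: final_take_Suc)
    then show ?thesis
      using colY_conj[OF final_gone_closed(2)[OF D i, of j] nth_level_color[OF D i j]] j
      by (simp add: fwd.nth_recolor recolor_point_def Let_def split_beta)
  qed
  then have "map (\<lambda>i. map (recolor_point D i) [0..<length (levels D ! i)]) [0..<length (levels D)]
      = map (fwd.recolor gone) (levels D)"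
    by (intro nth_equalityI) (auto intro!: nth_equalityI)
  then show ?thesis by (simp add: Q_diagram_def fwd.recolor_diagram_def)
qed

lemma Q_object_recolor:
  assumes "w \<in> words (Y_ell \<sigma> l)"
  shows "Q_object w = fwd.recolor gone w"
  using Q_diagram_recolor[OF identity_colored[OF assms]]
  by (simp add: Q_object_def fwd.recolor_diagram_def)

lemma fwd_diagram_regions:
  assumes "D \<in> colored_diagrams (Y_ell \<sigma> l) B"
  shows "fwd.diagram_regions gone D \<subseteq> Gstar"
  unfolding fwd.diagram_regions_def
  using assms fwd_regions_in_Gstar[OF gone_Gstar] by (fastforce simp: colored_diagrams_iff)

lemma bwd_Q_diagram:
  assumes D: "D \<in> colored_diagrams (Y_ell \<sigma> l) (B_ell \<sigma> l)"
  shows "bwd.recolor_diagram (mat 1) (Q_diagram D) = D"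
    and "bwd.diagram_regions (mat 1) (Q_diagram D) \<subseteq> Gprime"
proof -
  have w: "w \<in> words (Y_ell \<sigma> l)" if "w \<in> set (levels D)" for w
    using that D by (simp add: colored_diagrams_iff)
  note * = bwd_fwd[OF gone_Gstar, unfolded psi_gone]
  have "map (\<lambda>w. bwd.recolor (mat 1) (fwd.recolor gone w)) (levels D) = levels D"
    using *[OF w] by (simp add: map_idI)
  then show "bwd.recolor_diagram (mat 1) (Q_diagram D) = D"
    unfolding Q_diagram_recolor[OF D]
    by (simp add: bwd.recolor_diagram_def fwd.recolor_diagram_def o_def)
  have "bwd.regions (mat 1) (fwd.recolor gone w) \<subseteq> Gprime" if "w \<in> set (levels D)" for w
    using *[OF w[OF that]] fwd_regions_in_Gstar[OF gone_Gstar w[OF that]] psi_in_Gprime by auto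
  then show "bwd.diagram_regions (mat 1) (Q_diagram D) \<subseteq> Gprime"
    unfolding Q_diagram_recolor[OF D]
    by (auto simp: bwd.diagram_regions_def fwd.recolor_diagram_def)
qed

lemma Q_diagram_bwd:
  assumes D: "D \<in> colored_diagrams (Q_ell \<sigma> l) (quandle_braiding (Q_ell \<sigma> l) conj_op)"
    and good: "bwd.diagram_regions (mat 1) D \<subseteq> Gprime"
  shows "bwd.recolor_diagram (mat 1) D \<in> colored_diagrams (Y_ell \<sigma> l) (B_ell \<sigma> l)"
    and "Q_diagram (bwd.recolor_diagram (mat 1) D) = D"
proof -
  show c: "bwd.recolor_diagram (mat 1) D \<in> colored_diagrams (Y_ell \<sigma> l) (B_ell \<sigma> l)"
    by (rule bwd.recolor_diagram_colored[OF D _ good]) simp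
  have one: "mat 1 \<in> Gprime" "psi_inv (mat 1) = gone"
    using psi_in_Gprime[OF gone_Gstar] psi_inv_psi[OF gone_Gstar] by (simp_all add: psi_gone)
  have "fwd.recolor gone (bwd.recolor (mat 1) v) = v" if "v \<in> set (levels D)" for v
    using fwd_bwd[OF one(1), of v \<sigma> l] that D good
    by (auto simp: one(2) colored_diagrams_iff bwd.diagram_regions_def)
  then have "map (\<lambda>v. fwd.recolor gone (bwd.recolor (mat 1) v)) (levels D) = levels D"
    by (simp add: map_idI)
  then show "Q_diagram (bwd.recolor_diagram (mat 1) D) = D"
    unfolding Q_diagram_recolor[OF c]
    by (simp add: bwd.recolor_diagram_def fwd.recolor_diagram_def o_def)
qed

section \<open>Functoriality, injectivity and the tensor rule\<close>

abbreviation "BQ \<sigma> l \<equiv> quandle_braiding (Q_ell \<sigma> l) conj_op"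

lemma Q_diagram_colored:
  assumes D: "D \<in> colored_diagrams (Y_ell \<sigma> l) (B_ell \<sigma> l)"
  shows "Q_diagram D \<in> colored_diagrams (Q_ell \<sigma> l) (BQ \<sigma> l)"
  unfolding Q_diagram_recolor[OF D]
  by (rule fwd.recolor_diagram_colored[OF D gone_Gstar fwd_diagram_regions[OF D]])

lemma Q_diagram_isotopy:
  assumes "(D, E) \<in> isotopy (Y_ell \<sigma> l) (B_ell \<sigma> l)"
  shows "(Q_diagram D, Q_diagram E) \<in> isotopy (Q_ell \<sigma> l) (BQ \<sigma> l)"
  using fwd.isotopy_recolor[OF assms gone_Gstar] isotopy_ends(1,2)[OF assms]
  by (simp add: Q_diagram_recolor fwd_diagram_regions)

text \<open>The given isotopy may a priori leave the image of \<open>Q_diagram\<close>. It is pulled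
  back all the same: the labels of \<open>Q_diagram D\<close> are good, and every intermediate
  diagram has the same labels.\<close>

lemma Q_diagram_isotopy_reflect:
  assumes D: "D \<in> colored_diagrams (Y_ell \<sigma> l) (B_ell \<sigma> l)"
    and E: "E \<in> colored_diagrams (Y_ell \<sigma> l) (B_ell \<sigma> l)"
    and iso: "(Q_diagram D, Q_diagram E) \<in> isotopy (Q_ell \<sigma> l) (BQ \<sigma> l)"
  shows "(D, E) \<in> isotopy (Y_ell \<sigma> l) (B_ell \<sigma> l)"
  using bwd.isotopy_recolor[OF iso, of "mat 1"] bwd_Q_diagram[OF D] bwd_Q_diagram[OF E] by simp

lemma Q_diagram_stack:
  assumes D: "D \<in> colored_diagrams (Y_ell \<sigma> l) (B_ell \<sigma> l)"
    and E: "E \<in> colored_diagrams (Y_ell \<sigma> l) (B_ell \<sigma> l)" and eq: "target D = source E"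
  shows "Q_diagram (stack D E) = stack (Q_diagram D) (Q_diagram E)"
  using D E stack_colored[OF D E eq] by (simp add: Q_diagram_recolor fwd.recolor_stack)

lemma source_target_Q_diagram:
  assumes D: "D \<in> colored_diagrams (Y_ell \<sigma> l) (B_ell \<sigma> l)"
  shows "source (Q_diagram D) = Q_object (source D)" "target (Q_diagram D) = Q_object (target D)"
  using D source_in_words[OF D] target_in_words[OF D] colored_levels_nonempty[OF D]
  by (simp_all add: Q_diagram_recolor Q_object_recolor fwd.source_target_recolor)

abbreviation "Q_map \<sigma> l \<equiv> on_classes (Q_ell \<sigma> l) (BQ \<sigma> l) Q_diagram"

lemma Q_map_class:
  assumes D: "D \<in> colored_diagrams (Y_ell \<sigma> l) (B_ell \<sigma> l)"
  shows "Q_map \<sigma> l (isotopy_class (Y_ell \<sigma> l) (B_ell \<sigma> l) D) =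
    isotopy_class (Q_ell \<sigma> l) (BQ \<sigma> l) (Q_diagram D)"
proof -
  have "isotopy_class (Q_ell \<sigma> l) (BQ \<sigma> l) (Q_diagram E) =
      isotopy_class (Q_ell \<sigma> l) (BQ \<sigma> l) (Q_diagram D)"
    if "(D, E) \<in> isotopy (Y_ell \<sigma> l) (B_ell \<sigma> l)" for E
    using isotopy_class_eq[OF Q_diagram_isotopy[OF that]] by simp
  then show ?thesis
    unfolding on_classes_def using isotopy_class_self[OF D] by (intro SUP_eq_const) blast+
qed

lemma Q_functor:
  "is_functor (diagram_category (Y_ell \<sigma> l) (B_ell \<sigma> l))
     (diagram_category (Q_ell \<sigma> l) (BQ \<sigma> l)) Q_object (Q_map \<sigma> l)"
proof -
  let ?C = "diagram_category (Y_ell \<sigma> l) (B_ell \<sigma> l)"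
  let ?D = "diagram_category (Q_ell \<sigma> l) (BQ \<sigma> l)"
  have Obj: "Obj ?C = words (Y_ell \<sigma> l)" "Obj ?D = words (Q_ell \<sigma> l)"
    and Idt: "Idt ?C w = isotopy_class (Y_ell \<sigma> l) (B_ell \<sigma> l) (Diagram [w] [])"
      "Idt ?D v = isotopy_class (Q_ell \<sigma> l) (BQ \<sigma> l) (Diagram [v] [])" for w v
    by (simp_all add: diagram_category_def)
  show ?thesis
    unfolding is_functor_def
  proof (intro conjI ballI impI diagram_category_is_category)
    fix w assume w: "w \<in> Obj ?C"
    then have c: "Diagram [w] [] \<in> colored_diagrams (Y_ell \<sigma> l) (B_ell \<sigma> l)"
      by (simp add: Obj identity_colored)
    show "Q_object w \<in> Obj ?D"
      using source_in_words[OF Q_diagram_colored[OF c]] source_target_Q_diagram[OF c]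
      by (simp add: Obj)
    have "Q_diagram (Diagram [w] []) = Diagram [Q_object w] []"
      using w by (simp add: Q_diagram_recolor[OF c] Q_object_recolor Obj fwd.recolor_diagram_def)
    then show "Q_map \<sigma> l (Idt ?C w) = Idt ?D (Q_object w)"
      by (simp add: Idt Q_map_class[OF c])
  next
    fix f assume "f \<in> Mor ?C"
    then obtain D where D: "D \<in> colored_diagrams (Y_ell \<sigma> l) (B_ell \<sigma> l)"
      and f: "f = isotopy_class (Y_ell \<sigma> l) (B_ell \<sigma> l) D"
      by (rule Mor_diagram_category_cases)
    show "Q_map \<sigma> l f \<in> Mor ?D" "Src ?D (Q_map \<sigma> l f) = Q_object (Src ?C f)"
      "Tgt ?D (Q_map \<sigma> l f) = Q_object (Tgt ?C f)"
      using Q_diagram_colored[OF D] source_target_Q_diagram[OF D] D class_in_Mor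
      by (auto simp: f Q_map_class Src_class Tgt_class)
    fix g assume "g \<in> Mor ?C"
    then obtain E where E: "E \<in> colored_diagrams (Y_ell \<sigma> l) (B_ell \<sigma> l)"
      and g: "g = isotopy_class (Y_ell \<sigma> l) (B_ell \<sigma> l) E"
      by (rule Mor_diagram_category_cases)
    assume "Tgt ?C f = Src ?C g"
    then have eq: "target D = source E" using D E by (simp add: f g Src_class Tgt_class)
    then have eq': "target (Q_diagram D) = source (Q_diagram E)"
      using source_target_Q_diagram[OF D] source_target_Q_diagram[OF E] by simp
    show "Q_map \<sigma> l (Cmp ?C g f) = Cmp ?D (Q_map \<sigma> l g) (Q_map \<sigma> l f)"
      using D E eq eq' stack_colored[OF D E eq]
      by (simp add: f g Cmp_class Q_map_class Q_diagram_stack Q_diagram_colored)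
  qed
qed

lemma inj_on_Q_diagram: "inj_on Q_diagram (colored_diagrams (Y_ell \<sigma> l) (B_ell \<sigma> l))"
  using bwd_Q_diagram(1) by (rule inj_on_inverseI)

lemma inj_on_Q_map: "inj_on (Q_map \<sigma> l) (Mor (diagram_category (Y_ell \<sigma> l) (B_ell \<sigma> l)))"
proof (rule inj_onI)
  fix f g
  assume "f \<in> Mor (diagram_category (Y_ell \<sigma> l) (B_ell \<sigma> l))"
    and "g \<in> Mor (diagram_category (Y_ell \<sigma> l) (B_ell \<sigma> l))" and eq: "Q_map \<sigma> l f = Q_map \<sigma> l g"
  then obtain D E where D: "D \<in> colored_diagrams (Y_ell \<sigma> l) (B_ell \<sigma> l)"
      "f = isotopy_class (Y_ell \<sigma> l) (B_ell \<sigma> l) D"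
    and E: "E \<in> colored_diagrams (Y_ell \<sigma> l) (B_ell \<sigma> l)"
      "g = isotopy_class (Y_ell \<sigma> l) (B_ell \<sigma> l) E"
    by (auto elim!: Mor_diagram_category_cases)
  then have "(Q_diagram D, Q_diagram E) \<in> isotopy (Q_ell \<sigma> l) (BQ \<sigma> l)"
    using eq eq_equiv_class[OF _ isotopy_equiv Q_diagram_colored[OF E(1)]] by (simp add: Q_map_class)
  then show "f = g"
    using isotopy_class_eq[OF Q_diagram_isotopy_reflect] D E by simp
qed

lemma map_diagram_Q_diagram:
  assumes D: "D \<in> colored_diagrams (Y_ell \<sigma> l) (B_ell \<sigma> l)"
  shows "map_diagram (\<lambda>_. ()) (Q_diagram D) = map_diagram (\<lambda>_. ()) D"
proof -
  have "map (map_prod (\<lambda>_. ()) id) (fwd.recolor g w) = map (map_prod (\<lambda>_. ()) id) w" for g w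
    by (induction w arbitrary: g) (simp_all add: map_prod_def split_beta)
  then show ?thesis
    using Q_diagram_recolor[OF D] by (cases D) (simp add: fwd.recolor_diagram_def)
qed

lemma Q_object_Cons:
  assumes x: "x \<in> Y_ell \<sigma> l" and w: "w \<in> words (Y_ell \<sigma> l)"
  shows "Q_object ((x, s) # w) = Q_object [(x, s)] @
    map (map_prod (signed_action (Q_ell \<sigma> l) act_ell (x, s)) id) (Q_object w)"
proof -
  obtain y z where xy: "x = (y, z)" by (cases x)
  have y: "y \<in> Gstar" using fst_Y_ell[OF x] by (simp add: xy)
  \<comment> \<open>A downward letter leads from the unit label to \<open>ginv y\<close>, and
    conjugation by its \<open>phi_plus\<close> is the inverse of the action of \<open>x\<close>, as
    \<open>signed_action\<close> demands.\<close>
  let ?h = "if s then y else ginv y"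
  let ?c = "\<lambda>(m, t). (phi_plus ?h ** m ** matrix_inv (phi_plus ?h), t)"
  have h: "?h \<in> Gstar" using y by simp
  have "Q_object w \<in> words (Q_ell \<sigma> l)"
    using source_in_words[OF Q_diagram_colored[OF identity_colored[OF w]]]
    by (simp add: Q_object_def)
  then have q: "fst p \<in> Q_ell \<sigma> l" if "p \<in> set (Q_object w)" for p
    using that by (auto simp: words_def)
  have "signed_action (Q_ell \<sigma> l) act_ell (x, s) q = ?c q" if "q \<in> Q_ell \<sigma> l" for q
    using that y act_ell_inverse(1)[OF y that, of z]
    by (cases q) (simp add: signed_action_def xy act_ell_def matrix_inv_inv Gstar_invertible)
  then have "map (map_prod (signed_action (Q_ell \<sigma> l) act_ell (x, s)) id) (Q_object w) =
      map (map_prod ?c id) (Q_object w)"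
    using q by (intro map_cong) (auto simp: map_prod_def split_beta)
  also have "\<dots> = fwd.recolor ?h w"
    using fwd_recolor_gmul[OF h gone_Gstar w] by (simp add: Q_object_recolor[OF w] gmul_simps(9))
  finally have *: "map (map_prod (signed_action (Q_ell \<sigma> l) act_ell (x, s)) id) (Q_object w) =
      fwd.recolor ?h w" .
  show ?thesis
    unfolding * using x w by (simp add: Q_object_recolor[of _ \<sigma> l] stepY_def xy gmul_simps(8))
qed

section \<open>Zariski open sets\<close>

definition kap :: "gstar \<Rightarrow> complex" where "kap y = phi_plus y $ 1 $ 1"
definition eps :: "gstar \<Rightarrow> complex" where "eps y = phi_minus y $ 1 $ 2"
definition phi :: "gstar \<Rightarrow> complex" where "phi y = phi_plus y $ 2 $ 1"

lemma coordinates_gs [simp]: "kap (gs k e p) = k" "eps (gs k e p) = e" "phi (gs k e p) = p"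
  by (simp_all add: kap_def eps_def phi_def gs_def)

lemma gs_coordinates: "y \<in> Gstar \<Longrightarrow> gs (kap y) (eps y) (phi y) = y"
  and kap_nonzero: "y \<in> Gstar \<Longrightarrow> kap y \<noteq> 0"
  by (auto elim: Gstar_cases)

definition ev :: "complex poly poly poly \<Rightarrow> gstar \<Rightarrow> complex" where
  "ev p y = poly (poly (poly p [:[:kap y:]:]) [:eps y:]) (phi y)"

lemma ev_simps [simp]:
  "ev (p + q) y = ev p y + ev q y" "ev (p - q) y = ev p y - ev q y" "ev (p * q) y = ev p y * ev q y"
  "ev 1 y = 1" "ev 0 y = 0" "ev (p ^ n) y = ev p y ^ n"
  by (simp_all add: ev_def)

lemma zariski_open_iff:
  "zariski_open Z \<longleftrightarrow> (\<exists>P. Z = {y \<in> Gstar. \<exists>p\<in>P. ev p y \<noteq> 0})"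
  by (simp add: zariski_open_def ev_def kap_def eps_def phi_def)

text \<open>Here \<open>'a\<close> will itself be a ring of polynomials, and evaluation is wanted at
  complex constants: the infinitely many values of \<open>f\<close> cannot all be roots.\<close>

lemma poly_nonzero_somewhere:
  fixes p :: "'a::idom poly" and f :: "complex \<Rightarrow> 'a"
  assumes "p \<noteq> 0" "inj f"
  obtains a where "poly p (f a) \<noteq> 0"
proof -
  have "infinite (range f)" using assms(2) by (simp add: finite_image_iff infinite_UNIV_char_0)
  then have "\<not> range f \<subseteq> {x. poly p x = 0}" using poly_roots_finite[OF assms(1)] finite_subset by blast
  then show thesis using that by auto
qed

lemma ev_nonzero_somewhere:
  assumes "p \<noteq> 0"
  obtains y where "y \<in> Gstar" "ev p y \<noteq> 0"
proof -
  \<comment> \<open>The extra factor is the variable \<kappa>; it forces the chosen value of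
    \<kappa> to be nonzero, as membership in \<open>Gstar\<close> requires.\<close>
  have "p * [:0, 1:] \<noteq> 0" using assms by simp
  moreover have "inj (\<lambda>k :: complex. [:[:k:]:])" by (simp add: inj_def)
  ultimately obtain k where "poly (p * [:0, 1:]) [:[:k:]:] \<noteq> 0" by (rule poly_nonzero_somewhere)
  then have k: "poly p [:[:k:]:] \<noteq> 0" "k \<noteq> 0" by auto
  have "inj (\<lambda>e :: complex. [:e:])" by (simp add: inj_def)
  with k(1) obtain e where e: "poly (poly p [:[:k:]:]) [:e:] \<noteq> 0" by (rule poly_nonzero_somewhere)
  have "inj (\<lambda>f :: complex. f)" by (simp add: inj_def)
  with e obtain f where "poly (poly (poly p [:[:k:]:]) [:e:]) f \<noteq> 0" by (rule poly_nonzero_somewhere)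
  then show thesis using k(2) that[of "gs k e f"] by (simp add: ev_def)
qed

lemma zariski_open_Int:
  assumes "zariski_open Z" "zariski_open Z'"
  shows "zariski_open (Z \<inter> Z')"
proof -
  obtain P P' where *: "Z = {y \<in> Gstar. \<exists>p\<in>P. ev p y \<noteq> 0}" "Z' = {y \<in> Gstar. \<exists>p\<in>P'. ev p y \<noteq> 0}"
    using assms by (auto simp: zariski_open_iff)
  have "Z \<inter> Z' = {y \<in> Gstar. \<exists>r\<in>{p * q | p q. p \<in> P \<and> q \<in> P'}. ev r y \<noteq> 0}"
    unfolding * by (auto; force)
  then show ?thesis unfolding zariski_open_iff by blast
qed

text \<open>Irreducibility of \<open>Gstar\<close>: polynomials over a domain have no zero divisors,
  and the product of two nonzero ones is nonzero at some point of \<open>Gstar\<close>.\<close>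

lemma zariski_open_Int_nonempty:
  assumes "zariski_open Z" "zariski_open Z'" "Z \<noteq> {}" "Z' \<noteq> {}"
  shows "Z \<inter> Z' \<noteq> {}"
proof -
  obtain P P' where *: "Z = {y \<in> Gstar. \<exists>p\<in>P. ev p y \<noteq> 0}" "Z' = {y \<in> Gstar. \<exists>p\<in>P'. ev p y \<noteq> 0}"
    using assms by (auto simp: zariski_open_iff)
  with assms(3,4) obtain p q where p: "p \<in> P" "p \<noteq> 0" and q: "q \<in> P'" "q \<noteq> 0"
    using ev_simps(5) by fastforce
  then obtain y where "y \<in> Gstar" "ev (p * q) y \<noteq> 0"
    using ev_nonzero_somewhere[of "p * q"] by auto
  with p q have "y \<in> Z \<inter> Z'" by (auto simp: *)
  then show ?thesis by blast
qed

lemma zariski_open_Gstar: "zariski_open Gstar"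
  unfolding zariski_open_iff by (rule exI[of _ "{1}"]) simp

text \<open>The denominators allowed on the open set \<open>d \<noteq> 0\<close> are the powers of \<open>\<kappa> d\<close>.\<close>

definition regular :: "(gstar \<Rightarrow> complex) \<Rightarrow> (gstar \<Rightarrow> complex) \<Rightarrow> bool" where
  "regular d f \<longleftrightarrow> (\<exists>q n. \<forall>y\<in>Gstar. d y \<noteq> 0 \<longrightarrow> f y * (kap y * d y) ^ n = ev q y)"

definition polynomial_map :: "(gstar \<Rightarrow> complex) \<Rightarrow> bool" where
  "polynomial_map f \<longleftrightarrow> (\<exists>q. \<forall>y\<in>Gstar. f y = ev q y)"

lemma polynomial_map_intros [intro]:
  "polynomial_map (\<lambda>y. c)" "polynomial_map kap" "polynomial_map eps" "polynomial_map phi"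
  "polynomial_map f \<Longrightarrow> polynomial_map g \<Longrightarrow> polynomial_map (\<lambda>y. f y + g y)"
  "polynomial_map f \<Longrightarrow> polynomial_map g \<Longrightarrow> polynomial_map (\<lambda>y. f y - g y)"
  "polynomial_map f \<Longrightarrow> polynomial_map g \<Longrightarrow> polynomial_map (\<lambda>y. f y * g y)"
proof -
  show "polynomial_map (\<lambda>y. c)"
    unfolding polynomial_map_def by (rule exI[of _ "[:[:[:c:]:]:]"]) (simp add: ev_def)
  show "polynomial_map kap"
    unfolding polynomial_map_def by (rule exI[of _ "[:0, 1:]"]) (simp add: ev_def)
  show "polynomial_map eps"
    unfolding polynomial_map_def by (rule exI[of _ "[:[:0, 1:]:]"]) (simp add: ev_def)
  show "polynomial_map phi"
    unfolding polynomial_map_def by (rule exI[of _ "[:[:[:0, 1:]:]:]"]) (simp add: ev_def)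
  show "polynomial_map (\<lambda>y. f y + g y)" "polynomial_map (\<lambda>y. f y - g y)" "polynomial_map (\<lambda>y. f y * g y)"
    if "polynomial_map f" "polynomial_map g" for f g
    using that unfolding polynomial_map_def by (metis ev_simps(1-3))+
qed

lemma regular_of_polynomial: "polynomial_map f \<Longrightarrow> regular d f"
  unfolding polynomial_map_def regular_def by (metis mult.right_neutral power_0)

context
  fixes d :: "gstar \<Rightarrow> complex"
  assumes d: "polynomial_map d"
begin

lemma denominator: "\<exists>q. \<forall>y\<in>Gstar. kap y * d y = ev q y"
  using polynomial_map_intros(7)[OF polynomial_map_intros(2) d] by (simp add: polynomial_map_def)

lemma regular_add:
  assumes "regular d f" "regular d g"
  shows "regular d (\<lambda>y. f y + g y)"
proof -
  obtain q n q' n' where *: "\<forall>y\<in>Gstar. d y \<noteq> 0 \<longrightarrow> f y * (kap y * d y) ^ n = ev q y"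
    "\<forall>y\<in>Gstar. d y \<noteq> 0 \<longrightarrow> g y * (kap y * d y) ^ n' = ev q' y"
    using assms by (auto simp: regular_def)
  obtain e where e: "\<forall>y\<in>Gstar. kap y * d y = ev e y" using denominator by blast
  have "(f y + g y) * (kap y * d y) ^ (n + n') = ev (q * e ^ n' + q' * e ^ n) y"
    if "y \<in> Gstar" "d y \<noteq> 0" for y
  proof -
    have "ev (q * e ^ n' + q' * e ^ n) y =
        f y * (kap y * d y) ^ n * (kap y * d y) ^ n' + g y * (kap y * d y) ^ n' * (kap y * d y) ^ n"
      using * e that by simp
    then show ?thesis by (simp add: power_add algebra_simps)
  qed
  then show ?thesis unfolding regular_def by blast
qed

lemma regular_mult:
  assumes "regular d f" "regular d g"
  shows "regular d (\<lambda>y. f y * g y)"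
proof -
  obtain q n q' n' where *: "\<forall>y\<in>Gstar. d y \<noteq> 0 \<longrightarrow> f y * (kap y * d y) ^ n = ev q y"
    "\<forall>y\<in>Gstar. d y \<noteq> 0 \<longrightarrow> g y * (kap y * d y) ^ n' = ev q' y"
    using assms by (auto simp: regular_def)
  have "(f y * g y) * (kap y * d y) ^ (n + n') = ev (q * q') y"
    if "y \<in> Gstar" "d y \<noteq> 0" for y
    using * that by (simp add: power_add) (metis mult.assoc mult.left_commute)
  then show ?thesis unfolding regular_def by blast
qed

lemma regular_const: "regular d (\<lambda>y. c)"
  by (rule regular_of_polynomial) auto

lemma regular_diff:
  assumes "regular d f" "regular d g"
  shows "regular d (\<lambda>y. f y - g y)"
  using regular_add[OF assms(1) regular_mult[OF regular_const[of "-1"] assms(2)]] by simp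

lemma regular_divide_const: "regular d f \<Longrightarrow> regular d (\<lambda>y. f y / c)"
  using regular_mult[of f "\<lambda>_. 1 / c"] regular_const by simp

lemma regular_divide_kap:
  assumes "regular d f"
  shows "regular d (\<lambda>y. f y / kap y)"
proof -
  obtain q where "\<forall>y\<in>Gstar. d y = ev q y" using d by (auto simp: polynomial_map_def)
  then have "\<forall>y\<in>Gstar. d y \<noteq> 0 \<longrightarrow> 1 / kap y * (kap y * d y) ^ 1 = ev q y" using kap_nonzero by simp
  then have "regular d (\<lambda>y. 1 / kap y)" unfolding regular_def by blast
  from regular_mult[OF assms this] show ?thesis by simp
qed

lemma regular_divide_denominator:
  assumes "regular d f"
  shows "regular d (\<lambda>y. f y / d y)"
proof -
  obtain q where "\<forall>y\<in>Gstar. kap y = ev q y"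
    using polynomial_map_intros(2) by (auto simp: polynomial_map_def)
  then have "\<forall>y\<in>Gstar. d y \<noteq> 0 \<longrightarrow> 1 / d y * (kap y * d y) ^ 1 = ev q y" by simp
  then have "regular d (\<lambda>y. 1 / d y)" unfolding regular_def by blast
  from regular_mult[OF assms this] show ?thesis by simp
qed

lemma regular_coordinates: "regular d kap" "regular d eps" "regular d phi"
  by (auto intro: regular_of_polynomial)

text \<open>Substitution of regular functions into a polynomial: one Horner induction per variable,
  beginning with the innermost coefficient ring.\<close>

lemma regular_ev:
  assumes "regular d f1" "regular d f2" "regular d f3"
  shows "regular d (\<lambda>y. poly (poly (poly p [:[:f1 y:]:]) [:f2 y:]) (f3 y))"
proof -
  have 1: "regular d (\<lambda>y. poly p (f3 y))" for p
    by (induction p) (auto intro!: regular_add regular_mult regular_const assms)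
  have 2: "regular d (\<lambda>y. poly (poly p [:f2 y:]) (f3 y))" for p
    by (induction p) (auto intro!: regular_add regular_mult regular_const assms 1)
  show ?thesis
    by (induction p) (auto intro!: regular_add regular_mult regular_const assms 2)
qed

lemma zariski_open_domain: "zariski_open {y \<in> Gstar. d y \<noteq> 0}"
proof -
  obtain q where "\<forall>y\<in>Gstar. d y = ev q y" using d by (auto simp: polynomial_map_def)
  then show ?thesis unfolding zariski_open_iff by (intro exI[of _ "{q}"]) auto
qed

text \<open>Clearing denominators: where \<open>d y \<noteq> 0\<close>, a power of the nonvanishing
  function \<open>kap y * d y\<close> turns \<open>ev p (T y)\<close> into a polynomial without
  changing where it vanishes.\<close>

lemma zariski_open_vimage:
  assumes T: "regular d (kap \<circ> T)" "regular d (eps \<circ> T)" "regular d (phi \<circ> T)"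
    and T_in: "\<And>y. y \<in> Gstar \<Longrightarrow> d y \<noteq> 0 \<Longrightarrow> T y \<in> Gstar"
    and Z: "zariski_open Z"
  shows "zariski_open {y \<in> Gstar. d y \<noteq> 0 \<and> T y \<in> Z}"
proof -
  obtain P where P: "Z = {y \<in> Gstar. \<exists>p\<in>P. ev p y \<noteq> 0}" using Z by (auto simp: zariski_open_iff)
  obtain e where e: "\<forall>y\<in>Gstar. d y = ev e y" using d by (auto simp: polynomial_map_def)
  have "\<exists>r. \<forall>y\<in>Gstar. ev r y \<noteq> 0 \<longleftrightarrow> d y \<noteq> 0 \<and> ev p (T y) \<noteq> 0" for p
  proof -
    have "regular d (\<lambda>y. ev p (T y))"
      using regular_ev[OF T, of p] by (simp add: ev_def)
    then obtain q n where q: "\<forall>y\<in>Gstar. d y \<noteq> 0 \<longrightarrow> ev p (T y) * (kap y * d y) ^ n = ev q y"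
      by (auto simp: regular_def)
    \<comment> \<open>The factor \<open>e\<close> represents \<open>d\<close>; it makes the product
      vanish on the locus \<open>d y = 0\<close>, where \<open>q\<close> is not controlled.\<close>
    have "\<forall>y\<in>Gstar. ev (q * e) y \<noteq> 0 \<longleftrightarrow> d y \<noteq> 0 \<and> ev p (T y) \<noteq> 0"
    proof
      fix y assume "y \<in> Gstar"
      then show "ev (q * e) y \<noteq> 0 \<longleftrightarrow> d y \<noteq> 0 \<and> ev p (T y) \<noteq> 0"
        using e kap_nonzero[of y] q[rule_format, of y, symmetric] by (cases "d y = 0") auto
    qed
    then show ?thesis by blast
  qed
  then obtain r where r: "\<And>p y. y \<in> Gstar \<Longrightarrow> ev (r p) y \<noteq> 0 \<longleftrightarrow> d y \<noteq> 0 \<and> ev p (T y) \<noteq> 0"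
    by metis
  have "{y \<in> Gstar. d y \<noteq> 0 \<and> T y \<in> Z} = {y \<in> Gstar. \<exists>s\<in>r ` P. ev s y \<noteq> 0}"
    using r T_in by (auto simp: P)
  then show ?thesis unfolding zariski_open_iff by blast
qed

end

section \<open>Birational correspondences\<close>

text \<open>Stated for relations instead of partial maps, so that one relation between the ends of a
  strand can be read in both directions and serve several components of B, S and their
  inverses.\<close>

definition open_correspondence :: "(gstar \<Rightarrow> gstar \<Rightarrow> bool) \<Rightarrow> bool" where
  "open_correspondence R \<longleftrightarrow> (\<forall>Z. zariski_open Z \<longrightarrow> Z \<noteq> {} \<longrightarrow>
     zariski_open {y \<in> Gstar. \<exists>y'\<in>Z. R y y'} \<and> {y \<in> Gstar. \<exists>y'\<in>Z. R y y'} \<noteq> {})"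

definition birational :: "(gstar \<Rightarrow> gstar \<Rightarrow> bool) \<Rightarrow> bool" where
  "birational R \<longleftrightarrow> open_correspondence R \<and> open_correspondence R\<inverse>\<inverse> \<and>
     (\<forall>x\<in>Gstar. \<forall>y\<in>Gstar. \<forall>z\<in>Gstar. (R x y \<and> R x z \<longrightarrow> y = z) \<and> (R y x \<and> R z x \<longrightarrow> y = z))"

lemma birational_converse: "birational R \<Longrightarrow> birational R\<inverse>\<inverse>"
  by (simp add: birational_def)

lemma zariski_open_subset: "zariski_open Z \<Longrightarrow> Z \<subseteq> Gstar"
  by (auto simp: zariski_open_iff)

text \<open>The relation is presented as the graph of a rational map and also of its inverse,
  defined where \<open>d\<close>, respectively \<open>d'\<close>, does not vanish. Both denominators
  are nonzero at the unit, so these loci are nonempty and open.\<close>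

lemma birationalI:
  assumes d: "polynomial_map d" "polynomial_map d'" "d gone \<noteq> 0" "d' gone \<noteq> 0"
    and t: "regular d ta" "regular d tb" "regular d tc" "regular d' ua" "regular d' ub" "regular d' uc"
    and R: "\<And>k e p k' e' p'. k \<noteq> 0 \<Longrightarrow> k' \<noteq> 0 \<Longrightarrow> R (gs k e p) (gs k' e' p') \<longleftrightarrow>
      d (gs k e p) \<noteq> 0 \<and> k' = ta (gs k e p) \<and> e' = tb (gs k e p) \<and> p' = tc (gs k e p)"
    and R': "\<And>k e p k' e' p'. k \<noteq> 0 \<Longrightarrow> k' \<noteq> 0 \<Longrightarrow> R (gs k e p) (gs k' e' p') \<longleftrightarrow>
      d' (gs k' e' p') \<noteq> 0 \<and> k = ua (gs k' e' p') \<and> e = ub (gs k' e' p') \<and> p = uc (gs k' e' p')"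
    and nz: "\<And>y. y \<in> Gstar \<Longrightarrow> d y \<noteq> 0 \<Longrightarrow> ta y \<noteq> 0" "\<And>y. y \<in> Gstar \<Longrightarrow> d' y \<noteq> 0 \<Longrightarrow> ua y \<noteq> 0"
  shows "birational R"
proof -
  let ?T = "\<lambda>y. gs (ta y) (tb y) (tc y)" and ?T' = "\<lambda>y. gs (ua y) (ub y) (uc y)"
  have T: "R y y' \<longleftrightarrow> d y \<noteq> 0 \<and> y' = ?T y" if "y \<in> Gstar" "y' \<in> Gstar" for y y'
    using R[of "kap y" "kap y'" "eps y" "phi y" "eps y'" "phi y'"] that kap_nonzero
    by (metis gs_coordinates gs_eq)
  have T': "R y y' \<longleftrightarrow> d' y' \<noteq> 0 \<and> y = ?T' y'" if "y \<in> Gstar" "y' \<in> Gstar" for y y'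
    using R'[of "kap y" "kap y'" "eps y" "phi y" "eps y'" "phi y'"] that kap_nonzero
    by (metis gs_coordinates gs_eq)
  \<comment> \<open>One direction is proved for arbitrary data and used twice, with the map and its
    inverse exchanged.\<close>
  have half: "open_correspondence R"
    if d: "polynomial_map d" "polynomial_map d'" "d' gone \<noteq> 0"
      and t: "regular d ta" "regular d tb" "regular d tc"
      and T: "\<And>y y'. y \<in> Gstar \<Longrightarrow> y' \<in> Gstar \<Longrightarrow> R y y' \<longleftrightarrow> d y \<noteq> 0 \<and> y' = gs (ta y) (tb y) (tc y)"
      and T': "\<And>y y'. y \<in> Gstar \<Longrightarrow> y' \<in> Gstar \<Longrightarrow> R y y' \<longleftrightarrow> d' y' \<noteq> 0 \<and> y = T' y'"
      and nz: "\<And>y. y \<in> Gstar \<Longrightarrow> d y \<noteq> 0 \<Longrightarrow> ta y \<noteq> 0"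
        "\<And>y. y \<in> Gstar \<Longrightarrow> d' y \<noteq> 0 \<Longrightarrow> T' y \<in> Gstar"
    for d d' ta tb tc T' and R :: "gstar \<Rightarrow> gstar \<Rightarrow> bool"
    unfolding open_correspondence_def
  proof (intro allI impI conjI)
    fix Z assume Z: "zariski_open Z" "Z \<noteq> {}"
    note ZG = zariski_open_subset[OF Z(1)]
    have "{y \<in> Gstar. \<exists>y'\<in>Z. R y y'} = {y \<in> Gstar. d y \<noteq> 0 \<and> gs (ta y) (tb y) (tc y) \<in> Z}"
      using T ZG by blast
    then show "zariski_open {y \<in> Gstar. \<exists>y'\<in>Z. R y y'}"
      using zariski_open_vimage[OF d(1), of "\<lambda>y. gs (ta y) (tb y) (tc y)" Z] Z t nz by (simp add: o_def)
    \<comment> \<open>By irreducibility \<open>Z\<close> meets the domain of the inverse map, and a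
      point there has a preimage.\<close>
    have "gone \<in> {y \<in> Gstar. d' y \<noteq> 0}" using d(3) by simp
    then have "Z \<inter> {y \<in> Gstar. d' y \<noteq> 0} \<noteq> {}"
      using zariski_open_Int_nonempty[OF Z(1) zariski_open_domain[OF d(2)] Z(2)] by blast
    then obtain y where y: "y \<in> Z" "y \<in> Gstar" "d' y \<noteq> 0" by blast
    then have "R (T' y) y" "T' y \<in> Gstar" using T'[OF nz(2), of y y] nz(2) by auto
    with y show "{y \<in> Gstar. \<exists>y'\<in>Z. R y y'} \<noteq> {}" by blast
  qed
  have "open_correspondence R"
    by (rule half[OF d(1,2,4) t(1-3) T T' nz(1)]) (use nz(2) in auto)
  moreover have "open_correspondence R\<inverse>\<inverse>"
    by (rule half[OF d(2,1,3) t(4-6), where T' = ?T]) (use T T' nz in auto)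
  moreover have "\<forall>x\<in>Gstar. \<forall>y\<in>Gstar. \<forall>z\<in>Gstar.
      (R x y \<and> R x z \<longrightarrow> y = z) \<and> (R y x \<and> R z x \<longrightarrow> y = z)"
    using T T' by metis
  ultimately show ?thesis by (simp add: birational_def)
qed

lemmas regular_intros = regular_const regular_coordinates regular_add regular_diff regular_mult
  regular_divide_const regular_divide_kap regular_divide_denominator

section \<open>Eliminating one color from the crossing equations\<close>

lemma B_star_Gstar:
  "B_star (y1, y2) = Some (y4, y3) \<Longrightarrow> y1 \<in> Gstar \<and> y2 \<in> Gstar \<and> y3 \<in> Gstar \<and> y4 \<in> Gstar"
  by (simp add: B_star_iff)

text \<open>Three equations serve to define \<open>y3\<close>: k3 = k1 k2 / k4, e3 = e1 / k4, and p3
  from the \<phi> coordinates of the products. The last one imposes nothing else, so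
  \<open>p1\<close> disappears, and three equations remain. The other eliminations follow the same
  pattern, each with one coordinate that is free in this way.\<close>

lemma eliminate_3:
  assumes k: "k1 \<noteq> 0" "k2 \<noteq> 0" "k4 \<noteq> 0"
  shows "(\<exists>y3. B_star (gs k1 e1 p1, gs k2 e2 p2) = Some (gs k4 e4 p4, y3)) \<longleftrightarrow>
    k4 = k2 + e1 * p2 \<and> p4 = k1 * p2 \<and> (e2 + e1 * k2) * k4 = e1 + e4 * (k1 * k2)"
    (is "?L \<longleftrightarrow> ?R")
proof
  assume ?L
  then obtain y3 where y: "B_star (gs k1 e1 p1, gs k2 e2 p2) = Some (gs k4 e4 p4, y3)" by blast
  then have "y3 \<in> Gstar" using B_star_Gstar by blast
  then obtain k3 e3 p3 where g: "k3 \<noteq> 0" "y3 = gs k3 e3 p3" by (rule Gstar_cases)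
  have *: "k4 = k2 + e1 * p2" "k1 * k2 = k4 * k3" "p4 = k1 * p2" "e1 = e3 * k4"
    "e2 + e1 * k2 = e3 + e4 * k3"
    using y unfolding g(2) B_star_gs[OF k(1,2) g(1) k(3)] by blast+
  have "(e2 + e1 * k2) * k4 = e3 * k4 + e4 * (k4 * k3)" unfolding *(5) by (simp add: algebra_simps)
  then have "(e2 + e1 * k2) * k4 = e1 + e4 * (k1 * k2)" by (simp only: *(2) *(4)[symmetric])
  with * show ?R by blast
next
  assume R: ?R
  define k3 e3 where "k3 = k1 * k2 / k4" and "e3 = e1 / k4"
  have *: "k3 \<noteq> 0" "k1 * k2 = k4 * k3" "e1 = e3 * k4" using k by (simp_all add: k3_def e3_def)
  have "(e3 + e4 * k3) * k4 = e3 * k4 + e4 * (k4 * k3)" by (simp add: algebra_simps)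
  then have "(e2 + e1 * k2) * k4 = (e3 + e4 * k3) * k4"
    using R[THEN conjunct2, THEN conjunct2] unfolding *(2,3)[symmetric] by (rule trans[OF _ sym, rotated])
  then have "e2 + e1 * k2 = e3 + e4 * k3" using k by simp
  moreover have "p1 * k2 + p2 = p4 * k3 + (p1 * k2 + p2 - p4 * k3)" by simp
  ultimately have "B_star (gs k1 e1 p1, gs k2 e2 p2) = Some (gs k4 e4 p4, gs k3 e3 (p1 * k2 + p2 - p4 * k3))"
    unfolding B_star_gs[OF k(1,2) *(1) k(3)] using R * by blast
  then show ?L by blast
qed

lemma eliminate_4:
  assumes k: "k1 \<noteq> 0" "k2 \<noteq> 0" "k3 \<noteq> 0"
  shows "(\<exists>y4. B_star (gs k1 e1 p1, gs k2 e2 p2) = Some (y4, gs k3 e3 p3)) \<longleftrightarrow>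
    k1 * k2 = (k2 + e1 * p2) * k3 \<and> e1 = e3 * (k2 + e1 * p2) \<and> p1 * k2 + p2 = k1 * p2 * k3 + p3"
    (is "?L \<longleftrightarrow> ?R")
proof
  assume ?L
  then obtain y4 where y: "B_star (gs k1 e1 p1, gs k2 e2 p2) = Some (y4, gs k3 e3 p3)" by blast
  then have "y4 \<in> Gstar" using B_star_Gstar by blast
  then obtain k4 e4 p4 where g: "k4 \<noteq> 0" "y4 = gs k4 e4 p4" by (rule Gstar_cases)
  have *: "k4 = k2 + e1 * p2" "k1 * k2 = k4 * k3" "p4 = k1 * p2" "e1 = e3 * k4"
    "p1 * k2 + p2 = p4 * k3 + p3"
    using y unfolding g(2) B_star_gs[OF k g(1)] by blast+
  then show ?R by metis
next
  assume R: ?R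
  \<comment> \<open>The \<kappa> coordinate of the eliminated color divides \<open>k1 * k2\<close>,
    hence is nonzero and the color lies in \<open>Gstar\<close>.\<close>
  then have k4: "k2 + e1 * p2 \<noteq> 0" using k by force
  have "e2 + e1 * k2 = e3 + (e2 + e1 * k2 - e3) / k3 * k3" using k by simp
  then have "B_star (gs k1 e1 p1, gs k2 e2 p2) =
      Some (gs (k2 + e1 * p2) ((e2 + e1 * k2 - e3) / k3) (k1 * p2), gs k3 e3 p3)"
    unfolding B_star_gs[OF k k4] using R by blast
  then show ?L by blast
qed

lemma eliminate_2:
  assumes k: "k1 \<noteq> 0" "k3 \<noteq> 0" "k4 \<noteq> 0"
  shows "(\<exists>y2. B_star (gs k1 e1 p1, y2) = Some (gs k4 e4 p4, gs k3 e3 p3)) \<longleftrightarrow>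
    k1 * k4 = k4 * k3 + e1 * p4 \<and> e1 = e3 * k4 \<and> p1 * (k4 * k3) + p4 = (p4 * k3 + p3) * k1"
    (is "?L \<longleftrightarrow> ?R")
proof
  assume ?L
  then obtain y2 where y: "B_star (gs k1 e1 p1, y2) = Some (gs k4 e4 p4, gs k3 e3 p3)" by blast
  then have "y2 \<in> Gstar" using B_star_Gstar by blast
  then obtain k2 e2 p2 where g: "k2 \<noteq> 0" "y2 = gs k2 e2 p2" by (rule Gstar_cases)
  have *: "k4 = k2 + e1 * p2" "k1 * k2 = k4 * k3" "p4 = k1 * p2" "e1 = e3 * k4"
    "p1 * k2 + p2 = p4 * k3 + p3"
    using y unfolding g(2) B_star_gs[OF k(1) g(1) k(2,3)] by blast+
  have "k1 * k4 = k1 * k2 + e1 * (k1 * p2)" by (subst *(1)) (simp add: algebra_simps)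
  moreover have "(p4 * k3 + p3) * k1 = p1 * (k1 * k2) + k1 * p2"
    unfolding *(5)[symmetric] by (simp add: algebra_simps)
  ultimately show ?R using * by metis
next
  assume R: ?R
  define k2 p2 where "k2 = k4 * k3 / k1" and "p2 = p4 / k1"
  have *: "k2 \<noteq> 0" "k1 * k2 = k4 * k3" "p4 = k1 * p2" using k by (simp_all add: k2_def p2_def)
  have "k1 * k4 = k1 * (k2 + e1 * p2)" using R * by (simp add: algebra_simps)
  then have "k4 = k2 + e1 * p2" using k by simp
  moreover have "k1 * (p1 * k2 + p2) = p1 * (k1 * k2) + k1 * p2" by (simp add: algebra_simps)
  then have "k1 * (p1 * k2 + p2) = (p4 * k3 + p3) * k1"
    using R[THEN conjunct2, THEN conjunct2] unfolding *(2) *(3)[symmetric] by (rule trans)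
  then have "p1 * k2 + p2 = p4 * k3 + p3" using k by (simp add: mult.commute[of k1])
  moreover have "(e3 + e4 * k3 - e1 * k2) + e1 * k2 = e3 + e4 * k3" by simp
  ultimately have "B_star (gs k1 e1 p1, gs k2 (e3 + e4 * k3 - e1 * k2) p2) = Some (gs k4 e4 p4, gs k3 e3 p3)"
    unfolding B_star_gs[OF k(1) *(1) k(2,3)] using R * by blast
  then show ?L by blast
qed

lemma eliminate_1:
  assumes k: "k2 \<noteq> 0" "k3 \<noteq> 0" "k4 \<noteq> 0"
  shows "(\<exists>y1. B_star (y1, gs k2 e2 p2) = Some (gs k4 e4 p4, gs k3 e3 p3)) \<longleftrightarrow>
    k4 = k2 + e3 * k4 * p2 \<and> p4 * k2 = k4 * k3 * p2 \<and> e2 + e3 * k4 * k2 = e3 + e4 * k3"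
    (is "?L \<longleftrightarrow> ?R")
proof
  assume ?L
  then obtain y1 where y: "B_star (y1, gs k2 e2 p2) = Some (gs k4 e4 p4, gs k3 e3 p3)" by blast
  then have "y1 \<in> Gstar" using B_star_Gstar by blast
  then obtain k1 e1 p1 where g: "k1 \<noteq> 0" "y1 = gs k1 e1 p1" by (rule Gstar_cases)
  have *: "k4 = k2 + e1 * p2" "k1 * k2 = k4 * k3" "p4 = k1 * p2" "e1 = e3 * k4"
    "e2 + e1 * k2 = e3 + e4 * k3"
    using y unfolding g(2) B_star_gs[OF g(1) k] by blast+
  have "p4 * k2 = (k1 * k2) * p2" unfolding *(3) by (simp add: algebra_simps)
  then have "p4 * k2 = k4 * k3 * p2" unfolding *(2) .
  with * show ?R by metis
next
  assume R: ?R
  define k1 where "k1 = k4 * k3 / k2"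
  have *: "k1 \<noteq> 0" "k1 * k2 = k4 * k3" using k by (simp_all add: k1_def)
  have "p4 * k2 = (k1 * p2) * k2" using R * by (simp add: algebra_simps)
  then have "p4 = k1 * p2" using k by simp
  moreover have "(p4 * k3 + p3 - p2) / k2 * k2 + p2 = p4 * k3 + p3" using k by simp
  ultimately have "B_star (gs k1 (e3 * k4) ((p4 * k3 + p3 - p2) / k2), gs k2 e2 p2) =
      Some (gs k4 e4 p4, gs k3 e3 p3)"
    unfolding B_star_gs[OF *(1) k] using R * by blast
  then show ?L by blast
qed

text \<open>With \<open>y1\<close> fixed, \<kappa> and \<phi> of \<open>y4\<close> are linear in
  those of \<open>y2\<close>, and the remaining equation is linear in either \<epsilon>.
  \<open>?d\<close> is \<kappa> of \<open>y4\<close> as a function of \<open>y2\<close>, and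
  \<open>?d'\<close> is \<kappa> of \<open>y2\<close> as a function of \<open>y4\<close>; both must
  be nonzero for the colors to lie in \<open>Gstar\<close>.\<close>

lemma birational_fixing_1:
  assumes "y1 \<in> Gstar"
  shows "birational (\<lambda>y2 y4. \<exists>y3. B_star (y1, y2) = Some (y4, y3))"
proof -
  obtain k1 e1 p1 where y: "k1 \<noteq> 0" "y1 = gs k1 e1 p1" using assms by (rule Gstar_cases)
  let ?d = "\<lambda>y. kap y + e1 * phi y" and ?d' = "\<lambda>y. kap y - e1 / k1 * phi y"
  show ?thesis
  proof (rule birationalI[where d = ?d and ta = ?d
        and tb = "\<lambda>y. ((eps y + e1 * kap y) * (kap y + e1 * phi y) - e1) / k1 / kap y"
        and tc = "\<lambda>y. k1 * phi y" and d' = ?d' and ua = ?d'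
        and ub = "\<lambda>y. (e1 + eps y * (k1 * (kap y - e1 / k1 * phi y))) / kap y
                        - e1 * (kap y - e1 / k1 * phi y)"
        and uc = "\<lambda>y. phi y / k1"])
    show pd: "polynomial_map ?d" and pd': "polynomial_map ?d'"
      by (intro polynomial_map_intros)+
    show "regular ?d ?d" "regular ?d (\<lambda>y. ((eps y + e1 * kap y) * (kap y + e1 * phi y) - e1) / k1 / kap y)"
      "regular ?d (\<lambda>y. k1 * phi y)"
      by (intro regular_intros[OF pd])+
    show "regular ?d' ?d'" "regular ?d' (\<lambda>y. (e1 + eps y * (k1 * (kap y - e1 / k1 * phi y))) / kap y
                        - e1 * (kap y - e1 / k1 * phi y))" "regular ?d' (\<lambda>y. phi y / k1)"
      by (intro regular_intros[OF pd'])+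
    fix k2 e2 p2 k4 e4 p4 :: complex assume k: "k2 \<noteq> 0" "k4 \<noteq> 0"
    show "(\<exists>y3. B_star (y1, gs k2 e2 p2) = Some (gs k4 e4 p4, y3)) \<longleftrightarrow>
      kap (gs k2 e2 p2) + e1 * phi (gs k2 e2 p2) \<noteq> 0 \<and> k4 = kap (gs k2 e2 p2) + e1 * phi (gs k2 e2 p2) \<and>
      e4 = ((eps (gs k2 e2 p2) + e1 * kap (gs k2 e2 p2)) * (kap (gs k2 e2 p2) + e1 * phi (gs k2 e2 p2)) - e1)
        / k1 / kap (gs k2 e2 p2) \<and> p4 = k1 * phi (gs k2 e2 p2)"
      unfolding y(2) eliminate_3[OF y(1) k] using k y(1) by (auto simp: field_simps)
    have "k4 = k2 + e1 * p2 \<longleftrightarrow> k2 = k4 - e1 / k1 * p4" "p4 = k1 * p2 \<longleftrightarrow> p2 = p4 / k1" if "p4 = k1 * p2"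
      using that y(1) by (auto simp: field_simps)
    moreover have "p4 = k1 * p2 \<longleftrightarrow> p2 = p4 / k1" using y(1) by (auto simp: field_simps)
    moreover have "(e2 + e1 * k2) * k4 = e1 + e4 * (k1 * k2) \<longleftrightarrow> e2 = (e1 + e4 * (k1 * k2)) / k4 - e1 * k2"
      using k by (auto simp: field_simps)
    ultimately show "(\<exists>y3. B_star (y1, gs k2 e2 p2) = Some (gs k4 e4 p4, y3)) \<longleftrightarrow>
      kap (gs k4 e4 p4) - e1 / k1 * phi (gs k4 e4 p4) \<noteq> 0 \<and>
      k2 = kap (gs k4 e4 p4) - e1 / k1 * phi (gs k4 e4 p4) \<and>
      e2 = (e1 + eps (gs k4 e4 p4) * (k1 * (kap (gs k4 e4 p4) - e1 / k1 * phi (gs k4 e4 p4)))) / kap (gs k4 e4 p4)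
                        - e1 * (kap (gs k4 e4 p4) - e1 / k1 * phi (gs k4 e4 p4)) \<and>
      p2 = phi (gs k4 e4 p4) / k1"
      unfolding y(2) eliminate_3[OF y(1) k] coordinates_gs using k(1) by metis
  qed (auto simp: gone_gs)
qed

lemma birational_fixing_2:
  assumes "y2 \<in> Gstar"
  shows "birational (\<lambda>y1 y3. \<exists>y4. B_star (y1, y2) = Some (y4, y3))"
proof -
  obtain k2 e2 p2 where y: "k2 \<noteq> 0" "y2 = gs k2 e2 p2" using assms by (rule Gstar_cases)
  let ?d = "\<lambda>y. k2 + eps y * p2" and ?d' = "\<lambda>y. 1 - eps y * p2"
  let ?t1 = "\<lambda>y. kap y * k2 / (k2 + eps y * p2)" and ?t2 = "\<lambda>y. eps y / (k2 + eps y * p2)"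
  let ?t3 = "\<lambda>y. phi y * k2 + p2 - kap y * p2 * (kap y * k2 / (k2 + eps y * p2))"
  let ?s1 = "\<lambda>y. kap y / (1 - eps y * p2)" and ?s2 = "\<lambda>y. eps y * k2 / (1 - eps y * p2)"
  let ?s3 = "\<lambda>y. (phi y + kap y / (1 - eps y * p2) * p2 * kap y - p2) / k2"
  show ?thesis
  proof (rule birationalI[where d = ?d and ta = ?t1 and tb = ?t2 and tc = ?t3
        and d' = ?d' and ua = ?s1 and ub = ?s2 and uc = ?s3])
    show pd: "polynomial_map ?d" and pd': "polynomial_map ?d'"
      by (intro polynomial_map_intros)+
    show "regular ?d ?t1" "regular ?d ?t2" "regular ?d ?t3"
      by (intro regular_intros[OF pd])+
    show "regular ?d' ?s1" "regular ?d' ?s2" "regular ?d' ?s3"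
      by (intro regular_intros[OF pd'])+
    fix k1 e1 p1 k3 e3 p3 :: complex assume k: "k1 \<noteq> 0" "k3 \<noteq> 0"
    have "k2 + e1 * p2 \<noteq> 0" if "k1 * k2 = (k2 + e1 * p2) * k3" using that k y(1) by auto
    moreover have "k1 * k2 = (k2 + e1 * p2) * k3 \<longleftrightarrow> k3 = k1 * k2 / (k2 + e1 * p2)"
      "e1 = e3 * (k2 + e1 * p2) \<longleftrightarrow> e3 = e1 / (k2 + e1 * p2)" if "k2 + e1 * p2 \<noteq> 0"
      using that by (auto simp: nonzero_eq_divide_eq mult.commute)
    moreover have "p1 * k2 + p2 = k1 * p2 * k3 + p3 \<longleftrightarrow> p3 = p1 * k2 + p2 - k1 * p2 * k3" by auto
    ultimately show "(\<exists>y4. B_star (gs k1 e1 p1, y2) = Some (y4, gs k3 e3 p3)) \<longleftrightarrow>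
      ?d (gs k1 e1 p1) \<noteq> 0 \<and> k3 = ?t1 (gs k1 e1 p1) \<and> e3 = ?t2 (gs k1 e1 p1) \<and> p3 = ?t3 (gs k1 e1 p1)"
      unfolding y(2) eliminate_4[OF k(1) y(1) k(2)] coordinates_gs by metis
    \<comment> \<open>On the graph the two denominators multiply to the constant \<open>k2\<close>,
      so neither of them vanishes there.\<close>
    have w: "(k2 + e1 * p2) * (1 - e3 * p2) = k2" if "e1 = e3 * (k2 + e1 * p2)"
    proof -
      have "(k2 + e1 * p2) * (1 - e3 * p2) = k2 + e1 * p2 - e3 * (k2 + e1 * p2) * p2"
        by (simp add: algebra_simps)
      then show ?thesis unfolding that[symmetric] by simp
    qed
    have e: "e1 = e3 * (k2 + e1 * p2) \<longleftrightarrow> 1 - e3 * p2 \<noteq> 0 \<and> e1 = e3 * k2 / (1 - e3 * p2)"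
    proof -
      have "e1 = e3 * (k2 + e1 * p2) \<longleftrightarrow> e1 * (1 - e3 * p2) = e3 * k2" by (auto simp: algebra_simps)
      moreover have "1 - e3 * p2 \<noteq> 0" if "e1 = e3 * (k2 + e1 * p2)" using w[OF that] y(1) by auto
      ultimately show ?thesis by (metis nonzero_eq_divide_eq)
    qed
    have "k1 * k2 = (k2 + e1 * p2) * k3 \<longleftrightarrow> k1 = k3 / (1 - e3 * p2)"
      if "e1 = e3 * (k2 + e1 * p2)"
    proof -
      have nz: "1 - e3 * p2 \<noteq> 0" "k2 + e1 * p2 \<noteq> 0" using w[OF that] y(1) by auto
      have X: "k1 * k2 = (k2 + e1 * p2) * (k1 * (1 - e3 * p2))"
        by (subst w[OF that, symmetric]) (simp add: algebra_simps)
      have "k1 * k2 = (k2 + e1 * p2) * k3 \<longleftrightarrow> k1 * (1 - e3 * p2) = k3"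
        unfolding X mult_cancel_left using nz by blast
      then show ?thesis using nz by (metis nonzero_eq_divide_eq)
    qed
    moreover have "p1 * k2 + p2 = k1 * p2 * k3 + p3 \<longleftrightarrow> p1 = (p3 + k1 * p2 * k3 - p2) / k2"
      using y(1) by (auto simp: field_simps)
    ultimately show "(\<exists>y4. B_star (gs k1 e1 p1, y2) = Some (y4, gs k3 e3 p3)) \<longleftrightarrow>
      ?d' (gs k3 e3 p3) \<noteq> 0 \<and> k1 = ?s1 (gs k3 e3 p3) \<and> e1 = ?s2 (gs k3 e3 p3) \<and> p1 = ?s3 (gs k3 e3 p3)"
      unfolding y(2) eliminate_4[OF k(1) y(1) k(2)] coordinates_gs using e by metis
  qed (use y(1) kap_nonzero in \<open>auto simp: gone_gs\<close>)
qed

text \<open>The crossing equations are symmetric under exchanging \<epsilon> with \<phi>, color 1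
  with color 4 and color 2 with color 3. This is the mirror image of
  \<open>birational_fixing_1\<close>; \<open>?d\<close> is now \<kappa> of \<open>y1\<close> and
  \<open>?d'\<close> is \<kappa> of \<open>y3\<close>.\<close>

lemma birational_fixing_4:
  assumes "y4 \<in> Gstar"
  shows "birational (\<lambda>y3 y1. \<exists>y2. B_star (y1, y2) = Some (y4, y3))"
proof -
  obtain k4 e4 p4 where y: "k4 \<noteq> 0" "y4 = gs k4 e4 p4" using assms by (rule Gstar_cases)
  let ?d = "\<lambda>y. kap y + eps y * p4" and ?d' = "\<lambda>y. kap y - p4 / k4 * eps y"
  let ?t2 = "\<lambda>y. eps y * k4"
  let ?t3 = "\<lambda>y. ((p4 * kap y + phi y) * (kap y + eps y * p4) - p4) / k4 / kap y"
  let ?s2 = "\<lambda>y. eps y / k4"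
  let ?s3 = "\<lambda>y. (phi y * (k4 * (kap y - p4 / k4 * eps y)) + p4) / kap y - p4 * (kap y - p4 / k4 * eps y)"
  show ?thesis
  proof (rule birationalI[where d = ?d and ta = ?d and tb = ?t2 and tc = ?t3
        and d' = ?d' and ua = ?d' and ub = ?s2 and uc = ?s3])
    show pd: "polynomial_map ?d" by (intro polynomial_map_intros)
    show pd': "polynomial_map ?d'" by (intro polynomial_map_intros)
    show "regular ?d ?d" "regular ?d ?t2" "regular ?d ?t3"
      by (intro regular_intros[OF pd])+
    show "regular ?d' ?d'" "regular ?d' ?s2" "regular ?d' ?s3"
      by (intro regular_intros[OF pd'])+
    fix k3 e3 p3 k1 e1 p1 :: complex assume k: "k3 \<noteq> 0" "k1 \<noteq> 0"
    have "k1 * k4 = k4 * k3 + e1 * p4 \<longleftrightarrow> k1 = k3 + e3 * p4" if "e1 = e3 * k4"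
    proof -
      have "k4 * k3 + e1 * p4 = (k3 + e3 * p4) * k4" unfolding that by (simp add: algebra_simps)
      then show ?thesis using y(1) by simp
    qed
    moreover have "p1 * (k4 * k3) + p4 = (p4 * k3 + p3) * k1 \<longleftrightarrow> p1 = ((p4 * k3 + p3) * k1 - p4) / k4 / k3"
      using y(1) k by (auto simp: field_simps)
    ultimately show "(\<exists>y2. B_star (gs k1 e1 p1, y2) = Some (y4, gs k3 e3 p3)) \<longleftrightarrow>
      ?d (gs k3 e3 p3) \<noteq> 0 \<and> k1 = ?d (gs k3 e3 p3) \<and> e1 = ?t2 (gs k3 e3 p3) \<and> p1 = ?t3 (gs k3 e3 p3)"
      unfolding y(2) eliminate_2[OF k(2,1) y(1)] coordinates_gs using k(2) by metis
    have "k1 * k4 = k4 * k3 + e1 * p4 \<longleftrightarrow> k3 = k1 - p4 / k4 * e1"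
      using y(1) by (auto simp: field_simps)
    moreover have "e1 = e3 * k4 \<longleftrightarrow> e3 = e1 / k4" using y(1) by auto
    moreover have "p1 * (k4 * k3) + p4 = (p4 * k3 + p3) * k1 \<longleftrightarrow> p3 = (p1 * (k4 * k3) + p4) / k1 - p4 * k3"
      using k by (auto simp: field_simps)
    ultimately show "(\<exists>y2. B_star (gs k1 e1 p1, y2) = Some (y4, gs k3 e3 p3)) \<longleftrightarrow>
      ?d' (gs k1 e1 p1) \<noteq> 0 \<and> k3 = ?d' (gs k1 e1 p1) \<and> e3 = ?s2 (gs k1 e1 p1) \<and> p3 = ?s3 (gs k1 e1 p1)"
      unfolding y(2) eliminate_2[OF k(2,1) y(1)] coordinates_gs using k(1) by metis
  qed (auto simp: gone_gs)
qed

text \<open>The mirror image of \<open>birational_fixing_2\<close> under the same symmetry. Again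
  the two denominators multiply to a constant, here \<open>k3\<close>, as the fact \<open>D\<close>
  records.\<close>

lemma birational_fixing_3:
  assumes "y3 \<in> Gstar"
  shows "birational (\<lambda>y4 y2. \<exists>y1. B_star (y1, y2) = Some (y4, y3))"
proof -
  obtain k3 e3 p3 where y: "k3 \<noteq> 0" "y3 = gs k3 e3 p3" using assms by (rule Gstar_cases)
  let ?d = "\<lambda>y. k3 + e3 * phi y" and ?d' = "\<lambda>y. 1 - e3 * phi y"
  let ?t1 = "\<lambda>y. kap y * k3 / (k3 + e3 * phi y)" and ?t3 = "\<lambda>y. phi y / (k3 + e3 * phi y)"
  let ?t2 = "\<lambda>y. e3 + eps y * k3 - e3 * kap y * (kap y * k3 / (k3 + e3 * phi y))"
  let ?s1 = "\<lambda>y. kap y / (1 - e3 * phi y)" and ?s3 = "\<lambda>y. k3 * phi y / (1 - e3 * phi y)"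
  let ?s2 = "\<lambda>y. (eps y + e3 * (kap y / (1 - e3 * phi y)) * kap y - e3) / k3"
  show ?thesis
  proof (rule birationalI[where d = ?d and ta = ?t1 and tb = ?t2 and tc = ?t3
        and d' = ?d' and ua = ?s1 and ub = ?s2 and uc = ?s3])
    show pd: "polynomial_map ?d" and pd': "polynomial_map ?d'"
      by (intro polynomial_map_intros)+
    show "regular ?d ?t1" "regular ?d ?t2" "regular ?d ?t3"
      by (intro regular_intros[OF pd])+
    show "regular ?d' ?s1" "regular ?d' ?s2" "regular ?d' ?s3"
      by (intro regular_intros[OF pd'])+
    fix k4 e4 p4 k2 e2 p2 :: complex assume k: "k4 \<noteq> 0" "k2 \<noteq> 0"
    have a: "k4 = k2 + e3 * k4 * p2 \<longleftrightarrow> k2 = k4 * (1 - e3 * p2)" by (auto simp: algebra_simps)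
    have c: "p4 * k2 = k4 * k3 * p2 \<longleftrightarrow> p4 * (1 - e3 * p2) = k3 * p2" if "k2 = k4 * (1 - e3 * p2)"
    proof -
      have X: "p4 * k2 = k4 * (p4 * (1 - e3 * p2))" unfolding that by simp
      show ?thesis unfolding X mult.assoc[of k4] mult_cancel_left using k(1) by blast
    qed
    have D: "(k3 + e3 * p4) * (1 - e3 * p2) = k3" if "p4 * (1 - e3 * p2) = k3 * p2"
    proof -
      have "(k3 + e3 * p4) * (1 - e3 * p2) = k3 * (1 - e3 * p2) + e3 * (p4 * (1 - e3 * p2))"
        by (simp add: algebra_simps)
      also have "\<dots> = k3" by (subst that) (simp add: algebra_simps)
      finally show ?thesis .
    qed
    have p: "p4 * (1 - e3 * p2) = k3 * p2 \<longleftrightarrow> p2 * (k3 + e3 * p4) = p4" by (auto simp: algebra_simps)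
    have "k4 = k2 + e3 * k4 * p2 \<and> p4 * k2 = k4 * k3 * p2 \<longleftrightarrow>
        k3 + e3 * p4 \<noteq> 0 \<and> k2 = k4 * k3 / (k3 + e3 * p4) \<and> p2 = p4 / (k3 + e3 * p4)" (is "?L \<longleftrightarrow> ?R")
    proof
      assume ?L
      then have *: "k2 = k4 * (1 - e3 * p2)" "p4 * (1 - e3 * p2) = k3 * p2" using a c by auto
      then have nz: "k3 + e3 * p4 \<noteq> 0" using D y(1) by auto
      have "k4 * k3 = k2 * (k3 + e3 * p4)"
        by (subst D[OF *(2), symmetric]) (simp add: *(1) algebra_simps)
      then show ?R using nz * p by (auto simp: nonzero_eq_divide_eq)
    next
      assume R: ?R
      then have *: "p4 * (1 - e3 * p2) = k3 * p2" using p by simp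
      have "k2 * (k3 + e3 * p4) = k4 * k3" using R by simp
      also have "\<dots> = k4 * ((k3 + e3 * p4) * (1 - e3 * p2))" by (simp only: D[OF *])
      also have "\<dots> = k4 * (1 - e3 * p2) * (k3 + e3 * p4)" by (simp only: mult_ac)
      finally have "k2 = k4 * (1 - e3 * p2)"
        unfolding mult_cancel_right using R by blast
      with * show ?L using a c by simp
    qed
    moreover have "e2 + e3 * k4 * k2 = e3 + e4 * k3 \<longleftrightarrow> e2 = e3 + e4 * k3 - e3 * k4 * k2"
      by (simp only: eq_diff_eq)
    ultimately show "(\<exists>y1. B_star (y1, gs k2 e2 p2) = Some (gs k4 e4 p4, y3)) \<longleftrightarrow>
      ?d (gs k4 e4 p4) \<noteq> 0 \<and> k2 = ?t1 (gs k4 e4 p4) \<and> e2 = ?t2 (gs k4 e4 p4) \<and> p2 = ?t3 (gs k4 e4 p4)"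
      unfolding y(2) eliminate_1[OF k(2) y(1) k(1)] coordinates_gs by metis
    have "k4 = k2 + e3 * k4 * p2 \<and> p4 * k2 = k4 * k3 * p2 \<longleftrightarrow>
        1 - e3 * p2 \<noteq> 0 \<and> k4 = k2 / (1 - e3 * p2) \<and> p4 = k3 * p2 / (1 - e3 * p2)"
    proof (cases "1 - e3 * p2 = 0")
      case True
      then show ?thesis using a k by auto
    next
      case False
      then show ?thesis using a c by (metis nonzero_eq_divide_eq)
    qed
    moreover have "e2 + e3 * k4 * k2 = e3 + e4 * k3 \<longleftrightarrow> e4 = (e2 + e3 * k4 * k2 - e3) / k3"
      using y(1) by (auto simp: field_simps)
    ultimately show "(\<exists>y1. B_star (y1, gs k2 e2 p2) = Some (gs k4 e4 p4, y3)) \<longleftrightarrow>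
      ?d' (gs k2 e2 p2) \<noteq> 0 \<and> k4 = ?s1 (gs k2 e2 p2) \<and> e4 = ?s2 (gs k2 e2 p2) \<and> p4 = ?s3 (gs k2 e2 p2)"
      unfolding y(2) eliminate_1[OF k(2) y(1) k(1)] coordinates_gs by metis
  qed (use y(1) kap_nonzero in \<open>auto simp: gone_gs\<close>)
qed

section \<open>Chebyshev polynomials\<close>

text \<open>The recursion Cb_(n+2) = X Cb_(n+1) - Cb_n comes from the addition formulas for the
  cosine of (n+1)\<theta> plus and minus \<theta>.\<close>

lemma chebyshev_exists: "\<exists>p. \<forall>\<theta>::complex. poly p (2 * cos \<theta>) = 2 * cos (of_nat r * \<theta>)"
proof (induction r rule: less_induct)
  case (less r)
  consider "r = 0" | "r = 1" | n where "r = Suc (Suc n)" by (metis One_nat_def not0_implies_Suc)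
  then show ?case
  proof cases
    case 1
    then show ?thesis by (intro exI[of _ "[:2:]"]) simp
  next
    case 2
    then show ?thesis by (intro exI[of _ "[:0, 1:]"]) simp
  next
    case (3 n)
    obtain p q where p: "\<And>\<theta>::complex. poly p (2 * cos \<theta>) = 2 * cos (of_nat n * \<theta>)"
      and q: "\<And>\<theta>::complex. poly q (2 * cos \<theta>) = 2 * cos (of_nat (Suc n) * \<theta>)"
      using less[of n] less[of "Suc n"] 3 by auto
    have "poly ([:0, 1:] * q - p) (2 * cos \<theta>) = 2 * cos (of_nat r * \<theta>)" for \<theta>
    proof -
      have "of_nat r * \<theta> = of_nat (Suc n) * \<theta> + \<theta>" "of_nat n * \<theta> = of_nat (Suc n) * \<theta> - \<theta>"
        by (simp_all add: 3 algebra_simps)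
      then have "2 * cos (of_nat r * \<theta>) =
          2 * cos \<theta> * (2 * cos (of_nat (Suc n) * \<theta>)) - 2 * cos (of_nat n * \<theta>)"
        by (simp only: cos_add cos_diff) (simp add: algebra_simps)
      then show ?thesis by (simp add: p q del: of_nat_Suc)
    qed
    then show ?thesis by blast
  qed
qed

text \<open>Every complex number has the form 2 cos \<theta>, by the complex \<open>Arccos\<close>,
  so the defining condition fixes all values of the polynomial and the \<open>THE\<close> is
  meaningful.\<close>

lemma poly_Cb: "poly (Cb r) (2 * cos \<theta>) = 2 * cos (of_nat r * \<theta>)"
proof -
  obtain p where p: "\<forall>\<theta>::complex. poly p (2 * cos \<theta>) = 2 * cos (of_nat r * \<theta>)"
    using chebyshev_exists by blast
  have "q = p" if q: "\<forall>\<theta>::complex. poly q (2 * cos \<theta>) = 2 * cos (of_nat r * \<theta>)" for q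
  proof -
    have "poly q z = poly p z" for z
      using p[rule_format, of "Arccos (z / 2)"] q[rule_format, of "Arccos (z / 2)"] by simp
    then show ?thesis by (simp add: poly_eq_poly_eq_iff[symmetric] fun_eq_iff)
  qed
  with p have "\<exists>!p. \<forall>\<theta>::complex. poly p (2 * cos \<theta>) = 2 * cos (of_nat r * \<theta>)" by blast
  from theI'[OF this] show ?thesis unfolding Cb_def by blast
qed

lemma Cb_surj:
  assumes "r > 0" "\<sigma> \<noteq> 0"
  obtains z where "\<sigma> * poly (Cb r) z = t"
proof (rule that)
  show "\<sigma> * poly (Cb r) (2 * cos (Arccos (t / (2 * \<sigma>)) / of_nat r)) = t"
    using assms by (simp add: poly_Cb)
qed

lemma Cb_at_2: "poly (Cb r) 2 = 2"
  using poly_Cb[of r 0] by simp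

lemma Cb_at_minus_2: "poly (Cb r) (- 2) = 2 * (- 1) ^ r"
proof -
  have "cos (of_nat r * complex_of_real pi) = (- 1) ^ r"
    by (metis cos_npi cos_of_real of_real_1 of_real_minus of_real_mult of_real_of_nat_eq of_real_power)
  moreover have "cos (complex_of_real pi) = - 1" by (simp flip: cos_of_real)
  ultimately show ?thesis using poly_Cb[of r "complex_of_real pi"] by simp
qed

section \<open>Genericity\<close>

text \<open>The traces 2 and -2 are excluded by a polynomial that is not identically zero, and over
  any other trace a suitable \<open>z\<close> exists by \<open>Cb_surj\<close>.\<close>

lemma zariski_open_meets_Y_ell:
  assumes "\<sigma> \<noteq> 0" "rr l > 0" "zariski_open Z" "Z \<noteq> {}"
  shows "(Z \<times> UNIV) \<inter> Y_ell \<sigma> l \<noteq> {}"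
proof -
  \<comment> \<open>\<open>?t\<close> is \<kappa> times the trace of \<open>psi y\<close>, which is
    a polynomial; so \<open>?d\<close> vanishes exactly where the trace is 2 or -2.\<close>
  let ?t = "\<lambda>y. kap y * kap y + 1 - phi y * eps y"
  let ?d = "\<lambda>y. (?t y - 2 * kap y) * (?t y + 2 * kap y)"
  have pd: "polynomial_map ?d" by (intro polynomial_map_intros)
  \<comment> \<open>At this point \<open>?t\<close> is 1 and \<open>?d\<close> is -3.\<close>
  have "gs 1 1 1 \<in> {y \<in> Gstar. ?d y \<noteq> 0}" by simp
  then have "Z \<inter> {y \<in> Gstar. ?d y \<noteq> 0} \<noteq> {}"
    using zariski_open_Int_nonempty[OF assms(3) zariski_open_domain[OF pd] assms(4)] by blast
  then obtain y where y: "y \<in> Z" "y \<in> Gstar" "?d y \<noteq> 0" by blast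
  obtain k e p where g: "k \<noteq> 0" "y = gs k e p" using y(2) by (rule Gstar_cases)
  have "kap y * trace (psi y) = ?t y" using g by (simp add: psi_gs field_simps)
  then have "?t y - 2 * kap y = kap y * (trace (psi y) - 2)"
    "?t y + 2 * kap y = kap y * (trace (psi y) + 2)"
    by (simp_all add: algebra_simps)
  then have "trace (psi y) \<notin> {2, - 2}"
    using y(3) by auto
  moreover obtain z where "\<sigma> * poly (Cb (rr l)) z = trace (psi y)"
    using Cb_surj[OF assms(2,1)] by blast
  ultimately have "(y, z) \<in> Y_ell \<sigma> l" using y(2) by (simp add: Y_ell_def)
  with y(1) show ?thesis by blast
qed

lemma Y_ell_in_G_ell: "Y_ell \<sigma> l \<in> G_ell \<sigma> l"
proof -
  have "Y_ell \<sigma> l = (Gstar \<times> UNIV) \<inter> Y_ell \<sigma> l" by (auto simp: Y_ell_iff)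
  moreover have "Gstar \<noteq> {}" using gone_Gstar by blast
  ultimately show ?thesis unfolding G_ell_def using zariski_open_Gstar by blast
qed

lemma G_ell_genericity:
  assumes "\<sigma> \<noteq> 0" "rr l > 0"
  shows "genericity_system (Y_ell \<sigma> l) (G_ell \<sigma> l)"
  unfolding genericity_system_def
proof (intro conjI ballI)
  show "G_ell \<sigma> l \<subseteq> Pow (Y_ell \<sigma> l)" by (auto simp: G_ell_def)
  show "Y_ell \<sigma> l \<in> G_ell \<sigma> l" by (rule Y_ell_in_G_ell)
  show "{} \<notin> G_ell \<sigma> l"
    using zariski_open_meets_Y_ell[OF assms] unfolding G_ell_def by blast
  fix W W' assume "W \<in> G_ell \<sigma> l" "W' \<in> G_ell \<sigma> l"
  then obtain Z Z' where Z: "zariski_open Z" "Z \<noteq> {}" "W = (Z \<times> UNIV) \<inter> Y_ell \<sigma> l"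
    and Z': "zariski_open Z'" "Z' \<noteq> {}" "W' = (Z' \<times> UNIV) \<inter> Y_ell \<sigma> l"
    by (auto simp: G_ell_def)
  have "W \<inter> W' = ((Z \<inter> Z') \<times> UNIV) \<inter> Y_ell \<sigma> l" using Z Z' by blast
  then show "W \<inter> W' \<in> G_ell \<sigma> l"
    using zariski_open_Int[OF Z(1) Z'(1)] zariski_open_Int_nonempty[OF Z(1) Z'(1) Z(2) Z'(2)]
    unfolding G_ell_def by blast
qed

text \<open>Since \<open>z\<close> is carried along unchanged and related colors admit the same
  \<open>z\<close>, the preimage is cut out of \<open>Y_ell\<close> by a condition on the
  \<open>Gstar\<close> entry alone.\<close>

lemma open_correspondence_G_ell:
  assumes R: "open_correspondence R" and W: "W \<in> G_ell \<sigma> l"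
    and Y: "\<And>y y' z. R y y' \<Longrightarrow> (y, z) \<in> Y_ell \<sigma> l \<longleftrightarrow> (y', z) \<in> Y_ell \<sigma> l"
  shows "{x \<in> Y_ell \<sigma> l. \<exists>y'. (y', snd x) \<in> W \<and> R (fst x) y'} \<in> G_ell \<sigma> l"
proof -
  obtain Z where Z: "zariski_open Z" "Z \<noteq> {}" "W = (Z \<times> UNIV) \<inter> Y_ell \<sigma> l"
    using W by (auto simp: G_ell_def)
  let ?U = "{y \<in> Gstar. \<exists>y'\<in>Z. R y y'}"
  have "{x \<in> Y_ell \<sigma> l. \<exists>y'. (y', snd x) \<in> W \<and> R (fst x) y'} = (?U \<times> UNIV) \<inter> Y_ell \<sigma> l"
  proof (rule set_eqI)
    fix x :: ycolor
    obtain y z where x: "x = (y, z)" by (metis surj_pair)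
    show "x \<in> {x \<in> Y_ell \<sigma> l. \<exists>y'. (y', snd x) \<in> W \<and> R (fst x) y'} \<longleftrightarrow>
        x \<in> (?U \<times> UNIV) \<inter> Y_ell \<sigma> l"
      unfolding x mem_Collect_eq fst_conv snd_conv Z(3) Int_iff mem_Times_iff
      using Y[of y _ z] fst_Y_ell[of x \<sigma> l] unfolding x fst_conv by blast
  qed
  moreover have "zariski_open ?U" "?U \<noteq> {}" using R Z(1,2) unfolding open_correspondence_def by blast+
  ultimately show ?thesis unfolding G_ell_def by blast
qed

lemma generic_bijection_birational:
  assumes R: "birational R"
    and Y: "\<And>y y' z. R y y' \<Longrightarrow> (y, z) \<in> Y_ell \<sigma> l \<longleftrightarrow> (y', z) \<in> Y_ell \<sigma> l"
    and f: "\<And>x x'. f x = Some x' \<longleftrightarrow> x \<in> Y_ell \<sigma> l \<and> x' \<in> Y_ell \<sigma> l \<and> snd x' = snd x \<and> R (fst x) (fst x')"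
  shows "generic_bijection (G_ell \<sigma> l) f"
proof -
  have image: "{x'. \<exists>x\<in>W. f x = Some x'} \<in> G_ell \<sigma> l" (is "?I W \<in> _")
    and preimage: "{x. \<exists>x'\<in>W. f x = Some x'} \<in> G_ell \<sigma> l" (is "?P W \<in> _")
    if W: "W \<in> G_ell \<sigma> l" for W
  proof -
    have oc: "open_correspondence R" "open_correspondence R\<inverse>\<inverse>"
      using R unfolding birational_def by blast+
    have sub: "W \<subseteq> Y_ell \<sigma> l" using W by (auto simp: G_ell_def)
    have "?I W = {x \<in> Y_ell \<sigma> l. \<exists>y'. (y', snd x) \<in> W \<and> R\<inverse>\<inverse> (fst x) y'}"
      using sub by (force simp: f)
    also have "\<dots> \<in> G_ell \<sigma> l"
      by (rule open_correspondence_G_ell[OF oc(2) W]) (use Y in auto)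
    finally show "?I W \<in> G_ell \<sigma> l" .
    have "?P W = {x \<in> Y_ell \<sigma> l. \<exists>y'. (y', snd x) \<in> W \<and> R (fst x) y'}"
      using sub by (force simp: f)
    also have "\<dots> \<in> G_ell \<sigma> l"
      by (rule open_correspondence_G_ell[OF oc(1) W Y])
    finally show "?P W \<in> G_ell \<sigma> l" .
  qed
  have mem: "x \<in> Y_ell \<sigma> l \<and> x' \<in> Y_ell \<sigma> l" if "f x = Some x'" for x x'
    using that unfolding f by blast
  \<comment> \<open>Domain and range are the preimage and the image of \<open>Y_ell\<close>, itself
    a generic set.\<close>
  have "dom f = {x. \<exists>x'\<in>Y_ell \<sigma> l. f x = Some x'}" "ran f = {x'. \<exists>x\<in>Y_ell \<sigma> l. f x = Some x'}"
    using mem by (force simp: dom_def ran_def)+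
  moreover have "inj_on f (dom f)"
  proof (rule inj_onI)
    fix x y assume "x \<in> dom f" "f x = f y"
    then obtain x' where "f x = Some x'" "f y = Some x'" by (metis domD)
    then have "R (fst x) (fst x')" "R (fst y) (fst x')" "snd x = snd y"
      "fst x \<in> Gstar" "fst y \<in> Gstar" "fst x' \<in> Gstar"
      unfolding f using fst_Y_ell by metis+
    then show "x = y" using R unfolding birational_def by (metis prod.expand)
  qed
  ultimately show ?thesis
    unfolding generic_bijection_def using image preimage Y_ell_in_G_ell by simp
qed

section \<open>The crossing relation and its four partial maps\<close>

definition graph_map :: "('a \<Rightarrow> 'b \<Rightarrow> bool) \<Rightarrow> ('a \<rightharpoonup> 'b)" where
  "graph_map P = (\<lambda>x. if \<exists>y. P x y then Some (SOME y. P x y) else None)"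

lemma graph_map_iff:
  assumes "\<And>x y y'. P x y \<Longrightarrow> P x y' \<Longrightarrow> y = y'"
  shows "graph_map P x = Some y \<longleftrightarrow> P x y"
  using assms someI[of "P x"] unfolding graph_map_def by auto

lemma component_iff:
  "left_component F x y = Some y' \<longleftrightarrow> (\<exists>z. F (x, y) = Some (y', z))"
  "right_component F x y = Some y' \<longleftrightarrow> (\<exists>z. F (y, x) = Some (z, y'))"
  by (auto simp: left_component_def right_component_def)

lemma generic_biquandle_ell:
  assumes "\<sigma> \<noteq> 0" "rr l > 0"
  shows "generic_biquandle (Y_ell \<sigma> l) (G_ell \<sigma> l) (B_ell \<sigma> l)"
proof -
  let ?Y = "Y_ell \<sigma> l"
  \<comment> \<open>All four maps are read off from this one relation among the colors around a
    crossing: 1 and 2 at the bottom, 4 and 3 at the top.\<close>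
  define C where "C x1 x2 x3 x4 \<longleftrightarrow> B_ell \<sigma> l (x1, x2) = Some (x4, x3)" for x1 x2 x3 x4
  have C: "C x1 x2 x3 x4 \<longleftrightarrow> x1 \<in> ?Y \<and> x2 \<in> ?Y \<and> x3 \<in> ?Y \<and> x4 \<in> ?Y \<and> snd x4 = snd x2 \<and>
      snd x3 = snd x1 \<and> B_star (fst x1, fst x2) = Some (fst x4, fst x3)" for x1 x2 x3 x4
    using B_ell_iff[of \<sigma> l "fst x1" "snd x1" "fst x2" "snd x2" "fst x4" "snd x4" "fst x3" "snd x3"]
      B_star_in_Y_ell[of "fst x1" "fst x2" "fst x4" "fst x3" _ \<sigma> l]
    unfolding C_def prod.collapse by (metis prod.collapse)
  have Yiff: "(y4, z) \<in> ?Y \<longleftrightarrow> (y2, z) \<in> ?Y" "(y3, z) \<in> ?Y \<longleftrightarrow> (y1, z) \<in> ?Y"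
    if "B_star (y1, y2) = Some (y4, y3)" for y1 y2 y3 y4 z
    using B_star_in_Y_ell[OF that] by auto
  note bi = birational_fixing_1 birational_fixing_2 birational_fixing_3 birational_fixing_4
  \<comment> \<open>Two neighboring colors determine the other two. For the bottom pair
    \<open>B_ell\<close> is a map anyway; otherwise the first entries agree by the uniqueness
    clauses of the birational relations, and the \<open>z\<close> entries agree along
    strands.\<close>
  have uniq: "(C x1 x2 x3 x4 \<and> C x1 x2 x3' x4' \<longrightarrow> x3 = x3' \<and> x4 = x4') \<and>
      (C x1 x2 x3 x4 \<and> C x1' x2' x3 x4 \<longrightarrow> x1 = x1' \<and> x2 = x2') \<and>
      (C x1 x2 x3 x4 \<and> C x1 x2' x3' x4 \<longrightarrow> x3 = x3' \<and> x2 = x2') \<and>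
      (C x1 x2 x3 x4 \<and> C x1' x2 x3 x4' \<longrightarrow> x4 = x4' \<and> x1 = x1')"
    for x1 x2 x3 x4 x1' x2' x3' x4'
  proof -
    have G: "fst x \<in> Gstar" if "x \<in> ?Y" for x using that by (rule fst_Y_ell)
    have u4: "fst x1 = fst x1'" if "C x1 x2 x3 x4" "C x1' x2' x3 x4" for x1 x2 x3 x4 x1' x2'
      using that bi(4)[of "fst x4"] unfolding C birational_def by (meson G)
    have u3: "fst x2 = fst x2'" if "C x1 x2 x3 x4" "C x1' x2' x3 x4" for x1 x2 x3 x4 x1' x2'
      using that bi(3)[of "fst x3"] unfolding C birational_def by (meson G)
    have v4: "fst x3 = fst x3'" if "C x1 x2 x3 x4" "C x1 x2' x3' x4" for x1 x2 x3 x4 x2' x3'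
      using that bi(4)[of "fst x4"] unfolding C birational_def by (meson G)
    have v1: "fst x2 = fst x2'" if "C x1 x2 x3 x4" "C x1 x2' x3' x4" for x1 x2 x3 x4 x2' x3'
      using that bi(1)[of "fst x1"] unfolding C birational_def by (meson G)
    have w3: "fst x4 = fst x4'" if "C x1 x2 x3 x4" "C x1' x2 x3 x4'" for x1 x2 x3 x4 x1' x4'
      using that bi(3)[of "fst x3"] unfolding C birational_def by (meson G)
    have w2: "fst x1 = fst x1'" if "C x1 x2 x3 x4" "C x1' x2 x3 x4'" for x1 x2 x3 x4 x1' x4'
      using that bi(2)[of "fst x2"] unfolding C birational_def by (meson G)
    have s: "snd x4 = snd x2" "snd x3 = snd x1" if "C x1 x2 x3 x4" for x1 x2 x3 x4
      using that by (auto simp: C)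
    show ?thesis
    proof (intro conjI impI)
      assume "C x1 x2 x3 x4 \<and> C x1 x2 x3' x4'"
      then show "x3 = x3'" "x4 = x4'" by (auto simp: C_def)
    next
      assume "C x1 x2 x3 x4 \<and> C x1' x2' x3 x4"
      then have c: "C x1 x2 x3 x4" "C x1' x2' x3 x4" by auto
      note s' = s[OF c(1)] s[OF c(2)]
      show "x1 = x1'" by (rule prod_eqI[OF u4[OF c]]) (metis s')
      show "x2 = x2'" by (rule prod_eqI[OF u3[OF c]]) (metis s')
    next
      assume "C x1 x2 x3 x4 \<and> C x1 x2' x3' x4"
      then have c: "C x1 x2 x3 x4" "C x1 x2' x3' x4" by auto
      note s' = s[OF c(1)] s[OF c(2)]
      show "x3 = x3'" by (rule prod_eqI[OF v4[OF c]]) (metis s')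
      show "x2 = x2'" by (rule prod_eqI[OF v1[OF c]]) (metis s')
    next
      assume "C x1 x2 x3 x4 \<and> C x1' x2 x3 x4'"
      then have c: "C x1 x2 x3 x4" "C x1' x2 x3 x4'" by auto
      note s' = s[OF c(1)] s[OF c(2)]
      show "x4 = x4'" by (rule prod_eqI[OF w3[OF c]]) (metis s')
      show "x1 = x1'" by (rule prod_eqI[OF w2[OF c]]) (metis s')
    qed
  qed
  define B' where "B' = graph_map (\<lambda>(x4, x3) (x1, x2). C x1 x2 x3 x4)"
  define S where "S = graph_map (\<lambda>(x4, x1) (x3, x2). C x1 x2 x3 x4)"
  define S' where "S' = graph_map (\<lambda>(x3, x2) (x4, x1). C x1 x2 x3 x4)"
  have B: "B_ell \<sigma> l (x1, x2) = Some (x4, x3) \<longleftrightarrow> C x1 x2 x3 x4"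
    and B': "B' (x4, x3) = Some (x1, x2) \<longleftrightarrow> C x1 x2 x3 x4"
    and S: "S (x4, x1) = Some (x3, x2) \<longleftrightarrow> C x1 x2 x3 x4"
    and S': "S' (x3, x2) = Some (x4, x1) \<longleftrightarrow> C x1 x2 x3 x4" for x1 x2 x3 x4
  proof -
    show "B_ell \<sigma> l (x1, x2) = Some (x4, x3) \<longleftrightarrow> C x1 x2 x3 x4" by (simp add: C_def)
    show "B' (x4, x3) = Some (x1, x2) \<longleftrightarrow> C x1 x2 x3 x4"
      unfolding B'_def by (subst graph_map_iff) (use uniq in \<open>auto split: prod.splits\<close>)
    show "S (x4, x1) = Some (x3, x2) \<longleftrightarrow> C x1 x2 x3 x4"
      unfolding S_def by (subst graph_map_iff) (use uniq in \<open>auto split: prod.splits\<close>)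
    show "S' (x3, x2) = Some (x4, x1) \<longleftrightarrow> C x1 x2 x3 x4"
      unfolding S'_def by (subst graph_map_iff) (use uniq in \<open>auto split: prod.splits\<close>)
  qed
  \<comment> \<open>Fixing one color projects the relation to the ends of the strand that does not
    contain it. By \<open>Yiff\<close> the remaining color then lies in \<open>Y_ell\<close> with
    the right \<open>z\<close>.\<close>
  have C1: "(\<exists>x3. C x1 x2 x3 x4) \<longleftrightarrow> x2 \<in> ?Y \<and> x4 \<in> ?Y \<and> snd x4 = snd x2 \<and>
      (\<exists>y3. B_star (fst x1, fst x2) = Some (fst x4, y3))" if "x1 \<in> ?Y" for x1 x2 x4
    unfolding C using that Yiff(2) by (metis fst_conv snd_conv prod.collapse)
  have C2: "(\<exists>x4. C x1 x2 x3 x4) \<longleftrightarrow> x1 \<in> ?Y \<and> x3 \<in> ?Y \<and> snd x3 = snd x1 \<and>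
      (\<exists>y4. B_star (fst x1, fst x2) = Some (y4, fst x3))" if "x2 \<in> ?Y" for x1 x2 x3
    unfolding C using that Yiff(1) by (metis fst_conv snd_conv prod.collapse)
  have C3: "(\<exists>x1. C x1 x2 x3 x4) \<longleftrightarrow> x2 \<in> ?Y \<and> x4 \<in> ?Y \<and> snd x4 = snd x2 \<and>
      (\<exists>y1. B_star (y1, fst x2) = Some (fst x4, fst x3))" if "x3 \<in> ?Y" for x2 x3 x4
    unfolding C using that Yiff(2) by (metis fst_conv snd_conv prod.collapse)
  have C4: "(\<exists>x2. C x1 x2 x3 x4) \<longleftrightarrow> x1 \<in> ?Y \<and> x3 \<in> ?Y \<and> snd x3 = snd x1 \<and>
      (\<exists>y2. B_star (fst x1, y2) = Some (fst x4, fst x3))" if "x4 \<in> ?Y" for x1 x3 x4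
    unfolding C using that Yiff(1) by (metis fst_conv snd_conv prod.collapse)
  have gen: "generic_bijection (G_ell \<sigma> l) f"
    if "birational R" "\<And>y y' z. R y y' \<Longrightarrow> (y, z) \<in> ?Y \<longleftrightarrow> (y', z) \<in> ?Y"
      "\<And>x x'. f x = Some x' \<longleftrightarrow> x \<in> ?Y \<and> x' \<in> ?Y \<and> snd x' = snd x \<and> R (fst x) (fst x')" for f R
    using that by (rule generic_bijection_birational)
  have gen': "generic_bijection (G_ell \<sigma> l) f"
    if "birational R" "\<And>y y' z. R y y' \<Longrightarrow> (y, z) \<in> ?Y \<longleftrightarrow> (y', z) \<in> ?Y"
      "\<And>x x'. f x' = Some x \<longleftrightarrow> x \<in> ?Y \<and> x' \<in> ?Y \<and> snd x' = snd x \<and> R (fst x) (fst x')" for f R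
    by (rule gen[OF birational_converse[OF that(1)]]) (use that(2,3) in auto)
  have "generic_bijection (G_ell \<sigma> l) (left_component F x) \<and>
      generic_bijection (G_ell \<sigma> l) (right_component F x)"
    if F: "F \<in> {B_ell \<sigma> l, B', S, S'}" and x: "x \<in> ?Y" for F x
  proof -
    have x': "fst x \<in> Gstar" using x by (rule fst_Y_ell)
    note bx = bi[OF x']
    note defs = component_iff B B' S S' C1[OF x] C2[OF x] C3[OF x] C4[OF x]
    have r1: "(y, z) \<in> ?Y \<longleftrightarrow> (y', z) \<in> ?Y" if "\<exists>y3. B_star (fst x, y) = Some (y', y3)" for y y' z
      using that Yiff(1) by blast
    have r2: "(y, z) \<in> ?Y \<longleftrightarrow> (y', z) \<in> ?Y" if "\<exists>y4. B_star (y, fst x) = Some (y4, y')" for y y' z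
      using that Yiff(2) by blast
    have r3: "(y, z) \<in> ?Y \<longleftrightarrow> (y', z) \<in> ?Y" if "\<exists>y1. B_star (y1, y') = Some (y, fst x)" for y y' z
      using that Yiff(1) by blast
    have r4: "(y, z) \<in> ?Y \<longleftrightarrow> (y', z) \<in> ?Y" if "\<exists>y2. B_star (y', y2) = Some (fst x, y)" for y y' z
      using that Yiff(2) by blast
    \<comment> \<open>The left and right components fix colors 1 and 2 for \<open>B_ell\<close>, 4
      and 3 for \<open>B'\<close>, 4 and 1 for \<open>S\<close>, 3 and 2 for \<open>S'\<close>. For
      \<open>S\<close> and \<open>S'\<close> the map runs against the direction of the relation,
      hence \<open>gen'\<close>.\<close>
    from F consider "F = B_ell \<sigma> l" | "F = B'" | "F = S" | "F = S'" by blast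
    then show ?thesis
    proof cases
      case 1
      have "generic_bijection (G_ell \<sigma> l) (left_component F x)"
        unfolding 1 by (rule gen[OF bx(1)], erule r1, unfold defs, metis)
      moreover have "generic_bijection (G_ell \<sigma> l) (right_component F x)"
        unfolding 1 by (rule gen[OF bx(2)], erule r2, unfold defs, metis)
      ultimately show ?thesis by blast
    next
      case 2
      have "generic_bijection (G_ell \<sigma> l) (left_component F x)"
        unfolding 2 by (rule gen[OF bx(4)], erule r4, unfold defs, metis)
      moreover have "generic_bijection (G_ell \<sigma> l) (right_component F x)"
        unfolding 2 by (rule gen[OF bx(3)], erule r3, unfold defs, metis)
      ultimately show ?thesis by blast
    next
      case 3
      have "generic_bijection (G_ell \<sigma> l) (left_component F x)"
        unfolding 3 by (rule gen'[OF bx(4)], erule r4, unfold defs, metis)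
      moreover have "generic_bijection (G_ell \<sigma> l) (right_component F x)"
        unfolding 3 by (rule gen'[OF bx(1)], erule r1, unfold defs, metis)
      ultimately show ?thesis by blast
    next
      case 4
      have "generic_bijection (G_ell \<sigma> l) (left_component F x)"
        unfolding 4 by (rule gen'[OF bx(3)], erule r3, unfold defs, metis)
      moreover have "generic_bijection (G_ell \<sigma> l) (right_component F x)"
        unfolding 4 by (rule gen'[OF bx(2)], erule r2, unfold defs, metis)
      ultimately show ?thesis by blast
    qed
  qed
  moreover have "partial_map_on ?Y F" if "F \<in> {B_ell \<sigma> l, B', S, S'}" for F
  proof -
    have "F p = Some q \<Longrightarrow> p \<in> ?Y \<times> ?Y \<and> q \<in> ?Y \<times> ?Y" for p q
      using that by (cases p; cases q) (auto simp: B B' S S' C)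
    then show ?thesis unfolding partial_map_on_def dom_def ran_def by blast
  qed
  ultimately show ?thesis
    unfolding generic_biquandle_def using G_ell_genericity[OF assms] B B' S S'
    by (intro conjI exI[of _ B'] exI[of _ S] exI[of _ S']) simp_all
qed

section \<open>Generic lifts of diagrams\<close>

lemma map_diagram_act_ell_colored:
  assumes x: "x \<in> Y_ell \<sigma> l" and D: "D \<in> colored_diagrams (Q_ell \<sigma> l) (BQ \<sigma> l)"
  shows "map_diagram (act_ell x) D \<in> colored_diagrams (Q_ell \<sigma> l) (BQ \<sigma> l)"
proof -
  have aut: "quandle_aut (Q_ell \<sigma> l) conj_op (act_ell x)" using x by (rule quandle_aut_act_ell)
  then have act_in: "act_ell x q \<in> Q_ell \<sigma> l" if "q \<in> Q_ell \<sigma> l" for q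
    using that by (auto simp: quandle_aut_def bij_betw_def)
  \<comment> \<open>Acting by one automorphism is a recoloring whose automaton has a single
    state.\<close>
  interpret act: recoloring "Q_ell \<sigma> l" "BQ \<sigma> l" "Q_ell \<sigma> l" "BQ \<sigma> l" UNIV UNIV
    "\<lambda>_ _. ()" "\<lambda>_ p. act_ell x (fst p)"
    by unfold_locales
      (use aut act_in in \<open>auto simp: quandle_braiding_iff quandle_aut_def
        intro!: partial_map_quandle_braiding quandle_Q_ell\<close>)
  have "act.recolor () w = map (map_prod (act_ell x) id) w" for w
    by (induction w) (simp_all add: map_prod_def split_beta)
  then have "map_diagram (act_ell x) D = act.recolor_diagram () D"
    by (cases D) (simp add: act.recolor_diagram_def)
  then show ?thesis using act.recolor_diagram_colored[OF D] by simp
qed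

text \<open>A label is a product of colors and their inverses times the starting label, so
  conjugating all of these conjugates the label.\<close>

lemma bwd_regions_act_ell:
  assumes y: "y \<in> Gstar" and w: "w \<in> words (Q_ell \<sigma> l)"
  defines "c \<equiv> \<lambda>M. phi_plus y ** M ** matrix_inv (phi_plus y)"
  shows "bwd.regions (c M) (map (map_prod (act_ell (y, z)) id) w) = c ` bwd.regions M w"
  using w
proof (induction w arbitrary: M)
  case (Cons p w)
  have "invertible (fst (fst p))" "invertible (phi_plus y)"
    using Cons.prems Q_ell_invertible[of "fst (fst p)" "snd (fst p)" \<sigma> l] y
    by (simp_all add: Gstar_invertible)
  then have "stepQ (c M) (map_prod (act_ell (y, z)) id p) = c (stepQ M p)"
    by (cases p; cases "fst p") (simp add: stepQ_def act_ell_def c_def matrix_group_simps)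
  then show ?case using Cons by (simp add: id_def)
qed simp

lemma zariski_open_conj_in_Gprime:
  assumes "finite Ms" "\<forall>M\<in>Ms. det M = 1"
  shows "\<exists>U. zariski_open U \<and> U \<noteq> {} \<and>
    (\<forall>y\<in>U. \<forall>M\<in>Ms. phi_plus y ** M ** matrix_inv (phi_plus y) \<in> Gprime)"
  using assms
proof (induction Ms rule: finite_induct)
  case empty
  then show ?case using zariski_open_Gstar gone_Gstar by blast
next
  case (insert M Ms)
  obtain U where U: "zariski_open U" "U \<noteq> {}"
    "\<And>y M. y \<in> U \<Longrightarrow> M \<in> Ms \<Longrightarrow> phi_plus y ** M ** matrix_inv (phi_plus y) \<in> Gprime"
    using insert.IH insert.prems by blast
  have M: "det M = 1" using insert.prems by simp
  \<comment> \<open>The upper left entry of the conjugated matrix, in which \<kappa>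
    cancels.\<close>
  let ?d = "\<lambda>y. M$1$1 - phi y * M$1$2"
  let ?V = "{y \<in> Gstar. ?d y \<noteq> 0}"
  have V: "zariski_open ?V" by (intro zariski_open_domain polynomial_map_intros)
  \<comment> \<open>At \<phi> = 0 and \<phi> = 1 the values of \<open>?d\<close> are M11 and M11 -
    M12. Both vanish only if the first row of \<open>M\<close> is zero, against
    \<open>det M = 1\<close>.\<close>
  have "gs 1 0 0 \<in> ?V \<or> gs 1 0 1 \<in> ?V" using M by (auto simp: det_2)
  then have "U \<inter> ?V \<noteq> {}" using zariski_open_Int_nonempty[OF U(1) V U(2)] by blast
  moreover have "phi_plus y ** M ** matrix_inv (phi_plus y) \<in> Gprime" if y: "y \<in> ?V" for y
  proof -
    obtain k e p where g: "k \<noteq> 0" "y = gs k e p" using y by (auto elim: Gstar_cases)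
    have "(phi_plus y ** M ** matrix_inv (phi_plus y)) $ 1 $ 1 = ?d y"
      using g by (cases M rule: m2_cases) (simp add: gs_def inv_m2 phi_def field_simps)
    then show ?thesis
      using y M conjugate_det_trace(1)[OF Gstar_invertible(1)] by (simp add: Gprime_def)
  qed
  ultimately show ?case
    using zariski_open_Int[OF U(1) V] U(3) by (intro exI[of _ "U \<inter> ?V"]) blast
qed

lemma Q_diagram_generic_lift:
  assumes D: "D \<in> colored_diagrams (Q_ell \<sigma> l) (BQ \<sigma> l)"
  shows "\<exists>Z\<in>G_ell \<sigma> l. \<forall>x\<in>Z.
    map_diagram (act_ell x) D \<in> Q_diagram ` colored_diagrams (Y_ell \<sigma> l) (B_ell \<sigma> l)"
proof -
  have w: "w \<in> words (Q_ell \<sigma> l)" if "w \<in> set (levels D)" for w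
    using that D by (simp add: colored_diagrams_iff)
  have "finite (bwd.diagram_regions (mat 1) D)"
    by (simp add: bwd.diagram_regions_def bwd.finite_regions)
  moreover have "\<forall>M\<in>bwd.diagram_regions (mat 1) D. det M = 1"
    using bwd.regions_closed[of "mat 1", OF _ w] by (fastforce simp: bwd.diagram_regions_def)
  ultimately obtain U where U: "zariski_open U" "U \<noteq> {}"
    "\<And>y M. y \<in> U \<Longrightarrow> M \<in> bwd.diagram_regions (mat 1) D \<Longrightarrow>
      phi_plus y ** M ** matrix_inv (phi_plus y) \<in> Gprime"
    using zariski_open_conj_in_Gprime by meson
  show ?thesis
  proof (intro bexI ballI)
    show "(U \<times> UNIV) \<inter> Y_ell \<sigma> l \<in> G_ell \<sigma> l" using U(1,2) unfolding G_ell_def by blast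
    fix x assume x: "x \<in> (U \<times> UNIV) \<inter> Y_ell \<sigma> l"
    obtain y z where xy: "x = (y, z)" by (metis surj_pair)
    have y: "y \<in> U" "y \<in> Gstar" using x zariski_open_subset[OF U(1)] by (auto simp: xy)
    let ?D = "map_diagram (act_ell x) D"
    have c: "?D \<in> colored_diagrams (Q_ell \<sigma> l) (BQ \<sigma> l)"
      using x D by (intro map_diagram_act_ell_colored) auto
    have lv: "levels ?D = map (map (map_prod (act_ell x) id)) (levels D)" by (cases D) simp
    \<comment> \<open>The leftmost region keeps the label 1, so the labels of the translated diagram
      are the conjugates of those of \<open>D\<close>.\<close>
    have one: "phi_plus y ** mat 1 ** matrix_inv (phi_plus y) = mat 1"
      using y by (simp add: matrix_inv_cancel Gstar_invertible)
    have "bwd.regions (mat 1) (map (map_prod (act_ell x) id) w) \<subseteq> Gprime"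
      if "w \<in> set (levels D)" for w
    proof -
      have "bwd.regions (mat 1) w \<subseteq> bwd.diagram_regions (mat 1) D"
        using that by (auto simp: bwd.diagram_regions_def)
      then show ?thesis
        using bwd_regions_act_ell[OF y(2) w[OF that], of "mat 1" z] U(3)[OF y(1)]
        unfolding one xy by auto
    qed
    then have "bwd.diagram_regions (mat 1) ?D \<subseteq> Gprime"
      by (auto simp: bwd.diagram_regions_def lv)
    from Q_diagram_bwd[OF c this]
    show "?D \<in> Q_diagram ` colored_diagrams (Y_ell \<sigma> l) (B_ell \<sigma> l)" by (metis image_eqI)
  qed
qed

lemma factorization_ell:
  assumes "\<sigma> \<noteq> 0" "rr l > 0"
  shows "generic_biquandle_factorization (Y_ell \<sigma> l) (G_ell \<sigma> l) (B_ell \<sigma> l)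
    Q_object Q_diagram act_ell (Q_ell \<sigma> l) conj_op"
  unfolding generic_biquandle_factorization_def Let_def
  using quandle_Q_ell generic_biquandle_ell[OF assms] quandle_aut_act_ell Q_functor
    Q_diagram_colored map_diagram_Q_diagram inj_on_Q_diagram inj_on_Q_map Q_object_Cons
    Q_diagram_generic_lift
  by (intro conjI ballI allI) blast+

section \<open>Inclusion of the quandles and the sign of the exceptional trace\<close>

lemma exceptional_trace: "trace (exceptional_matrix l) = 2 * (- 1) ^ (rr l - 1)"
  by (simp add: exceptional_matrix_def mat_eq_m2)

text \<open>Both sets are quandles under conjugation, so only the inclusion is in question, and only
  the exceptional point can violate it.\<close>

lemma subquandle_ell_iff:
  "subquandle (Q_ell \<sigma> l) (conj_Cb \<sigma> (rr l)) conj_op \<longleftrightarrow>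
    2 * (- 1) ^ (rr l - 1) = \<sigma> * poly (Cb (rr l)) (2 * (- 1) ^ (l - 1))"
proof -
  have "quandle (conj_Cb \<sigma> (rr l)) conj_op"
    by (rule quandle_conj_op) (auto simp: conj_Cb_def invertible_det_one conjugate_det_trace)
  moreover have "Q_ell \<sigma> l \<subseteq> conj_Cb \<sigma> (rr l) \<longleftrightarrow>
      (exceptional_matrix l, exceptional_value l) \<in> conj_Cb \<sigma> (rr l)"
    by (auto simp: Q_ell_def)
  ultimately show ?thesis
    using exceptional_in_Gprime[of l] quandle_Q_ell[of \<sigma> l]
    by (simp add: subquandle_def conj_Cb_def Gprime_def exceptional_trace exceptional_value_def)
qed

text \<open>For even \<open>l\<close> the argument is -2, where the polynomial takes the value 2
  (-1)^r, of sign opposite to the exceptional trace. For odd \<open>l\<close> the argument is 2 and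
  r - 1 = l - 1 is even, so all signs are trivial.\<close>

lemma exceptional_Cb:
  assumes "l \<ge> 3"
  shows "poly (Cb (rr l)) (2 * (- 1) ^ (l - 1)) = (- 1) ^ (l - 1) * (2 * (- 1) ^ (rr l - 1))"
proof (cases "even l")
  case True
  then obtain n where n: "l = 2 * Suc n" using assms by (metis evenE not0_implies_Suc mult_0_right not_numeral_le_zero)
  then show ?thesis by (simp add: rr_def Cb_at_minus_2)
next
  case False
  then show ?thesis by (simp add: rr_def Cb_at_2)
qed

theorem theorem5p6:
  fixes l :: nat
  assumes "l \<ge> 3"
  shows "generic_biquandle_factorization (Y_ell 1 l) (G_ell 1 l) (B_ell 1 l)
           Q_object Q_diagram act_ell (Q_ell 1 l) conj_op \<and>
         (subquandle (Q_ell 1 l) (conj_Cb 1 (rr l)) conj_op \<longleftrightarrow> odd l) \<and>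
         (let \<sigma> = (-1) ^ (l - 1) in
            generic_biquandle_factorization (Y_ell \<sigma> l) (G_ell \<sigma> l) (B_ell \<sigma> l)
              Q_object Q_diagram act_ell (Q_ell \<sigma> l) conj_op \<and>
            subquandle (Q_ell \<sigma> l) (conj_Cb \<sigma> (rr l)) conj_op)"
proof -
  have r: "rr l > 0" using assms by (auto simp: rr_def)
  have "subquandle (Q_ell 1 l) (conj_Cb 1 (rr l)) conj_op \<longleftrightarrow> odd l"
    using assms unfolding subquandle_ell_iff exceptional_Cb[OF assms] by (cases "even l") auto
  \<comment> \<open>With this \<sigma> the sign from \<open>exceptional_Cb\<close> occurs twice and
    cancels, whereas with \<sigma> = 1 it survives for even \<open>l\<close>.\<close>
  moreover have "subquandle (Q_ell ((-1) ^ (l - 1)) l) (conj_Cb ((-1) ^ (l - 1)) (rr l)) conj_op"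
    using assms unfolding subquandle_ell_iff exceptional_Cb[OF assms] by (cases "even l") auto
  ultimately show ?thesis
    using factorization_ell[OF _ r] by (simp add: Let_def)
qed

end
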